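(* Let $K$ be a quadratic field with discriminant $\Delta_K$, let $\chi$ be the Dirichlet character attached to $K/\mathbb{Q}$, and assume that $d=\Delta_K>0$. Let $$q_1(s)=\frac{\zeta(2s)}{\zeta(s)L(s,\chi)}\prod_{p\mid d}(1+p^{-s}),\qquad q_2(s)=\frac{L(s,\chi)}{\zeta(s)}\prod_{p\mid d}(1-p^{-s})^{-1}.$$ Then, for each even natural number $n\ge 2$, $$q_1(n)=-\frac{2d^n}{\binom{2n}{n}\sqrt d}\,\frac{B_{2n}}{B_{n,\chi}B_{n}}\prod_{p\mid d}(1+p^{-n}),$$ $$q_2(n)=\frac{\sqrt d}{d^n}\,\frac{B_{n,\chi}}{B_n}\prod_{p\mid d}(1-p^{-n})^{-1}.$$
   Context: The Dirichlet character attached to the quadratic field $K$ is the primitive quadratic character modulo $|\Delta_K|$ given by the Kronecker symbol $\chi(n)=\left(\frac{\Delta_K}{n}\right)$. $\zeta$ is the Riemann zeta function and $L(s,\chi)$ is the Dirichlet $L$-function of $\chi$. Products are over primes $p$ dividing $d$. $B_n$ are the Bernoulli numbers, $\frac{t}{e^t-1}=\sum_{n\ge0}B_n\frac{t^n}{n!}$, and $B_{n,\chi}$ are the generalized Bernoulli numbers of the character $\chi$ modulo $d$, defined by $$\sum_{a=1}^d\chi(a)\frac{te^{at}}{e^{dt}-1}=\sum_{n=0}^{\infty}B_{n,\chi}\frac{t^n}{n!}.$$ *)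

theory Defs
  imports
    "HOL-Analysis.Analysis"
    "HOL-Computational_Algebra.Computational_Algebra"
    "HOL-Number_Theory.Number_Theory"
begin

section \<open>Quadratic fields and their discriminants\<close>

text \<open>
  A field of characteristic 0 is represented as a subfield \<^term>\<open>K\<close> of an arbitrary type of
  class \<^class>\<open>field_char_0\<close>; the case where \<^term>\<open>K\<close> is the whole type is included.
\<close>

interpretation rat_vs: vector_space "\<lambda>(q::rat) (x::'a::field_char_0). of_rat q * x"
  by unfold_locales (simp_all add: algebra_simps of_rat_add of_rat_mult)

definition is_subfield :: "'a::field set \<Rightarrow> bool" where
  "is_subfield K \<longleftrightarrow>
     0 \<in> K \<and> 1 \<in> K \<and>
     (\<forall>x\<in>K. \<forall>y\<in>K. x + y \<in> K \<and> x * y \<in> K) \<and>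
     (\<forall>x\<in>K. - x \<in> K \<and> inverse x \<in> K)"

definition quadratic_field :: "'a::field_char_0 set \<Rightarrow> bool" where
  "quadratic_field K \<longleftrightarrow> is_subfield K \<and> rat_vs.dim K = 2"

definition ring_of_integers :: "'a::field_char_0 set \<Rightarrow> 'a set" where
  "ring_of_integers K = {x \<in> K. algebraic_int x}"

text \<open>
  The trace of the \<open>\<rat>\<close>-linear map \<open>y \<mapsto> x * y\<close> on \<^term>\<open>K\<close>, computed in some
  \<open>\<rat>\<close>-basis of \<^term>\<open>K\<close>; \<^term>\<open>rat_vs.representation B v b\<close> is the \<open>b\<close>-coordinate of \<open>v\<close>.
\<close>

definition field_trace :: "'a::field_char_0 set \<Rightarrow> 'a \<Rightarrow> rat" where
  "field_trace K x =
     (let B = (SOME B. \<not> rat_vs.dependent B \<and> rat_vs.span B = K)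
      in \<Sum>b\<in>B. rat_vs.representation B (x * b) b)"

definition integral_basis2 :: "'a::field_char_0 set \<Rightarrow> 'a \<Rightarrow> 'a \<Rightarrow> bool" where
  "integral_basis2 K w1 w2 \<longleftrightarrow>
     ring_of_integers K = {of_int a * w1 + of_int b * w2 | a b. True} \<and>
     (\<forall>a b. of_int a * w1 + of_int b * w2 = 0 \<longrightarrow> a = 0 \<and> b = 0)"

text \<open>The determinant of the trace form on an integral basis.\<close>

definition quadratic_disc :: "'a::field_char_0 set \<Rightarrow> int" where
  "quadratic_disc K =
     (THE D. \<exists>w1 w2. integral_basis2 K w1 w2 \<and>
        of_int D = field_trace K (w1 * w1) * field_trace K (w2 * w2)
                   - field_trace K (w1 * w2) * field_trace K (w2 * w1))"

section \<open>The Kronecker symbol and the attached character\<close>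

definition kronecker_prime :: "int \<Rightarrow> int \<Rightarrow> int" where
  "kronecker_prime a p =
     (if p = 2 then (if even a then 0 else if a mod 8 \<in> {1, 7} then 1 else -1)
      else Legendre a p)"

text \<open>For \<open>n \<noteq> 0\<close> the first factor is the value at the unit part of \<open>n\<close>, with \<open>(a/-1) = -1\<close>
  precisely if \<open>a < 0\<close>.\<close>

definition kronecker_symbol :: "int \<Rightarrow> int \<Rightarrow> int" where
  "kronecker_symbol a n =
     (if n = 0 then (if \<bar>a\<bar> = 1 then 1 else 0)
      else (if n < 0 \<and> a < 0 then -1 else 1) *
           (\<Prod>p\<in>prime_factors n. kronecker_prime a p ^ multiplicity p n))"

definition attached_character :: "'a::field_char_0 set \<Rightarrow> nat \<Rightarrow> complex" where
  "attached_character K n = of_int (kronecker_symbol (quadratic_disc K) (int n))"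

section \<open>Zeta and L-functions\<close>

text \<open>Both are given by their Dirichlet series, hence meaningful only for \<open>Re s > 1\<close>.\<close>

definition riemann_zeta :: "complex \<Rightarrow> complex" where
  "riemann_zeta s = (\<Sum>n. of_nat (Suc n) powr (- s))"

definition dirichlet_L :: "(nat \<Rightarrow> complex) \<Rightarrow> complex \<Rightarrow> complex" where
  "dirichlet_L chi s = (\<Sum>n. chi (Suc n) * of_nat (Suc n) powr (- s))"

definition q1 :: "nat \<Rightarrow> (nat \<Rightarrow> complex) \<Rightarrow> complex \<Rightarrow> complex" where
  "q1 d chi s = riemann_zeta (2 * s) / (riemann_zeta s * dirichlet_L chi s) *
     (\<Prod>p | prime p \<and> p dvd d. 1 + of_nat p powr (- s))"

definition q2 :: "nat \<Rightarrow> (nat \<Rightarrow> complex) \<Rightarrow> complex \<Rightarrow> complex" where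
  "q2 d chi s = dirichlet_L chi s / riemann_zeta s *
     (\<Prod>p | prime p \<and> p dvd d. inverse (1 - of_nat p powr (- s)))"

section \<open>Bernoulli numbers\<close>

text \<open>
  The denominators below have subdegree 1 and the numerators subdegree at least 1, so
  division of formal power series is exact.
\<close>

definition bernoulli_number :: "nat \<Rightarrow> complex" where
  "bernoulli_number n = fact n * fps_nth (fps_X / (fps_exp 1 - 1)) n"

definition gen_bernoulli_number :: "nat \<Rightarrow> (nat \<Rightarrow> complex) \<Rightarrow> nat \<Rightarrow> complex" where
  "gen_bernoulli_number d chi n = fact n *
     fps_nth (\<Sum>a=1..d. fps_const (chi a) *
                (fps_X * fps_exp (of_nat a) / (fps_exp (of_nat d) - 1))) n"

end

theory Submission
  imports Defs
begin

text \<open>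
  Both identities follow from the evaluations
  \<open>B\<^sub>n / n! = - 2 (i / 2\<pi>)\<^sup>n \<zeta>(n)\<close> and
  \<open>B\<^bsub>n,\<chi>\<^esub> / n! = - 2 (i / 2\<pi>)\<^sup>n d\<^sup>n L(n, \<chi>) / \<surd>d\<close> for even \<open>n \<ge> 2\<close>.
  A finite Fourier transform writes \<open>\<Sum>\<^sub>a \<chi>(a) e\<^bsup>at\<^esup> / (e\<^bsup>dt\<^esup> - 1)\<close> as
  \<open>(\<tau> / d) \<Sum>\<^sub>k \<chi>(k) / (\<omega>\<^sup>-\<^sup>k e\<^sup>t - 1)\<close> with \<open>\<omega> = e\<^bsup>2\<pi>i/d\<^esup>\<close> and \<open>\<tau>\<close> the Gauss sum of \<open>\<chi>\<close>;
  each summand is a cotangent, hence by the reflection formula of the digamma function its Taylor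
  coefficients are sums \<open>\<Sum>\<^sub>j (k/d + j)\<^sup>-\<^sup>n\<close>.  The case of \<open>\<zeta>\<close> comes from \<open>-1 / (e\<^sup>t + 1)\<close>.

  The remaining arithmetic input is \<open>\<tau> = \<surd>d\<close>.  Quadratic reciprocity turns the Kronecker symbol of
  a fundamental discriminant into a product of characters belonging to prime discriminants, and
  the Gauss sums multiply up to the sign given by reciprocity.  For an odd prime \<open>p\<close>
  only the sign of \<open>\<tau>\<close> is in question; as in Estermann's proof it is enough to show
  \<open>1 + 2 \<Sum>\<^bsub>0 < x < p\<^esub> cos (\<pi> x\<^sup>2 / 2p) > - \<surd>p\<close>, where the terms with \<open>x \<le> \<surd>p\<close> are nonnegative
  and the others oscillate.
\<close>

section \<open>Bernoulli numbers and Dirichlet series at even integers\<close>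

text \<open>The sign of the Gauss sum cannot be avoided: each right-hand side pairs one generalized
  Bernoulli number with one \<open>sqrt d\<close>, so the square of the Gauss sum alone would leave
  both formulas undetermined up to sign. The sign survives products because every Gauss sum is
  normalised as a principal root \<open>csqrt D\<close>, also for D < 0. A positive discriminant
  such as 12 = (-4)(-3) can have negative factors, and \<open>csqrt (D * E)\<close> differs from
  \<open>csqrt D * csqrt E\<close> by exactly the sign that reciprocity produces. The detour for
  zeta is forced by the open strip \<open>0 < Re w < 1\<close> of the digamma formula:
  \<open>1 / (exp t - 1)\<close> would belong to x = 0, where it has a pole at t = 0. The choice x =
  1/2 costs a factor \<open>2 ^ n - 1\<close>, which cancels in the end. The discriminant is defined
  through an arbitrary rational basis (for the trace) and an arbitrary integral basis, so the ring
  of integers has to be determined before the character can be tied to a squarefree number.\<close>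

lemma strip_not_nonpos_Ints:
  fixes z :: complex
  assumes "0 < Re z" "Re z < 1"
  shows "z \<notin> \<int>\<^sub>\<le>\<^sub>0" "1 - z \<notin> \<int>\<^sub>\<le>\<^sub>0"
proof -
  show "z \<notin> \<int>\<^sub>\<le>\<^sub>0" using assms by (auto elim!: nonpos_Ints_cases)
  show "1 - z \<notin> \<int>\<^sub>\<le>\<^sub>0"
  proof
    assume "1 - z \<in> \<int>\<^sub>\<le>\<^sub>0"
    then obtain n where "1 - z = of_int n" "n \<le> 0" by (auto elim: nonpos_Ints_cases)
    from arg_cong[OF this(1), of Re] this(2) assms show False by simp
  qed
qed

lemma sin_pi_strip_nonzero:
  fixes w :: complex
  assumes "0 < Re w" "Re w < 1"
  shows "sin (of_real pi * w) \<noteq> 0"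
proof
  assume "sin (of_real pi * w) = 0"
  then obtain n :: int where "of_real pi * w = of_real (real_of_int n * pi)"
    by (auto simp: sin_eq_0)
  hence "w = of_int n" by (simp add: mult.commute)
  thus False using assms by auto
qed

text \<open>This is the logarithmic derivative of
  \<open>Gamma z * Gamma (1 - z) = pi / sin (pi * z)\<close>. Both sides are differentiated as they
  stand and the nonvanishing Gamma product is cancelled, so no branch of the logarithm has to be
  chosen.\<close>

lemma Digamma_reflection:
  fixes w :: complex
  assumes "0 < Re w" "Re w < 1"
  shows "Digamma (1 - w) - Digamma w = of_real pi * (cos (of_real pi * w) / sin (of_real pi * w))"
proof -
  define S where "S = {w. 0 < Re w \<and> Re w < 1}"
  have oS: "open S"
    unfolding S_def by (intro open_Collect_conj open_Collect_less continuous_intros)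
  have nz: "z \<notin> \<int>\<^sub>\<le>\<^sub>0" "1 - z \<notin> \<int>\<^sub>\<le>\<^sub>0" if "z \<in> S" for z
    using that strip_not_nonpos_Ints[of z] by (auto simp: S_def)
  have sn: "sin (of_real pi * z) \<noteq> 0" if "z \<in> S" for z
    using that sin_pi_strip_nonzero[of z] by (simp add: S_def)
  have w: "w \<in> S" using assms by (simp add: S_def)
  let ?g = "\<lambda>z. Gamma z * Gamma (1 - z) :: complex"
  let ?h = "\<lambda>z. of_real pi / sin (of_real pi * z) :: complex"
  have d1: "(?g has_field_derivative (?g w * (Digamma w - Digamma (1 - w)))) (at w)"
    using nz[OF w] by (auto intro!: derivative_eq_intros simp: algebra_simps)
  have "(?h has_field_derivative (- (?h w * (of_real pi * (cos (of_real pi * w) / sin (of_real pi * w)))))) (at w)"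
    using sn[OF w] by (auto intro!: derivative_eq_intros simp: field_simps power2_eq_square)
  moreover have "\<And>z. z \<in> S \<Longrightarrow> ?h z = ?g z"
    by (simp add: Gamma_reflection_complex)
  ultimately have d2: "(?g has_field_derivative (- (?h w * (of_real pi * (cos (of_real pi * w) / sin (of_real pi * w)))))) (at w)"
    using has_field_derivative_transform_within_open[OF _ oS w, of ?h _ ?g] by blast
  have "?g w * (Digamma w - Digamma (1 - w)) = - (?h w * (of_real pi * (cos (of_real pi * w) / sin (of_real pi * w))))"
    by (rule DERIV_unique[OF d1 d2])
  also have "?h w = ?g w" by (simp add: Gamma_reflection_complex)
  finally have "?g w * (Digamma (1 - w) - Digamma w) = ?g w * (of_real pi * (cos (of_real pi * w) / sin (of_real pi * w)))"
    by (simp add: algebra_simps)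
  moreover have "?g w \<noteq> 0" using nz[OF w] by (auto simp: Gamma_eq_zero_iff)
  ultimately show ?thesis using mult_left_cancel by blast
qed

text \<open>The point \<open>w\<close> is chosen so that the left side is
  \<open>1 / (exp (- 2 * pi * i * w) - 1)\<close>. With \<open>z = exp (i * pi * w)\<close> this is
  a rational function of \<open>z\<close>, namely -1/2 plus i/2 times the cotangent of
  \<open>pi * w\<close>.\<close>

lemma inverse_exp_minus_1_eq_Digamma:
  fixes t :: complex and x :: real
  defines "w \<equiv> of_real x + \<i> * t / (2 * of_real pi)"
  assumes "0 < Re w" "Re w < 1"
  shows "inverse (cis (- 2 * pi * x) * exp t - 1) =
           - (1 / 2) + \<i> / (2 * of_real pi) * (Digamma (1 - w) - Digamma w)"
proof -
  have sn: "sin (of_real pi * w) \<noteq> 0"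
    by (rule sin_pi_strip_nonzero[OF assms(2,3)])
  define z where "z = exp (\<i> * (of_real pi * w))"
  have z: "z \<noteq> 0" by (simp add: z_def)
  have "cis (- 2 * pi * x) * exp t = exp (- 2 * (\<i> * (of_real pi * w)))"
    unfolding cis_conv_exp exp_add[symmetric]
    by (rule arg_cong[of _ _ exp]) (simp add: w_def distrib_left mult_ac)
  also have "\<dots> = inverse (z * z)"
    by (simp add: z_def exp_minus exp_double power2_eq_square)
  finally have 1: "cis (- 2 * pi * x) * exp t = inverse (z * z)" .
  have s: "sin (of_real pi * w) = (z - inverse z) / (2 * \<i>)"
   and c: "cos (of_real pi * w) = (z + inverse z) / 2"
    by (simp_all add: sin_exp_eq cos_exp_eq z_def exp_minus)
  have zz: "z * z \<noteq> 1"
  proof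
    assume "z * z = 1"
    hence "z = inverse z" using z by (simp add: field_simps)
    thus False using sn s by simp
  qed
  have "inverse (inverse (z * z) - 1) = - (1 / 2) + \<i> / 2 * (cos (of_real pi * w) / sin (of_real pi * w))"
    unfolding s c using z zz by (simp add: field_simps)
  thus ?thesis unfolding 1 Digamma_reflection[OF assms(2,3)] by simp
qed

section \<open>Hurwitz zeta values and Dirichlet series\<close>

definition hurwitz_sum :: "nat \<Rightarrow> real \<Rightarrow> complex" where
  "hurwitz_sum n x = (\<Sum>k. inverse ((of_real x + of_nat k) ^ n))"

lemma hurwitz_sum_sums:
  assumes "n \<ge> 2" "x > 0"
  shows "(\<lambda>k. inverse ((of_real x + of_nat k) ^ n)) sums hurwitz_sum n x"
    and "Polygamma (n - 1) (complex_of_real x) = (-1) ^ n * fact (n - 1) * hurwitz_sum n x"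
proof -
  have "(\<lambda>k. inverse ((complex_of_real x + of_nat k) ^ Suc (n - 1))) sums
          ((-1) ^ Suc (n - 1) * Polygamma (n - 1) (of_real x) / fact (n - 1))"
    using assms by (intro Polygamma_LIMSEQ) auto
  hence *: "(\<lambda>k. inverse ((complex_of_real x + of_nat k) ^ n)) sums
          ((-1) ^ n * Polygamma (n - 1) (of_real x) / fact (n - 1))"
    using assms by simp
  thus s: "(\<lambda>k. inverse ((of_real x + of_nat k) ^ n)) sums hurwitz_sum n x"
    unfolding hurwitz_sum_def using sums_summable summable_sums by blast
  have "hurwitz_sum n x = (-1) ^ n * Polygamma (n - 1) (of_real x) / fact (n - 1)"
    using sums_unique2[OF s *] .
  thus "Polygamma (n - 1) (complex_of_real x) = (-1) ^ n * fact (n - 1) * hurwitz_sum n x"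
    by (simp flip: power_mult_distrib add: mult.assoc[symmetric])
qed

text \<open>Differentiating the digamma formula n - 1 times at t = 0 gives two polygamma values, at
  x and 1 - x. For even n the inner derivative -1 of \<open>1 - w\<close> contributes an odd power,
  so the two values add up instead of cancelling.\<close>

lemma fps_nth_inverse_exp_minus_1:
  fixes x :: real
  assumes x: "0 < x" "x < 1" and n: "n \<ge> 2" "even n"
  shows "fps_nth (inverse (fps_const (cis (- 2 * pi * x)) * fps_exp 1 - 1)) (n - 1) =
           - ((\<i> / (2 * of_real pi)) ^ n) * (hurwitz_sum n x + hurwitz_sum n (1 - x))"
proof -
  define c where "c = \<i> / (2 * of_real pi)"
  define w where "w = (\<lambda>t. of_real x + \<i> * t / (2 * of_real pi))"
  define S where "S = {t. 0 < Re (w t) \<and> Re (w t) < 1}"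
  \<comment> \<open>Closed form of the derivative of order m: each differentiation yields a factor
    \<open>c\<close>, the derivative of \<open>w\<close>, and one more -1 in the term with
    \<open>1 - w\<close>; the constant -1/2 survives only for m = 0.\<close>
  define h where "h = (\<lambda>m t. (if m = 0 then - (1 / 2) else 0) +
     c ^ Suc m * ((-1) ^ m * Polygamma m (1 - w t) - Polygamma m (w t)))"
  let ?f = "\<lambda>t. inverse (cis (- 2 * pi * x) * exp t - 1)"
  have oS: "open S"
    unfolding S_def w_def by (intro open_Collect_conj open_Collect_less continuous_intros) auto
  have S0: "0 \<in> S" using x by (simp add: S_def w_def)
  have d: "deriv (h m) t = h (Suc m) t" if "t \<in> S" for m t
  proof -
    have "(w has_field_derivative c) (at t)"
      unfolding w_def c_def by (auto intro!: derivative_eq_intros)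
    hence "(h m has_field_derivative h (Suc m) t) (at t)"
      unfolding h_def using that strip_not_nonpos_Ints[of "w t"] unfolding S_def
      by (auto intro!: derivative_eq_intros simp: algebra_simps)
    thus ?thesis by (rule DERIV_imp_deriv)
  qed
  have hd: "(deriv ^^ m) ?f t = h m t" if "t \<in> S" for m t
    using that
  proof (induction m arbitrary: t)
    case 0
    thus ?case using inverse_exp_minus_1_eq_Digamma[of x t]
      by (simp add: S_def w_def h_def c_def)
  next
    case (Suc m)
    have "eventually (\<lambda>t. t \<in> S) (nhds t)"
      using oS Suc.prems by (simp add: eventually_nhds_in_open)
    hence "deriv ((deriv ^^ m) ?f) t = deriv (h m) t"
      by (intro deriv_cong_ev refl) (rule eventually_mono, assumption, rule Suc.IH)
    thus ?case using d[OF Suc.prems] by simp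
  qed
  \<comment> \<open>The constant term of the formal series is nonzero, so its formal inverse is the
    Taylor expansion of the analytic one.\<close>
  have cis1: "cis (- 2 * pi * x) \<noteq> 1"
  proof
    assume "cis (- 2 * pi * x) = 1"
    hence "cos (2 * pi * x) = 1" by (auto simp: complex_eq_iff)
    then obtain k :: int where "2 * pi * x = real_of_int k * 2 * pi" by (auto simp: cos_one_2pi_int)
    hence "x = of_int k" by simp
    thus False using x by simp
  qed
  have "?f has_fps_expansion inverse (fps_const (cis (- 2 * pi * x)) * fps_exp 1 - 1)"
    using cis1 by (intro fps_expansion_intros) auto
  from fps_nth_fps_expansion[OF this, of "n - 1"]
  have "fps_nth (inverse (fps_const (cis (- 2 * pi * x)) * fps_exp 1 - 1)) (n - 1) =
          h (n - 1) 0 / fact (n - 1)"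
    using hd[OF S0] by simp
  also have "h (n - 1) 0 = - (c ^ n * (Polygamma (n - 1) (of_real (1 - x)) + Polygamma (n - 1) (of_real x)))"
  proof -
    have "c ^ n = c * c ^ (n - 1)" using n by (subst power_Suc[symmetric]) simp
    moreover have "(-1 :: complex) ^ (n - 1) = -1" "n - 1 \<noteq> 0" using n by auto
    moreover have "w 0 = of_real x" by (simp add: w_def)
    ultimately show ?thesis by (simp add: h_def algebra_simps del: One_nat_def)
  qed
  also have "\<dots> = - (c ^ n * (fact (n - 1) * (hurwitz_sum n (1 - x) + hurwitz_sum n x)))"
    using n x by (simp only: hurwitz_sum_sums(2)) (simp add: hurwitz_sum_sums(2) algebra_simps)
  also have "\<dots> / fact (n - 1) = - (c ^ n * (hurwitz_sum n (1 - x) + hurwitz_sum n x))" by simp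
  finally show ?thesis by (simp only: c_def add.commute mult_minus_left)
qed


lemma hurwitz_sum_grouped:
  fixes f :: "nat \<Rightarrow> complex"
  assumes N: "N > 0" and n: "n \<ge> 2" and per: "\<And>k. f (k + N) = f k"
    and sm: "summable (\<lambda>m. f (Suc m) * inverse (of_nat (Suc m) ^ n))"
  shows "(\<Sum>m. f (Suc m) * inverse (of_nat (Suc m) ^ n)) =
           inverse (of_nat N ^ n) * (\<Sum>k=1..N. f k * hurwitz_sum n (real k / real N))"
proof -
  let ?g = "\<lambda>m. f (Suc m) * inverse (of_nat (Suc m) ^ n)"
  have per': "f (j * N + k) = f k" for j k
  proof (induction j)
    case (Suc j)
    have "f (Suc j * N + k) = f ((j * N + k) + N)" by (simp add: algebra_simps)
    thus ?case using Suc by (simp only: per)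
  qed simp
  have "(\<lambda>j. sum ?g {j * N..<j * N + N}) sums (\<Sum>m. ?g m)"
    by (rule sums_group[OF summable_sums[OF sm] N])
  also have "(\<lambda>j. sum ?g {j * N..<j * N + N}) =
               (\<lambda>j. \<Sum>k=1..N. inverse (of_nat N ^ n) * (f k * inverse ((of_real (real k / real N) + of_nat j) ^ n)))"
  proof
    fix j
    \<comment> \<open>The term of index m belongs to the integer m + 1, so block j covers
      \<open>j * N + 1\<close> to \<open>j * N + N\<close>. Hence k runs over 1..N and
      \<open>k / N\<close> stays positive.\<close>
    have "sum ?g {j * N..<j * N + N} = (\<Sum>k=1..N. f (j * N + k) * inverse (of_nat (j * N + k) ^ n))"
      by (rule sum.reindex_bij_witness[of _ "\<lambda>k. j * N + k - 1" "\<lambda>m. Suc m - j * N"]) auto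
    also have "\<dots> = (\<Sum>k=1..N. inverse (of_nat N ^ n) * (f k * inverse ((of_real (real k / real N) + of_nat j) ^ n)))"
    proof (rule sum.cong[OF refl])
      fix k assume "k \<in> {1..N}"
      have "complex_of_nat (j * N + k) = of_nat N * (of_real (real k / real N) + of_nat j)"
        using N by (simp add: field_simps)
      thus "f (j * N + k) * inverse (of_nat (j * N + k) ^ n) =
              inverse (of_nat N ^ n) * (f k * inverse ((of_real (real k / real N) + of_nat j) ^ n))"
        by (simp only: per' power_mult_distrib inverse_mult_distrib) (simp only: mult_ac)
    qed
    finally show "sum ?g {j * N..<j * N + N} = (\<Sum>k=1..N. inverse (of_nat N ^ n) * (f k * inverse ((of_real (real k / real N) + of_nat j) ^ n)))" .
  qed
  finally have 1: "\<dots> sums (\<Sum>m. ?g m)" .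
  have 2: "(\<lambda>j. \<Sum>k=1..N. inverse (of_nat N ^ n) * (f k * inverse ((of_real (real k / real N) + of_nat j) ^ n)))
          sums (\<Sum>k=1..N. inverse (of_nat N ^ n) * (f k * hurwitz_sum n (real k / real N)))"
    using N n by (intro sums_sum sums_mult hurwitz_sum_sums) auto
  show ?thesis using sums_unique2[OF 1 2] by (simp add: sum_distrib_left)
qed

lemma of_nat_powr_minus_of_nat: "m > 0 \<Longrightarrow> (of_nat m :: complex) powr (- of_nat n) = inverse (of_nat m ^ n)"
  by (simp add: powr_minus powr_nat)

lemma summable_dirichlet:
  fixes f :: "nat \<Rightarrow> complex"
  assumes "n \<ge> 2" "\<And>k. norm (f k) \<le> 1"
  shows "summable (\<lambda>m. f (Suc m) * inverse (of_nat (Suc m) ^ n))"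
proof (rule summable_comparison_test')
  show "summable (\<lambda>m. inverse (real (Suc m) ^ n))"
    using inverse_power_summable[OF assms(1), where ?'a = real] by (subst summable_Suc_iff) simp
  show "norm (f (Suc m) * inverse (of_nat (Suc m) ^ n)) \<le> inverse (real (Suc m) ^ n)" for m
    using mult_right_mono[OF assms(2)[of "Suc m"], of "inverse (real (Suc m) ^ n)"]
    by (simp add: norm_mult norm_inverse norm_power del: of_nat_Suc)
qed

lemma dirichlet_L_eq_hurwitz:
  assumes "N > 0" "n \<ge> 2" "\<And>k. chi (k + N) = chi k" "\<And>k. norm (chi k) \<le> 1"
  shows "dirichlet_L chi (of_nat n) =
           inverse (of_nat N ^ n) * (\<Sum>k=1..N. chi k * hurwitz_sum n (real k / real N))"
  unfolding dirichlet_L_def using hurwitz_sum_grouped[of N n chi] summable_dirichlet[of n chi] assms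
  by (simp add: of_nat_powr_minus_of_nat del: of_nat_Suc)

lemma riemann_zeta_eq_L: "riemann_zeta s = dirichlet_L (\<lambda>_. 1) s"
  by (simp add: riemann_zeta_def dirichlet_L_def)

text \<open>The constant function 1 has period 1 as well as period 2; comparing the two resulting
  expressions for zeta isolates the odd integers.\<close>

lemma hurwitz_sum_one_half:
  assumes "n \<ge> 2"
  shows "hurwitz_sum n (1 / 2) = (2 ^ n - 1) * riemann_zeta (of_nat n)"
proof -
  have "riemann_zeta (of_nat n) = hurwitz_sum n 1"
    using dirichlet_L_eq_hurwitz[of 1 n "\<lambda>_. 1"] assms by (simp add: riemann_zeta_eq_L)
  moreover have "riemann_zeta (of_nat n) = inverse (2 ^ n) * (hurwitz_sum n (1 / 2) + hurwitz_sum n 1)"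
    using dirichlet_L_eq_hurwitz[of 2 n "\<lambda>_. 1"] assms
    by (simp add: riemann_zeta_eq_L numeral_2_eq_2)
  ultimately show ?thesis by (simp add: field_simps)
qed

section \<open>Bernoulli numbers through formal power series\<close>

lemma fps_X_div_exp:
  fixes c :: complex
  assumes "c \<noteq> 0"
  shows "fps_X / (fps_exp c - 1) * (fps_exp c - 1) = (fps_X :: complex fps)"
    and "fps_exp c - 1 \<noteq> (0 :: complex fps)"
proof -
  have n1: "fps_nth (fps_exp c - 1) 1 \<noteq> 0" using assms by simp
  show nz: "fps_exp c - 1 \<noteq> (0 :: complex fps)" using n1 by (metis fps_zero_nth)
  have "subdegree (fps_exp c - 1) \<le> 1" using n1 by (rule subdegree_leI)
  hence "fps_exp c - 1 dvd (fps_X :: complex fps)"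
    using nz by (subst fps_dvd_iff) auto
  thus "fps_X / (fps_exp c - 1) * (fps_exp c - 1) = (fps_X :: complex fps)" by simp
qed

lemma bernoulli_number_eq_zeta:
  assumes n: "n \<ge> 2" "even n"
  shows "bernoulli_number n / fact n = - 2 * (\<i> / (2 * of_real pi)) ^ n * riemann_zeta (of_nat n)"
proof -
  define b :: "complex fps" where "b = fps_X / (fps_exp 1 - 1)"
  \<comment> \<open>This is \<open>2t / (exp (2t) - 1)\<close>. From
    \<open>2 / (exp (2t) - 1) - 1 / (exp t - 1) = - 1 / (exp t + 1)\<close> follows
    \<open>fps_X * G = b2 - b\<close>, whose coefficients are those of \<open>b\<close> times
    \<open>2 ^ n - 1\<close>.\<close>
  define b2 where "b2 = b oo (fps_const 2 * fps_X)"
  define G :: "complex fps" where "G = inverse (fps_const (cis (- 2 * pi * (1 / 2))) * fps_exp 1 - 1)"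
  let ?E = "fps_exp 1 :: complex fps"
  have b: "b * (?E - 1) = fps_X" unfolding b_def by (rule fps_X_div_exp) simp
  have EE: "fps_exp 2 = ?E * ?E" by (simp flip: fps_exp_add_mult)
  have "(b * (?E - 1)) oo (fps_const 2 * fps_X) = fps_X oo (fps_const 2 * fps_X)"
    by (simp only: b)
  hence "b2 * (fps_exp 2 - 1) = fps_const 2 * fps_X"
    by (simp add: b2_def fps_compose_mult_distrib fps_compose_sub_distrib fps_exp_compose_linear)
  hence b2: "b2 * ((?E - 1) * (?E + 1)) = 2 * fps_X"
    by (simp add: EE algebra_simps numeral_fps_const)
  have "cis (- 2 * pi * (1 / 2)) = -1" by (simp add: complex_eq_iff)
  hence "G = inverse (- (?E + 1))"
    unfolding G_def by (simp add: fps_const_neg[symmetric] del: fps_const_neg)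
  moreover have "inverse (- (?E + 1)) * (- (?E + 1)) = 1"
    by (rule inverse_mult_eq_1) simp
  ultimately have "G * (- (?E + 1)) = 1" by (simp only:)
  hence "- (G * (?E + 1)) = 1" by (simp only: mult_minus_right)
  hence G: "G * (?E + 1) = -1" by (metis minus_minus)
  have nz: "?E - 1 \<noteq> 0" by (rule fps_X_div_exp) simp
  have nz2: "?E + 1 \<noteq> 0"
  proof
    assume "?E + 1 = 0"
    hence "fps_nth (?E + 1) 0 = 0" by simp
    thus False by simp
  qed
  have "(fps_X * G) * ((?E - 1) * (?E + 1)) = fps_X * (?E - 1) * (G * (?E + 1))"
    by (simp only: mult_ac)
  also have "\<dots> = 2 * fps_X - fps_X * (?E + 1)" unfolding G by (simp add: algebra_simps)
  also have "\<dots> = (b2 - b) * ((?E - 1) * (?E + 1))"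
    by (subst b2[symmetric], subst b[symmetric]) (simp add: algebra_simps)
  finally have "fps_X * G = b2 - b" using nz nz2 by simp
  hence "fps_nth (fps_X * G) n = fps_nth (b2 - b) n" by simp
  moreover have "fps_nth b2 n = 2 ^ n * fps_nth b n"
    unfolding b2_def by (rule fps_nth_compose_linear)
  ultimately have "fps_nth G (n - 1) = (2 ^ n - 1) * fps_nth b n"
    using n by (simp add: algebra_simps)
  moreover have "fps_nth G (n - 1) = - ((\<i> / (2 * of_real pi)) ^ n) * (2 * ((2 ^ n - 1) * riemann_zeta (of_nat n)))"
    unfolding G_def using fps_nth_inverse_exp_minus_1[of "1/2" n] n hurwitz_sum_one_half[OF n(1)]
    by simp
  moreover have "(2 ^ n - 1 :: complex) \<noteq> 0"
  proof -
    have "(2::nat) ^ n \<noteq> 1" using n by simp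
    hence "complex_of_nat (2 ^ n) \<noteq> of_nat 1" by (simp only: of_nat_eq_iff not_False_eq_True)
    thus ?thesis by simp
  qed
  ultimately have "(2 ^ n - 1) * fps_nth b n = (2 ^ n - 1) * (- 2 * (\<i> / (2 * of_real pi)) ^ n * riemann_zeta (of_nat n))"
    and "(2 ^ n - 1 :: complex) \<noteq> 0"
    by (simp_all add: mult_ac)
  hence "fps_nth b n = - 2 * (\<i> / (2 * of_real pi)) ^ n * riemann_zeta (of_nat n)"
    using mult_left_cancel by blast
  thus ?thesis by (simp add: bernoulli_number_def b_def)
qed

lemma fps_const_sum: "fps_const (sum f A) = (\<Sum>x\<in>A. fps_const (f x))"
  by (rule fps_ext) (simp add: fps_sum_nth)

text \<open>The hypothesis \<open>gauss\<close> says that \<open>chi\<close> is its own finite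
  Fourier transform up to \<open>c\<close>; \<open>c * c = d\<close> turns the inverse of
  \<open>c\<close> into \<open>c / d\<close>. The generating function thereby becomes a combination
  of the series \<open>G k\<close> without pole at 0.\<close>

lemma gen_bernoulli_number_eq_L:
  fixes chi :: "nat \<Rightarrow> complex"
  assumes n: "n \<ge> 2" "even n" and d: "d > 1"
    and per: "\<And>k. chi (k + d) = chi k" and bd: "\<And>k. norm (chi k) \<le> 1"
    and chi0: "chi 0 = 0" and ev: "\<And>k. k \<le> d \<Longrightarrow> chi (d - k) = chi k"
    and gauss: "\<And>k. (\<Sum>a<d. chi a * cis (2 * pi * real a * real k / real d)) = c * chi k"
    and c: "c * c = of_nat d"
  shows "gen_bernoulli_number d chi n / fact n =
           - 2 * (c / of_nat d) * (\<i> / (2 * of_real pi)) ^ n * of_nat d ^ n * dirichlet_L chi (of_nat n)"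
proof -
  define w where "w = (\<lambda>k. cis (- 2 * pi * (real k / real d)))"
  define G where "G = (\<lambda>k. inverse (fps_const (w k) * fps_exp 1 - 1) :: complex fps)"
  let ?E = "\<lambda>a. fps_exp (of_nat a) :: complex fps"
  define Q where "Q = (fps_X / (?E d - 1) :: complex fps)"
  define S where "S = (\<Sum>a<d. fps_const (chi a) * ?E a)"
  have chid: "chi d = 0" using per[of 0] chi0 by simp
  have Q: "Q * (?E d - 1) = fps_X" and nz: "?E d - 1 \<noteq> (0 :: complex fps)"
    unfolding Q_def using fps_X_div_exp[of "of_nat d"] d by auto
  have w1: "w k \<noteq> 1" if "k \<in> {1..<d}" for k
  proof
    assume "w k = 1"
    hence "cos (2 * pi * (real k / real d)) = 1" by (auto simp: w_def complex_eq_iff)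
    then obtain j :: int where "2 * pi * (real k / real d) = real_of_int j * 2 * pi"
      by (auto simp: cos_one_2pi_int)
    hence "2 * pi * (real k / real d) = 2 * pi * of_int j" by (simp only: mult_ac)
    hence "real k / real d = of_int j" by (subst (asm) mult_left_cancel) simp_all
    moreover have "0 < real k / real d" "real k / real d < 1" using that d by auto
    ultimately show False by simp
  qed
  have wd: "w k ^ d = 1" for k
  proof -
    have "w k ^ d = cis (of_int (- int k) * (2 * pi))"
      unfolding w_def Complex.DeMoivre using d by (simp add: field_simps)
    also have "\<dots> = 1" using cis_multiple_2pi[of "of_int (- int k)"] by (simp add: mult_ac)
    finally show ?thesis .
  qed
  \<comment> \<open>A geometric sum: with \<open>z = w k * exp t\<close> the equation
    \<open>w k ^ d = 1\<close> gives \<open>exp (d * t) - 1 = z ^ d - 1\<close>.\<close>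
  have GE: "G k * (?E d - 1) = (\<Sum>j<d. fps_const (w k ^ j) * ?E j)" if "k \<in> {1..<d}" for k
  proof -
    let ?z = "fps_const (w k) * fps_exp 1 :: complex fps"
    have pow: "?z ^ j = fps_const (w k ^ j) * ?E j" for j
      by (simp add: power_mult_distrib fps_exp_power_mult fps_const_power)
    have "?E d - 1 = ?z ^ d - 1" by (simp add: pow wd)
    also have "\<dots> = (?z - 1) * (\<Sum>j<d. ?z ^ j)" by (rule power_diff_1_eq)
    also have "G k * \<dots> = (G k * (?z - 1)) * (\<Sum>j<d. ?z ^ j)" by (simp only: mult_ac)
    also have "G k * (?z - 1) = 1"
      unfolding G_def using w1[OF that] by (intro inverse_mult_eq_1) simp
    finally show ?thesis by (simp add: pow)
  qed
  \<comment> \<open>The roots \<open>w k\<close> carry a negative exponent, so j appears as the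
    frequency \<open>d - j\<close>; evenness of \<open>chi\<close> brings it back to j.\<close>
  have tau: "(\<Sum>k=1..<d. chi k * w k ^ j) = c * chi j" if "j < d" for j
  proof -
    have "(\<Sum>k=1..<d. chi k * w k ^ j) = (\<Sum>k<d. chi k * w k ^ j)"
      using chi0 d by (intro sum.mono_neutral_left) (auto simp: not_le)
    also have "\<dots> = (\<Sum>k<d. chi k * cis (2 * pi * real k * real (d - j) / real d))"
    proof (rule sum.cong[OF refl])
      fix k
      have "cis (2 * pi * real k * real (d - j) / real d) = cis (2 * pi * of_int (int k) + (- 2 * pi * real k * real j / real d))"
        using that d by (simp add: of_nat_diff field_simps)
      also have "\<dots> = cis (2 * pi * of_int (int k)) * cis (- 2 * pi * real k * real j / real d)" by (simp only: cis_mult)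
      also have "cis (2 * pi * of_int (int k)) = 1" by (rule cis_multiple_2pi) simp
      also have "1 * cis (- 2 * pi * real k * real j / real d) = w k ^ j"
        unfolding w_def Complex.DeMoivre by (simp add: field_simps)
      finally show "chi k * w k ^ j = chi k * cis (2 * pi * real k * real (d - j) / real d)" by simp
    qed
    also have "\<dots> = c * chi j" using gauss[of "d - j"] ev[of j] that by simp
    finally show ?thesis .
  qed
  have "(fps_const (c / of_nat d) * (\<Sum>k=1..<d. fps_const (chi k) * G k)) * (?E d - 1)
      = fps_const (c / of_nat d) * (\<Sum>k=1..<d. \<Sum>j<d. fps_const (chi k * w k ^ j) * ?E j)"
    by (simp add: sum_distrib_right sum_distrib_left mult.assoc GE flip: fps_const_mult)
  also have "\<dots> = fps_const (c / of_nat d) * (\<Sum>j<d. \<Sum>k=1..<d. fps_const (chi k * w k ^ j) * ?E j)"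
    by (subst sum.swap) rule
  also have "\<dots> = fps_const (c / of_nat d) * (\<Sum>j<d. fps_const (\<Sum>k=1..<d. chi k * w k ^ j) * ?E j)"
    by (simp add: sum_distrib_right fps_const_sum)
  also have "\<dots> = fps_const (c / of_nat d) * (\<Sum>j<d. fps_const (c * chi j) * ?E j)"
    by (intro arg_cong2[of _ _ _ _ times] sum.cong refl) (simp only: tau lessThan_iff)
  also have "\<dots> = fps_const (c / of_nat d * c) * S"
    unfolding S_def sum_distrib_left by (simp only: mult.assoc[symmetric] fps_const_mult)
  also have "c / of_nat d * c = 1" using c d by (simp add: field_simps)
  finally have S: "(fps_const (c / of_nat d) * (\<Sum>k=1..<d. fps_const (chi k) * G k)) * (?E d - 1) = S"
    by simp
  have dvdX: "fps_X * ?E a / (?E d - 1) = Q * ?E a" for a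
  proof -
    have "fps_X * ?E a = (Q * ?E a) * (?E d - 1)" by (subst Q[symmetric]) (simp only: mult_ac)
    thus ?thesis by (simp only: nonzero_mult_div_cancel_right[OF nz])
  qed
  have "(\<Sum>a=1..d. fps_const (chi a) * (fps_X * ?E a / (?E d - 1))) = (\<Sum>a=1..d. fps_const (chi a) * ?E a) * Q"
    by (simp add: dvdX sum_distrib_left sum_distrib_right mult_ac)
  \<comment> \<open>The range 1..d of the definition and the range 0..<d of the Fourier transform
    agree because \<open>chi\<close> vanishes at both 0 and d.\<close>
  also have "(\<Sum>a=1..d. fps_const (chi a) * ?E a) = (\<Sum>a=1..<d. fps_const (chi a) * ?E a)"
    using chid d by (intro sum.mono_neutral_right) auto
  also have "\<dots> = S"
    unfolding S_def using chi0 by (intro sum.mono_neutral_left) (auto simp: not_le)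
  also have "S * Q = fps_X * (fps_const (c / of_nat d) * (\<Sum>k=1..<d. fps_const (chi k) * G k))"
    by (subst S[symmetric], subst Q[symmetric]) (simp only: mult_ac)
  finally have "gen_bernoulli_number d chi n / fact n =
      c / of_nat d * (\<Sum>k=1..<d. chi k * fps_nth (G k) (n - 1))"
    unfolding gen_bernoulli_number_def using n by (simp add: fps_sum_nth)
  also have "(\<Sum>k=1..<d. chi k * fps_nth (G k) (n - 1)) =
      (\<Sum>k=1..<d. - ((\<i> / (2 * of_real pi)) ^ n) * (chi k * hurwitz_sum n (real k / real d) + chi k * hurwitz_sum n (1 - real k / real d)))"
  proof (rule sum.cong[OF refl])
    fix k assume "k \<in> {1..<d}"
    thus "chi k * fps_nth (G k) (n - 1) = - ((\<i> / (2 * of_real pi)) ^ n) * (chi k * hurwitz_sum n (real k / real d) + chi k * hurwitz_sum n (1 - real k / real d))"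
      unfolding G_def w_def using n by (subst fps_nth_inverse_exp_minus_1) (auto simp: algebra_simps)
  qed
  also have "\<dots> = - ((\<i> / (2 * of_real pi)) ^ n) * ((\<Sum>k=1..<d. chi k * hurwitz_sum n (real k / real d)) + (\<Sum>k=1..<d. chi k * hurwitz_sum n (1 - real k / real d)))"
    by (simp only: sum_distrib_left[symmetric] sum.distrib)
  \<comment> \<open>Reflecting k to \<open>d - k\<close> identifies the two halves; this is the
    origin of the factor 2 in the result.\<close>
  also have "(\<Sum>k=1..<d. chi k * hurwitz_sum n (1 - real k / real d)) = (\<Sum>k=1..<d. chi k * hurwitz_sum n (real k / real d))"
    by (rule sum.reindex_bij_witness[of _ "\<lambda>k. d - k" "\<lambda>k. d - k"])
       (auto simp: ev of_nat_diff diff_divide_distrib)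
  also have "(\<Sum>k=1..<d. chi k * hurwitz_sum n (real k / real d)) = (\<Sum>k=1..d. chi k * hurwitz_sum n (real k / real d))"
    using chid d by (intro sum.mono_neutral_left) auto
  also have "\<dots> = of_nat d ^ n * dirichlet_L chi (of_nat n)"
    using dirichlet_L_eq_hurwitz[of d n chi] n d per bd by simp
  finally show ?thesis by (simp add: algebra_simps)
qed

section \<open>An estimate for quadratic exponential sums\<close>

text \<open>Jordan's inequality: a concave function lies above its chord, here the one from 0 to
  1.\<close>

lemma sin_pi_half_ge:
  fixes y :: real
  assumes "0 \<le> y" "y \<le> 1"
  shows "y \<le> sin (pi * y / 2)"
proof -
  let ?f = "\<lambda>y. - sin (pi * y / 2)"
  have "convex_on {0..1} ?f"
  proof (rule f''_ge0_imp_convex)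
    show "(?f has_real_derivative (- (pi / 2) * cos (pi * x / 2))) (at x)" for x
      by (auto intro!: derivative_eq_intros)
    show "((\<lambda>y. - (pi / 2) * cos (pi * y / 2)) has_real_derivative (pi / 2)\<^sup>2 * sin (pi * x / 2)) (at x)" for x
      by (auto intro!: derivative_eq_intros simp: power2_eq_square)
    fix x :: real assume "x \<in> {0..1}"
    hence "0 \<le> pi * x / 2" "pi * x / 2 \<le> pi" by (auto simp: field_simps)
    thus "(pi / 2)\<^sup>2 * sin (pi * x / 2) \<ge> 0" by (intro mult_nonneg_nonneg sin_ge_zero) auto
  qed auto
  from convex_onD[OF this, of y 0 1] assms show ?thesis by simp
qed

lemma cos_pi_half_ge:
  fixes u :: real
  assumes "0 \<le> u" "u \<le> 1"
  shows "1 - u \<le> cos (pi * u / 2)"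
proof -
  have "1 - u \<le> sin (pi * (1 - u) / 2)" using assms by (intro sin_pi_half_ge) auto
  also have "pi * (1 - u) / 2 = pi / 2 - pi * u / 2" by (simp add: field_simps)
  finally show ?thesis by (simp add: sin_diff)
qed

text \<open>Abel summation: the increments of the decreasing weights telescope, so only the first
  weight enters the bound.\<close>

lemma norm_sum_by_parts_le:
  fixes v :: "nat \<Rightarrow> 'a :: real_normed_vector" and b :: "nat \<Rightarrow> real"
  assumes "m < n" "\<And>k. m \<le> k \<Longrightarrow> Suc k < n \<Longrightarrow> b (Suc k) \<le> b k" "\<And>k. m \<le> k \<Longrightarrow> k < n \<Longrightarrow> 0 \<le> b k"
    and v: "\<And>k. norm (v k) \<le> 1"
  shows "norm (\<Sum>k=m..<n. b k *\<^sub>R (v (Suc k) - v k)) \<le> 2 * b m"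
proof -
  \<comment> \<open>Moving the boundary term to the left makes the claim inductive: each step adds a
    vector of norm at most \<open>b j - b (Suc j)\<close>.\<close>
  have *: "norm ((\<Sum>k=m..<Suc j. b k *\<^sub>R (v (Suc k) - v k)) - b j *\<^sub>R v (Suc j)) \<le> 2 * b m - b j"
    if "m \<le> j" "j < n" for j
    using that
  proof (induction j rule: dec_induct)
    case base
    have "norm (b m *\<^sub>R v m) \<le> b m * 1"
      unfolding norm_scaleR using assms(3)[of m] base v[of m] by (intro mult_mono) auto
    thus ?case by (simp add: scaleR_diff_right)
  next
    case (step j)
    have dec: "b (Suc j) \<le> b j" using assms(2) step by auto
    have "(\<Sum>k=m..<Suc (Suc j). b k *\<^sub>R (v (Suc k) - v k)) - b (Suc j) *\<^sub>R v (Suc (Suc j)) =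
       ((\<Sum>k=m..<Suc j. b k *\<^sub>R (v (Suc k) - v k)) - b j *\<^sub>R v (Suc j)) + (b j - b (Suc j)) *\<^sub>R v (Suc j)"
      using step by (simp add: algebra_simps)
    also have "norm \<dots> \<le> (2 * b m - b j) + (b j - b (Suc j)) * 1"
    proof (rule norm_triangle_mono)
      show "norm ((b j - b (Suc j)) *\<^sub>R v (Suc j)) \<le> (b j - b (Suc j)) * 1"
        unfolding norm_scaleR using dec v by (intro mult_mono) auto
    qed (use step in auto)
    finally show ?case by simp
  qed
  define j where "j = n - 1"
  have j: "m \<le> j" "j < n" "n = Suc j" using assms(1) by (auto simp: j_def)
  have "norm (\<Sum>k=m..<n. b k *\<^sub>R (v (Suc k) - v k)) \<le>
     norm ((\<Sum>k=m..<Suc j. b k *\<^sub>R (v (Suc k) - v k)) - b j *\<^sub>R v (Suc j)) + norm (b j *\<^sub>R v (Suc j))"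
    unfolding j(3) by (rule norm_triangle_sub[of _ "b j *\<^sub>R v (Suc j)", unfolded add.commute[of "norm (b j *\<^sub>R v (Suc j))"]])
  also have "norm (b j *\<^sub>R v (Suc j)) \<le> b j * 1"
    unfolding norm_scaleR using assms(3)[of j] j v by (intro mult_mono) auto
  finally show ?thesis using *[OF j(1,2)] by simp
qed

text \<open>
  With \<open>v x = exp (\<pi>i (x - 1/2)\<^sup>2 / 2p)\<close> each term is a unimodular constant times
  \<open>(v (x + 1) - v x) / (2 sin (\<pi>x / 2p))\<close>, and these weights decrease in \<open>x\<close>.
\<close>

lemma norm_quadratic_tail_le:
  fixes p M :: nat
  assumes M: "0 < M" "M \<le> p"
  shows "norm (\<Sum>x=M..<p. cis (pi * real x ^ 2 / (2 * real p))) \<le> real p / real M"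
proof (cases "M = p")
  case False
  hence Mp: "M < p" using M by simp
  define v where "v = (\<lambda>x. cis (pi * (real x - 1 / 2) ^ 2 / (2 * real p)))"
  define b where "b = (\<lambda>x. 1 / (2 * sin (pi * (real x / real p) / 2)))"
  \<comment> \<open>Compensates the two constants from completing the square:
    \<open>(x + 1/2)^2\<close> and \<open>(x - 1/2)^2\<close> share the summand 1/4, a phase
    \<open>pi / (8 * p)\<close>, and the difference of conjugate phases yields a factor i.\<close>
  define c where "c = cis (- pi / (8 * real p)) / \<i>"
  have pos: "real x / real p \<le> sin (pi * (real x / real p) / 2)" "0 < sin (pi * (real x / real p) / 2)"
    if "0 < x" "x < p" for x
  proof -
    show *: "real x / real p \<le> sin (pi * (real x / real p) / 2)"
      using that by (intro sin_pi_half_ge) auto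
    have "0 < real x / real p" using that by auto
    thus "0 < sin (pi * (real x / real p) / 2)" using * by linarith
  qed
  have "(\<Sum>x=M..<p. cis (pi * real x ^ 2 / (2 * real p))) = (\<Sum>x=M..<p. c * (b x *\<^sub>R (v (Suc x) - v x)))"
  proof (rule sum.cong[OF refl])
    fix x assume x: "x \<in> {M..<p}"
    let ?s = "pi * (real x / real p) / 2" and ?A = "pi * (real x ^ 2 + 1 / 4) / (2 * real p)"
    have "v (Suc x) = cis ?A * cis ?s" "v x = cis ?A * cis (- ?s)"
      unfolding v_def cis_mult
      by (rule arg_cong[of _ _ cis], use x in \<open>simp add: field_simps power2_eq_square\<close>)+
    hence "v (Suc x) - v x = cis ?A * (2 * \<i> * of_real (sin ?s))"
      by (simp add: complex_eq_iff algebra_simps)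
    hence "b x *\<^sub>R (v (Suc x) - v x) = cis ?A * \<i>"
      using pos[of x] x M by (simp add: b_def scaleR_conv_of_real)
    hence "c * (b x *\<^sub>R (v (Suc x) - v x)) = cis (- pi / (8 * real p)) * cis ?A * (\<i> / \<i>)"
      by (simp only: c_def times_divide_eq_left times_divide_eq_right mult_ac)
    also have "\<i> / \<i> = 1" by (rule divide_self) simp
    also have "cis (- pi / (8 * real p)) * cis ?A * 1 = cis (- pi / (8 * real p)) * cis ?A" by simp
    also have "\<dots> = cis (pi * real x ^ 2 / (2 * real p))"
      using x by (simp add: cis_mult field_simps)
    finally show "cis (pi * real x ^ 2 / (2 * real p)) = c * (b x *\<^sub>R (v (Suc x) - v x))" by simp
  qed
  also have "norm \<dots> = norm (\<Sum>x=M..<p. b x *\<^sub>R (v (Suc x) - v x))"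
    by (simp only: sum_distrib_left[symmetric] norm_mult) (simp add: c_def norm_divide norm_mult)
  also have "\<dots> \<le> 2 * b M"
  proof (rule norm_sum_by_parts_le[OF Mp])
    fix k assume k: "M \<le> k" "Suc k < p"
    have "real (Suc k) / real p \<le> 1" using k by simp
    hence "pi * (real (Suc k) / real p) / 2 \<le> pi / 2"
      using mult_left_mono[of "real (Suc k) / real p" 1 pi] by simp
    moreover have "pi * (real k / real p) / 2 \<le> pi * (real (Suc k) / real p) / 2" by (simp add: divide_right_mono)
    moreover have "- (pi / 2) \<le> pi * (real k / real p) / 2"
      by (rule order_trans[of _ 0]) auto
    ultimately have "sin (pi * (real k / real p) / 2) \<le> sin (pi * (real (Suc k) / real p) / 2)"
      by (intro sin_monotone_2pi_le)
    thus "b (Suc k) \<le> b k" using pos[of k] k M unfolding b_def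
      by (intro divide_left_mono mult_left_mono) auto
  qed (use pos M in \<open>auto simp: b_def v_def less_imp_le intro!: divide_nonneg_pos\<close>)
  also have "\<dots> = 1 / sin (pi * (real M / real p) / 2)" by (simp add: b_def)
  also have "\<dots> \<le> 1 / (real M / real p)"
    using pos[of M] M Mp by (intro divide_left_mono) auto
  finally show ?thesis by simp
qed (use M in auto)

lemma sum_squares_real: "(\<Sum>x=1..N. real x ^ 2) = real N * (real N + 1) * (2 * real N + 1) / 6"
  by (induction N) (simp_all add: field_simps power2_eq_square)

text \<open>The cut at \<open>N = floor (sqrt p)\<close> is where the argument of the cosine reaches
  pi/2. Below it \<open>cos (pi * u / 2) \<ge> 1 - u\<close> leaves a sum of squares; above it the
  oscillation bounds the sum by \<open>p / (N + 1)\<close>.\<close>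

lemma quadratic_cos_sum_gt:
  fixes p :: nat
  assumes p: "p \<ge> 3"
  shows "1 + 2 * (\<Sum>x=1..<p. cos (pi * real x ^ 2 / (2 * real p))) > - sqrt (real p)"
proof -
  define s where "s = sqrt (real p)"
  define N where "N = nat \<lfloor>s\<rfloor>"
  have s0: "s > 1" using p by (simp add: s_def)
  have ss: "s * s = real p" by (simp add: s_def)
  have Ns: "real N \<le> s" "s < real N + 1" using s0 by (auto simp: N_def)
  have N1: "N \<ge> 1" using s0 Ns by (cases N) auto
  have "real (N * N) \<le> s * s" unfolding of_nat_mult using Ns by (intro mult_mono) auto
  hence NN: "N * N \<le> p" unfolding ss by (simp only: of_nat_le_iff)
  have "real p < (real N + 1) * (real N + 1)" unfolding ss[symmetric] using Ns s0 by (intro mult_strict_mono) auto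
  also have "\<dots> = real ((N + 1) * (N + 1))" by (simp add: algebra_simps)
  finally have pN: "p < (N + 1) * (N + 1)" by (simp only: of_nat_less_iff)
  have NP: "N + 1 \<le> p"
  proof (cases "N = 1")
    case False
    hence "2 * N \<le> N * N" using N1 by (intro mult_right_mono) auto
    thus ?thesis using NN N1 False by linarith
  qed (use p in auto)
  let ?c = "\<lambda>x. cos (pi * real x ^ 2 / (2 * real p))"
  have "(\<Sum>x=1..N. 1 - real x ^ 2 / real p) \<le> (\<Sum>x=1..N. ?c x)"
  proof (rule sum_mono)
    fix x assume x: "x \<in> {1..N}"
    have "x * x \<le> N * N" using x by (intro mult_mono) auto
    hence "x * x \<le> p" using NN by linarith
    hence "real (x * x) \<le> real p" by (simp only: of_nat_le_iff)
    hence "real x ^ 2 / real p \<le> 1" using p by (simp add: field_simps power2_eq_square)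
    from cos_pi_half_ge[OF _ this] show "1 - real x ^ 2 / real p \<le> ?c x" by (simp add: field_simps)
  qed
  moreover have "(\<Sum>x=1..N. 1 - real x ^ 2 / real p) = real N - real N * (real N + 1) * (2 * real N + 1) / (6 * real p)"
    by (simp add: sum_subtractf sum_divide_distrib[symmetric] sum_squares_real del: One_nat_def)
  moreover have "\<bar>\<Sum>x=N+1..<p. ?c x\<bar> \<le> real p / (real N + 1)"
  proof -
    have "\<bar>\<Sum>x=N+1..<p. ?c x\<bar> = \<bar>Re (\<Sum>x=N+1..<p. cis (pi * real x ^ 2 / (2 * real p)))\<bar>" by simp
    also have "\<dots> \<le> norm (\<Sum>x=N+1..<p. cis (pi * real x ^ 2 / (2 * real p)))" by (rule abs_Re_le_cmod)
    also have "\<dots> \<le> real p / real (N + 1)" using NP by (intro norm_quadratic_tail_le) auto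
    finally show ?thesis by (simp add: add.commute)
  qed
  moreover have "(\<Sum>x=1..<p. ?c x) = (\<Sum>x=1..N. ?c x) + (\<Sum>x=N+1..<p. ?c x)"
    using sum.atLeastLessThan_concat[of 1 "N + 1" p ?c] NP by (simp add: atLeastLessThanSuc_atLeastAtMost)
  moreover have "real N * (real N + 1) * (2 * real N + 1) / (3 * real p) =
      2 * (real N * (real N + 1) * (2 * real N + 1) / (6 * real p))" by simp
  moreover have "2 * real p / (real N + 1) = 2 * (real p / (real N + 1))" by simp
  ultimately have lower: "1 + 2 * (\<Sum>x=1..<p. ?c x) \<ge>
      1 + 2 * real N - real N * (real N + 1) * (2 * real N + 1) / (3 * real p) - 2 * real p / (real N + 1)"
    by linarith
  \<comment> \<open>By \<open>N * N \<le> p\<close> and \<open>s < N + 1\<close> the left side is at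
    least \<open>4 * N / 3 - 1 / (3 * N) - 2 * s\<close>, and \<open>4 * N / 3 - 1 / (3 * N)\<close>
    exceeds \<open>N + 1 > s\<close> from N = 4 on. For smaller N one has p at most 15, and each p
    is evaluated numerically against \<open>s \<ge> N\<close>.\<close>
  have "1 + 2 * real N - real N * (real N + 1) * (2 * real N + 1) / (3 * real p) - 2 * real p / (real N + 1) > - s"
  proof (cases "N \<ge> 4")
    case True
    have "real p / (real N + 1) \<le> s"
      unfolding ss[symmetric] using Ns s0 mult_left_mono[of s "real N + 1" s] by (simp add: field_simps)
    moreover have "real N * (real N + 1) * (2 * real N + 1) / (3 * real p) \<le>
                     real N * (real N + 1) * (2 * real N + 1) / (3 * real (N * N))"
      using NN N1 p by (intro divide_left_mono mult_left_mono) (auto simp flip: of_nat_mult)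
    moreover have "real N * (real N + 1) * (2 * real N + 1) / (3 * real (N * N)) = 2 * real N / 3 + 1 + 1 / (3 * real N)"
      using N1 by (simp add: field_simps)
    moreover have "1 / (3 * real N) \<le> 1 / (3 * 4)" using True by (intro divide_left_mono) auto
    moreover have "2 * real p / (real N + 1) = 2 * (real p / (real N + 1))" by simp
    moreover have "real N \<ge> 4" using True by simp
    ultimately show ?thesis using Ns by linarith
  next
    case False
    hence "N \<in> {1, 2, 3}" using N1 by auto
    moreover have "p \<in> {3..15}"
    proof -
      have "(N + 1) * (N + 1) \<le> 4 * 4" using False by (intro mult_mono) auto
      thus ?thesis using pN p by auto
    qed
    hence "p \<in> {3,4,5,6,7,8,9,10,11,12,13,14,15}" by (simp, presburger)
    ultimately show ?thesis using NN pN Ns by auto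
  qed
  with lower show ?thesis unfolding s_def by linarith
qed

section \<open>Legendre symbols and Gauss sums\<close>

lemma Legendre_cong: "[a = b] (mod int p) \<Longrightarrow> Legendre a (int p) = Legendre b (int p)"
  by (simp add: Legendre_def QuadRes_def cong_def)

lemma Legendre_values: "Legendre a p \<in> {-1, 0, 1}"
  by (simp add: Legendre_def)

lemma Legendre_eq_0_iff: "Legendre a p = 0 \<longleftrightarrow> p dvd a"
  by (simp add: Legendre_def cong_0_iff)

lemma Legendre_1: "p > 1 \<Longrightarrow> Legendre 1 p = 1"
proof -
  assume "p > 1"
  moreover have "QuadRes p 1" unfolding QuadRes_def by (rule exI[of _ 1]) simp
  ultimately show ?thesis by (auto simp: Legendre_def cong_0_iff)
qed

text \<open>Lifts Euler's criterion to equalities: both sides are signs or 0, hence differ by at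
  most 2 < p.\<close>

lemma small_cong_imp_eq:
  fixes x y p :: int
  assumes "[x = y] (mod p)" "\<bar>x - y\<bar> < p"
  shows "x = y"
  using assms zdvd_imp_le[of p "\<bar>x - y\<bar>"] by (auto simp: cong_iff_dvd_diff)

lemma Legendre_mult:
  assumes p: "prime p" "2 < p"
  shows "Legendre (a * b) (int p) = Legendre a (int p) * Legendre b (int p)"
proof (rule small_cong_imp_eq)
  have "[Legendre a p * Legendre b p = a ^ ((p - 1) div 2) * b ^ ((p - 1) div 2)] (mod int p)"
    by (intro cong_mult euler_criterion p)
  moreover have "[Legendre (a * b) p = (a * b) ^ ((p - 1) div 2)] (mod int p)"
    by (intro euler_criterion p)
  ultimately show "[Legendre (a * b) (int p) = Legendre a (int p) * Legendre b (int p)] (mod int p)"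
    by (metis cong_sym cong_trans power_mult_distrib)
  show "\<bar>Legendre (a * b) (int p) - Legendre a (int p) * Legendre b (int p)\<bar> < int p"
    using Legendre_values[of a p] Legendre_values[of b p] Legendre_values[of "a * b" p] p by auto
qed

lemma Legendre_minus_1:
  assumes p: "prime p" "2 < p"
  shows "Legendre (-1) (int p) = (-1) ^ ((p - 1) div 2)"
proof (rule small_cong_imp_eq)
  show "[Legendre (-1) p = (-1) ^ ((p - 1) div 2)] (mod int p)"
    by (intro euler_criterion p)
  have "(-1 :: int) ^ ((p - 1) div 2) \<in> {-1, 1}"
    by (cases "even ((p - 1) div 2)") auto
  thus "\<bar>Legendre (-1) (int p) - (-1) ^ ((p - 1) div 2)\<bar> < int p"
    using Legendre_values[of "-1" p] p by auto
qed

text \<open>Gauss's lemma with multiplier 2: the doubles of 1..h, where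
  \<open>h = (p - 1) / 2\<close>, stay below p and need no reduction, and those exceeding h come
  from the upper half, so the exponent is \<open>h - h div 2\<close>.\<close>

lemma Legendre_2:
  assumes p: "prime p" "2 < p"
  shows "Legendre 2 (int p) = (if p mod 8 \<in> {1, 7} then 1 else -1)"
proof -
  interpret GAUSS p 2
  proof
    have "\<not> int p dvd 2" using p(2) zdvd_imp_le[of "int p" 2] by auto
    thus "[2 \<noteq> 0] (mod int p)" by (simp add: cong_0_iff)
  qed (use p in auto)
  define h where "h = (int p - 1) div 2"
  have op: "odd p" using p prime_odd_nat by blast
  have h: "int p = 2 * h + 1" using op by (auto simp: h_def elim: oddE)
  have "C = (\<lambda>x. 2 * x) ` A"
    unfolding C_def B_def image_image
  proof (rule image_cong[OF refl])
    fix x assume "x \<in> A"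
    thus "x * 2 mod int p = 2 * x" by (auto simp: A_def h_def[symmetric] h)
  qed
  hence "E = (\<lambda>x. 2 * x) ` {h div 2 <.. h}"
    unfolding E_def A_def h_def[symmetric] by (auto simp: image_iff)
  hence "card E = nat (h - h div 2)"
    by (simp add: card_image inj_on_def)
  hence L: "Legendre 2 (int p) = (-1) ^ nat (h - h div 2)" by (simp add: gauss_lemma)
  have h0: "h \<ge> 1" using p h by linarith
  have "p mod 8 = 1 \<or> p mod 8 = 3 \<or> p mod 8 = 5 \<or> p mod 8 = 7" using op by presburger
  hence "even (nat (h - h div 2)) \<longleftrightarrow> p mod 8 \<in> {1, 7}"
    using h h0 by (simp add: even_nat_iff) presburger
  thus ?thesis unfolding L by (auto simp: minus_one_power_iff)
qed

text \<open>If every nonzero class were a square, squaring would be surjective on the finite set of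
  residues, hence injective; but 1 and -1 have the same square.\<close>

lemma exists_nonresidue:
  assumes p: "prime p" "2 < p"
  shows "\<exists>g. Legendre g (int p) = -1"
proof (rule ccontr)
  assume "\<not> ?thesis"
  hence L: "Legendre g (int p) = 1 \<or> int p dvd g" for g
    using Legendre_values[of g p] Legendre_eq_0_iff[of g p] by blast
  let ?R = "{0..<int p}" and ?s = "\<lambda>x. x\<^sup>2 mod int p"
  have "?R \<subseteq> ?s ` ?R"
  proof
    fix g assume g: "g \<in> ?R"
    show "g \<in> ?s ` ?R"
    proof (cases "g = 0")
      case False
      hence "\<not> int p dvd g" using g zdvd_imp_le[of "int p" g] by auto
      hence "Legendre g (int p) = 1" using L by blast
      hence "QuadRes p g" by (auto simp: Legendre_def split: if_splits)
      then obtain y where "[y\<^sup>2 = g] (mod int p)" by (auto simp: QuadRes_def)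
      hence "?s (y mod int p) = g" using g by (simp add: cong_def power_mod)
      thus ?thesis using p by (intro image_eqI[of _ _ "y mod int p"]) auto
    qed (use p in \<open>auto intro!: image_eqI[of _ _ 0]\<close>)
  qed
  hence "inj_on ?s ?R"
    by (intro eq_card_imp_inj_on antisym[OF card_image_le] card_mono finite_imageI
          finite_atLeastLessThan_int)
  moreover have "?s 1 = ?s (int p - 1)"
    by (simp add: power2_eq_square algebra_simps mod_simps) (simp add: mod_eq_dvd_iff)
  moreover have "1 \<in> ?R" "int p - 1 \<in> ?R" using p by auto
  ultimately have "1 = int p - 1" by (rule inj_onD)
  thus False using p by simp
qed

section \<open>Roots of unity and complete residue systems\<close>

definition unity_root :: "nat \<Rightarrow> int \<Rightarrow> complex" where
  "unity_root N k = cis (2 * pi * of_int k / of_nat N)"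

lemma unity_root_add: "unity_root N (j + k) = unity_root N j * unity_root N k"
  by (simp add: unity_root_def cis_mult distrib_left add_divide_distrib)

lemma unity_root_mult_N [simp]: "unity_root N (int N * k) = 1"
proof (cases "N = 0")
  case False
  hence "2 * pi * of_int (int N * k) / of_nat N = 2 * pi * of_int k" by simp
  thus ?thesis unfolding unity_root_def using cis_multiple_2pi[of "of_int k"] by (simp only: Ints_of_int)
qed (simp add: unity_root_def)

lemma unity_root_0 [simp]: "unity_root N 0 = 1"
  by (simp add: unity_root_def)

lemma unity_root_cong:
  assumes "[j = k] (mod int N)"
  shows "unity_root N j = unity_root N k"
proof -
  obtain m where "j = k + int N * m" using assms by (metis cong_iff_lin cong_sym)
  thus ?thesis by (simp add: unity_root_add)
qed

lemma unity_root_mult_cancel: "M > 0 \<Longrightarrow> unity_root (N * M) (k * int M) = unity_root N k"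
  unfolding unity_root_def by (rule arg_cong[of _ _ cis]) simp

lemma unity_root_power: "unity_root N (a * int m) = unity_root N a ^ m"
  unfolding unity_root_def Complex.DeMoivre by (simp add: mult_ac)

lemma unity_root_eq_1_iff:
  assumes "N > 0"
  shows "unity_root N k = 1 \<longleftrightarrow> int N dvd k"
proof
  assume "unity_root N k = 1"
  hence "cos (2 * pi * of_int k / of_nat N) = 1" by (auto simp: unity_root_def complex_eq_iff)
  then obtain j :: int where "2 * pi * of_int k / of_nat N = real_of_int j * 2 * pi"
    by (auto simp: cos_one_2pi_int)
  hence "2 * pi * of_int k = 2 * pi * (real_of_int j * of_nat N)" using assms by (simp add: field_simps)
  hence "real_of_int k = real_of_int (j * int N)" by (subst (asm) mult_left_cancel) auto
  hence "k = j * int N" by (simp only: of_int_eq_iff)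
  thus "int N dvd k" by simp
qed auto

lemma sum_unity_root:
  assumes "N > 0"
  shows "(\<Sum>a\<in>{0..<int N}. unity_root N (a * k)) = (if int N dvd k then of_nat N else 0)"
proof (cases "int N dvd k")
  case True
  hence "unity_root N (a * k) = 1" for a using assms by (simp add: unity_root_eq_1_iff)
  thus ?thesis using True by simp
next
  case False
  have "(\<Sum>a\<in>{0..<int N}. unity_root N (a * k)) = (\<Sum>a<N. unity_root N k ^ a)"
    by (rule sum.reindex_bij_witness[of _ int nat])
       (auto simp: unity_root_power[symmetric] mult.commute)
  also have "\<dots> = (unity_root N k ^ N - 1) / (unity_root N k - 1)"
    using False assms by (intro geometric_sum) (simp add: unity_root_eq_1_iff)
  also have "unity_root N k ^ N = 1"
    unfolding unity_root_power[symmetric] by (simp add: mult.commute[of k])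
  finally show ?thesis using False by simp
qed

text \<open>N integers that are pairwise incongruent modulo N form a complete residue system. The
  index set is arbitrary so that pairs from the Chinese remainder theorem are covered as
  well.\<close>

lemma sum_over_residues:
  fixes F :: "int \<Rightarrow> 'a :: comm_monoid_add"
  assumes N: "N > 0" and F: "\<And>a b. [a = b] (mod int N) \<Longrightarrow> F a = F b"
    and "finite A" and "card A = N" and inj: "inj_on (\<lambda>a. g a mod int N) A"
  shows "(\<Sum>a\<in>A. F (g a)) = (\<Sum>b\<in>{0..<int N}. F b)"
proof -
  have "(\<lambda>a. g a mod int N) ` A \<subseteq> {0..<int N}" using N by auto
  moreover have "card ((\<lambda>a. g a mod int N) ` A) = card {0..<int N}"
    using card_image[OF inj] assms by simp
  ultimately have "(\<lambda>a. g a mod int N) ` A = {0..<int N}" by (intro card_subset_eq) auto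
  hence "bij_betw (\<lambda>a. g a mod int N) A {0..<int N}" using inj by (simp add: bij_betw_def)
  from sum.reindex_bij_betw[OF this, of F]
  have "(\<Sum>b\<in>{0..<int N}. F b) = (\<Sum>a\<in>A. F (g a mod int N))" by simp
  also have "\<dots> = (\<Sum>a\<in>A. F (g a))" by (intro sum.cong refl F) (simp add: cong_def)
  finally show ?thesis ..
qed

lemma sum_over_residues_mult:
  fixes F :: "int \<Rightarrow> 'a :: comm_monoid_add"
  assumes N: "N > 0" and F: "\<And>a b. [a = b] (mod int N) \<Longrightarrow> F a = F b" and "coprime k (int N)"
  shows "(\<Sum>a\<in>{0..<int N}. F (k * a + c)) = (\<Sum>b\<in>{0..<int N}. F b)"
proof (rule sum_over_residues[OF N F])
  show "inj_on (\<lambda>a. (k * a + c) mod int N) {0..<int N}"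
  proof (rule inj_onI)
    fix x y assume xy: "x \<in> {0..<int N}" "y \<in> {0..<int N}" "(k * x + c) mod int N = (k * y + c) mod int N"
    hence "[k * x + c = k * y + c] (mod int N)" by (simp add: cong_def)
    hence "[x = y] (mod int N)" using assms(3) by (simp add: cong_add_rcancel cong_mult_lcancel)
    thus "x = y" using xy by (simp add: cong_def)
  qed
qed auto

section \<open>Characters reproduced by the finite Fourier transform\<close>

text \<open>
  The last condition for \<open>k = 1\<close> says that \<open>c\<close> is the Gauss sum of \<open>f\<close> (as soon as \<open>f 1 = 1\<close>);
  for all \<open>k\<close> it is primitivity, stated in the only form in which it is needed.
\<close>

definition gauss_char :: "nat \<Rightarrow> (int \<Rightarrow> int) \<Rightarrow> complex \<Rightarrow> bool" where
  "gauss_char N f c \<longleftrightarrow> N > 0 \<and> (\<forall>a b. f (a * b) = f a * f b) \<and> (\<forall>a b. [a = b] (mod int N) \<longrightarrow> f a = f b) \<and>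
     (\<forall>k. (\<Sum>a\<in>{0..<int N}. of_int (f a) * unity_root N (a * k)) = c * of_int (f k))"

text \<open>Substituting \<open>g * a\<close> for a shows that \<open>f g\<close> times the
  transform at \<open>g * k\<close> is the transform at k, for every unit g. For a unit k take g = k
  and compare with frequency 1. Otherwise the witness g fixes k but has \<open>f g = -1\<close>, so
  the transform at k equals its own negative.\<close>

lemma gauss_charI:
  assumes N: "N > 0" and mult: "\<And>a b. f (a * b) = f a * f b"
    and per: "\<And>a b. [a = b] (mod int N) \<Longrightarrow> f a = f b"
    and cop: "\<And>k. coprime k (int N) \<Longrightarrow> f k * f k = 1"
    and ncop: "\<And>k. \<not> coprime k (int N) \<Longrightarrow> f k = 0 \<and> (\<exists>g. f g = -1 \<and> [g * k = k] (mod int N) \<and> coprime g (int N))"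
  shows "gauss_char N f (\<Sum>a\<in>{0..<int N}. of_int (f a) * unity_root N a)"
proof -
  let ?T = "\<lambda>k. \<Sum>a\<in>{0..<int N}. of_int (f a) * unity_root N (a * k)"
  have T: "of_int (f g) * ?T (g * k) = ?T k" if "coprime g (int N)" for g k
  proof -
    have "of_int (f g) * ?T (g * k) = (\<Sum>a\<in>{0..<int N}. of_int (f (g * a + 0)) * unity_root N ((g * a + 0) * k))"
      unfolding sum_distrib_left by (intro sum.cong refl) (simp add: mult mult_ac)
    also have "\<dots> = ?T k"
      by (rule sum_over_residues_mult[OF N _ that, where F = "\<lambda>a. of_int (f a) * unity_root N (a * k)"])
         (metis per unity_root_cong cong_scalar_right)
    finally show ?thesis .
  qed
  have "?T k = ?T 1 * of_int (f k)" for k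
  proof (cases "coprime k (int N)")
    case True
    have "?T k = of_int (f k * f k) * ?T (k * 1)" using cop[OF True] by simp
    also have "\<dots> = of_int (f k) * (of_int (f k) * ?T (k * 1))" by (simp only: of_int_mult mult.assoc)
    also have "\<dots> = of_int (f k) * ?T 1" by (subst T[OF True]) rule
    finally show ?thesis by (simp only: mult.commute)
  next
    case False
    from ncop[OF this] obtain g where g: "f k = 0" "f g = -1" "[g * k = k] (mod int N)" "coprime g (int N)" by blast
    have "?T (g * k) = ?T k"
    proof (intro sum.cong refl arg_cong2[of _ _ _ _ times] unity_root_cong)
      fix a show "[a * (g * k) = a * k] (mod int N)" using g(3) by (rule cong_scalar_left)
    qed
    with T[OF g(4), of k] g(2) have "?T k = 0" by (simp add: neg_eq_iff_add_eq_0)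
    thus ?thesis using g(1) by simp
  qed
  moreover have "?T 1 = (\<Sum>a\<in>{0..<int N}. of_int (f a) * unity_root N a)" by simp
  ultimately show ?thesis unfolding gauss_char_def using N mult per by metis
qed

text \<open>Chinese remainder theorem with representatives \<open>x * N + y * M\<close>: the
  exponential splits into roots of order M and N, while \<open>f\<close> and \<open>h\<close> see
  \<open>x * N\<close> and \<open>y * M\<close>. This leaves the cross factor
  \<open>f N * h M\<close>, later evaluated by reciprocity.\<close>

lemma gauss_char_mult:
  assumes g: "gauss_char M f c" "gauss_char N h e" and MN: "coprime M N"
  shows "gauss_char (M * N) (\<lambda>a. f a * h a) (of_int (f (int N) * h (int M)) * c * e)"
proof -
  have M: "M > 0" and N: "N > 0" using g by (auto simp: gauss_char_def)
  have per: "f a * h a = f b * h b" if "[a = b] (mod int (M * N))" for a b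
  proof -
    have "[a = b] (mod int M)" "[a = b] (mod int N)"
      using that by (metis cong_modulus_mult mult.commute of_nat_mult)+
    thus ?thesis using g unfolding gauss_char_def by metis
  qed
  have "(\<Sum>a\<in>{0..<int (M * N)}. of_int (f a * h a) * unity_root (M * N) (a * k)) =
          (of_int (f (int N) * h (int M)) * c * e) * of_int (f k * h k)" for k
  proof -
    let ?F = "\<lambda>a. of_int (f a * h a) * unity_root (M * N) (a * k) :: complex"
    let ?g = "\<lambda>(x, y). x * int N + y * int M"
    have "(\<Sum>a\<in>{0..<int (M * N)}. ?F a) = (\<Sum>z\<in>{0..<int M} \<times> {0..<int N}. ?F (?g z))"
    proof (rule sum_over_residues[symmetric])
      show "?F a = ?F b" if "[a = b] (mod int (M * N))" for a b
        using per[OF that] unity_root_cong[of "a * k" "b * k" "M * N"] that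
        by (metis cong_scalar_right)
      show "inj_on (\<lambda>a. ?g a mod int (M * N)) ({0..<int M} \<times> {0..<int N})"
      proof (rule inj_onI; clarify)
        fix x y x' y'
        assume xy: "x \<in> {0..<int M}" "y \<in> {0..<int N}" "x' \<in> {0..<int M}" "y' \<in> {0..<int N}"
          and "(x * int N + y * int M) mod int (M * N) = (x' * int N + y' * int M) mod int (M * N)"
        hence c: "[x * int N + y * int M = x' * int N + y' * int M] (mod int M * int N)" by (simp add: cong_def)
        have "[x * int N + y * int M = x' * int N + y' * int M] (mod int M)"
          using c by (rule cong_modulus_mult)
        hence "[x * int N = x' * int N] (mod int M)" by (simp add: cong_def)
        hence "[x = x'] (mod int M)" using MN by (simp add: cong_mult_rcancel coprime_commute)
        moreover have "[x * int N + y * int M = x' * int N + y' * int M] (mod int N)"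
          using c unfolding mult.commute[of "int M" "int N"] by (rule cong_modulus_mult)
        hence "[y * int M = y' * int M] (mod int N)" by (simp add: cong_def)
        hence "[y = y'] (mod int N)" using MN by (simp add: cong_mult_rcancel)
        ultimately show "x = x' \<and> y = y'" using xy by (auto simp: cong_def)
      qed
    qed (use M N in auto)
    also have "\<dots> = (\<Sum>x\<in>{0..<int M}. \<Sum>y\<in>{0..<int N}.
        of_int (f (int N) * h (int M)) * ((of_int (f x) * unity_root M (x * k)) * (of_int (h y) * unity_root N (y * k))))"
      unfolding sum.cartesian_product
    proof (intro sum.cong refl, clarify)
      fix x y
      have "f (x * int N + y * int M) = f (x * int N)" 
        using g(1) unfolding gauss_char_def by (metis cong_add_lcancel_0 cong_mult_self_right)
      moreover have "h (x * int N + y * int M) = h (y * int M)" 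
        using g(2) unfolding gauss_char_def by (metis cong_add_rcancel_0 cong_mult_self_right)
      moreover have "unity_root (M * N) ((x * int N + y * int M) * k) =
                unity_root (M * N) ((x * k) * int N) * unity_root (N * M) ((y * k) * int M)"
        unfolding mult.commute[of N M] unity_root_add[symmetric] by (simp add: algebra_simps)
      moreover have "unity_root (M * N) ((x * k) * int N) = unity_root M (x * k)"
         "unity_root (N * M) ((y * k) * int M) = unity_root N (y * k)"
        using M N by (auto intro: unity_root_mult_cancel)
      moreover have "f (x * int N) = f x * f (int N)" "h (y * int M) = h y * h (int M)"
        using g by (auto simp: gauss_char_def)
      ultimately show "?F (x * int N + y * int M) = of_int (f (int N) * h (int M)) * ((of_int (f x) * unity_root M (x * k)) * (of_int (h y) * unity_root N (y * k)))"
        by (simp only: of_int_mult mult_ac)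
    qed
    also have "\<dots> = of_int (f (int N) * h (int M)) * ((\<Sum>x\<in>{0..<int M}. of_int (f x) * unity_root M (x * k)) * (\<Sum>y\<in>{0..<int N}. of_int (h y) * unity_root N (y * k)))"
      by (subst sum_product) (simp only: sum_distrib_left)
    also have "\<dots> = of_int (f (int N) * h (int M)) * ((c * of_int (f k)) * (e * of_int (h k)))"
      using g by (simp add: gauss_char_def)
    finally show ?thesis by (simp only: of_int_mult mult_ac)
  qed
  moreover have "\<forall>a b. f (a * b) * h (a * b) = f a * h a * (f b * h b)"
    using g by (simp add: gauss_char_def)
  ultimately show ?thesis unfolding gauss_char_def using M N per by simp
qed

section \<open>The sign of the quadratic Gauss sum\<close>

text \<open>Double counting of the product of the transforms at k and -k, summed over k: the Fourier
  property produces \<open>c * c * f (-1)\<close>, orthogonality of the roots of unity produces N,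
  both times the sum of the squares of \<open>f\<close>.\<close>

lemma gauss_char_square:
  assumes g: "gauss_char N f c" and f1: "f 1 \<noteq> 0"
  shows "c * c * of_int (f (-1)) = of_nat N"
proof -
  have N: "N > 0" using g by (simp add: gauss_char_def)
  let ?T = "\<lambda>k. \<Sum>a\<in>{0..<int N}. of_int (f a) * unity_root N (a * k)"
  have T: "?T k = c * of_int (f k)" for k using g by (simp add: gauss_char_def)
  define S where "S = (\<Sum>a\<in>{0..<int N}. f a * f a)"
  have "f 1 * f 1 = f 1" using g unfolding gauss_char_def by (metis mult_1)
  hence "f 1 = 1" using f1 by simp
  \<comment> \<open>Reducing 1 modulo N keeps the argument inside the summation range also for N =
    1.\<close>
  moreover have "f (1 mod int N) = f 1" using g unfolding gauss_char_def by (metis cong_mod_left cong_refl)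
  ultimately have "f (1 mod int N) * f (1 mod int N) = 1" by simp
  moreover have "f (1 mod int N) * f (1 mod int N) \<le> S"
    unfolding S_def using N by (intro member_le_sum) auto
  ultimately have S: "S \<noteq> 0" by simp
  have "(\<Sum>k\<in>{0..<int N}. ?T k * ?T (- k)) = (\<Sum>k\<in>{0..<int N}. c * c * of_int (f (-1)) * of_int (f k * f k))"
  proof (intro sum.cong refl)
    fix k
    have "f (- k) = f (-1) * f k" using g unfolding gauss_char_def by (metis mult_minus1)
    thus "?T k * ?T (- k) = c * c * of_int (f (-1)) * of_int (f k * f k)" unfolding T by simp
  qed
  also have "\<dots> = c * c * of_int (f (-1)) * of_int S"
    by (simp only: sum_distrib_left[symmetric] S_def of_int_sum)
  finally have 1: "(\<Sum>k\<in>{0..<int N}. ?T k * ?T (- k)) = c * c * of_int (f (-1)) * of_int S" .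
  have "(\<Sum>k\<in>{0..<int N}. ?T k * ?T (- k)) =
      (\<Sum>k\<in>{0..<int N}. \<Sum>a\<in>{0..<int N}. \<Sum>b\<in>{0..<int N}. of_int (f a * f b) * unity_root N (k * (a - b)))"
    unfolding sum_product
  proof (intro sum.cong refl)
    fix k a b
    have "unity_root N (k * (a - b)) = unity_root N (a * k) * unity_root N (b * - k)"
      by (simp add: unity_root_add[symmetric] algebra_simps)
    thus "of_int (f a) * unity_root N (a * k) * (of_int (f b) * unity_root N (b * - k)) = of_int (f a * f b) * unity_root N (k * (a - b))"
      by (simp only: of_int_mult mult_ac)
  qed
  also have "\<dots> = (\<Sum>a\<in>{0..<int N}. \<Sum>b\<in>{0..<int N}. \<Sum>k\<in>{0..<int N}. of_int (f a * f b) * unity_root N (k * (a - b)))"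
    by (rule trans[OF sum.swap], rule sum.cong[OF refl], rule sum.swap)
  also have "\<dots> = (\<Sum>a\<in>{0..<int N}. \<Sum>b\<in>{0..<int N}. if b = a then of_int (f a * f a) * of_nat N else 0)"
  proof (intro sum.cong refl)
    fix a b assume "a \<in> {0..<int N}" "b \<in> {0..<int N}"
    hence "int N dvd a - b \<longleftrightarrow> b = a"
      using small_cong_imp_eq[of a b "int N"] by (auto simp: cong_iff_dvd_diff)
    thus "(\<Sum>k\<in>{0..<int N}. of_int (f a * f b) * unity_root N (k * (a - b))) = (if b = a then of_int (f a * f a) * of_nat N else 0)"
      by (simp only: sum_distrib_left[symmetric] sum_unity_root[OF N]) simp
  qed
  also have "\<dots> = of_nat N * of_int S"
    by (simp add: S_def sum_distrib_left mult_ac)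
  finally show ?thesis using 1 S by simp
qed

lemma coprime_prime_iff:
  assumes "prime p"
  shows "coprime k (int p) \<longleftrightarrow> \<not> int p dvd k"
  using assms prime_imp_coprime[of "int p" k] by (auto simp: coprime_commute dest: coprime_common_divisor)

text \<open>If p divides k, multiplication by any g fixes k modulo p, so every nonresidue is a
  witness for \<open>gauss_charI\<close>.\<close>

lemma gauss_char_Legendre:
  assumes p: "prime p" "2 < p"
  shows "gauss_char p (\<lambda>a. Legendre a (int p)) (\<Sum>a\<in>{0..<int p}. of_int (Legendre a (int p)) * unity_root p a)"
proof (rule gauss_charI)
  fix k
  { assume "coprime k (int p)"
    hence "Legendre k (int p) \<noteq> 0" using p by (simp add: coprime_prime_iff Legendre_eq_0_iff)
    thus "Legendre k (int p) * Legendre k (int p) = 1" using Legendre_values[of k p] by auto }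
  { assume "\<not> coprime k (int p)"
    hence k: "int p dvd k" using p by (simp add: coprime_prime_iff)
    obtain g where g: "Legendre g (int p) = -1" using exists_nonresidue[OF p] by blast
    hence "coprime g (int p)" using Legendre_eq_0_iff[of g p] p by (simp add: coprime_prime_iff)
    thus "Legendre k (int p) = 0 \<and> (\<exists>g. Legendre g (int p) = -1 \<and> [g * k = k] (mod int p) \<and> coprime g (int p))"
      using g k by (auto simp: Legendre_eq_0_iff cong_iff_dvd_diff intro!: exI[of _ g] dvd_diff) }
qed (use p in \<open>auto simp: Legendre_mult intro: Legendre_cong\<close>)

text \<open>The residue a has \<open>1 + Legendre a p\<close> square roots modulo p, and the
  constant part contributes the sum of all p-th roots of unity, which is 0.\<close>

lemma quadratic_sum_eq_Legendre_sum:
  assumes p: "prime p" "2 < p"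
  shows "(\<Sum>x\<in>{0..<int p}. unity_root p (x\<^sup>2)) = (\<Sum>a\<in>{0..<int p}. of_int (Legendre a (int p)) * unity_root p a)"
proof -
  define h where "h = (int p - 1) div 2"
  have op: "odd p" using p prime_odd_nat by blast
  have h: "int p = 2 * h + 1" using op by (auto simp: h_def elim: oddE)
  have h0: "h \<ge> 1" using p h by linarith
  define R where "R = {a\<in>{0..<int p}. Legendre a (int p) = 1}"
  let ?u = "\<lambda>x. unity_root p (x\<^sup>2)"
  have neg: "[(int p - x)\<^sup>2 = x\<^sup>2] (mod int p)" for x
    by (auto simp: cong_iff_dvd_diff power2_eq_square algebra_simps)
  have "{0..<int p} = insert 0 ({1..h} \<union> {h+1..2*h})" using h h0 by auto
  hence "(\<Sum>x\<in>{0..<int p}. ?u x) = 1 + ((\<Sum>x\<in>{1..h}. ?u x) + (\<Sum>x\<in>{h+1..2*h}. ?u x))"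
    by (simp add: sum.union_disjoint)
  also have "(\<Sum>x\<in>{h+1..2*h}. ?u x) = (\<Sum>x\<in>{1..h}. ?u x)"
    by (rule sum.reindex_bij_witness[of _ "\<lambda>x. int p - x" "\<lambda>x. int p - x"])
       (use h neg in \<open>auto intro!: unity_root_cong cong_sym[OF neg]\<close>)
  also have "(\<Sum>x\<in>{1..h}. ?u x) = (\<Sum>a\<in>R. unity_root p a)"
  proof (rule sum.reindex_bij_betw[of "\<lambda>x. x\<^sup>2 mod int p" "{1..h}" R "unity_root p", THEN trans[rotated]])
    show "(\<Sum>x\<in>{1..h}. ?u x) = (\<Sum>x\<in>{1..h}. unity_root p (x\<^sup>2 mod int p))"
      by (intro sum.cong refl unity_root_cong) (simp add: cong_def)
    show "bij_betw (\<lambda>x. x\<^sup>2 mod int p) {1..h} R"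
      unfolding bij_betw_def
    proof
      show "inj_on (\<lambda>x. x\<^sup>2 mod int p) {1..h}"
      proof (rule inj_onI)
        fix x y assume xy: "x \<in> {1..h}" "y \<in> {1..h}" "x\<^sup>2 mod int p = y\<^sup>2 mod int p"
        hence "int p dvd (x - y) * (x + y)"
          by (simp add: mod_eq_dvd_iff power2_eq_square algebra_simps)
        hence "int p dvd x - y \<or> int p dvd x + y" using p by (simp add: prime_dvd_mult_iff)
        moreover have "\<not> int p dvd x + y" using xy h zdvd_imp_le[of "int p" "x + y"] by auto
        ultimately have "[x = y] (mod int p)" by (simp add: cong_iff_dvd_diff)
        thus "x = y" by (rule small_cong_imp_eq) (use xy h in auto)
      qed
      show "(\<lambda>x. x\<^sup>2 mod int p) ` {1..h} = R"
      proof (intro equalityI subsetI)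
        fix a assume "a \<in> (\<lambda>x. x\<^sup>2 mod int p) ` {1..h}"
        then obtain x where x: "x \<in> {1..h}" "a = x\<^sup>2 mod int p" by blast
        have "\<not> int p dvd x" using x h zdvd_imp_le[of "int p" x] by auto
        hence "\<not> int p dvd a" using p x by (simp add: prime_dvd_power_iff dvd_mod_iff)
        moreover have "QuadRes (int p) a" unfolding QuadRes_def x by (rule exI[of _ x]) (simp add: cong_def)
        ultimately show "a \<in> R" using p x by (simp add: R_def Legendre_def cong_0_iff)
      next
        fix a assume a: "a \<in> R"
        hence a0: "\<not> int p dvd a" and "QuadRes (int p) a" by (auto simp: R_def Legendre_def cong_0_iff split: if_splits)
        then obtain y where y: "[y\<^sup>2 = a] (mod int p)" by (auto simp: QuadRes_def)
        define z where "z = y mod int p"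
        have z: "[z\<^sup>2 = a] (mod int p)" using y by (simp add: z_def cong_def power_mod)
        have z0: "z \<noteq> 0" using z a0 by (auto simp: cong_0_iff dest: cong_sym)
        have zr: "0 < z" "z < int p" using z0 p pos_mod_bound[of "int p" y] pos_mod_sign[of "int p" y]
          unfolding z_def by linarith+
        have aeq: "a = a mod int p" using a by (simp add: R_def)
        show "a \<in> (\<lambda>x. x\<^sup>2 mod int p) ` {1..h}"
        proof (cases "z \<le> h")
          case True
          thus ?thesis using zr z aeq by (intro image_eqI[of _ _ z]) (auto simp: cong_def)
        next
          case False
          have "[(int p - z)\<^sup>2 = a] (mod int p)" using cong_trans[OF neg z] .
          thus ?thesis using zr aeq False h by (intro image_eqI[of _ _ "int p - z"]) (auto simp: cong_def)
        qed
      qed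
    qed
  qed
  also have "1 + ((\<Sum>a\<in>R. unity_root p a) + (\<Sum>a\<in>R. unity_root p a)) = unity_root p 0 + (\<Sum>a\<in>R. 2 * unity_root p a)"
    by (simp add: sum_distrib_left[symmetric])
  \<comment> \<open>The weight is 1 at 0, 2 on the nonzero squares and 0 on nonresidues, so the
    range can then be enlarged to all residues.\<close>
  also have "\<dots> = (\<Sum>a\<in>insert 0 R. (1 + of_int (Legendre a (int p))) * unity_root p a)"
  proof -
    have L0: "Legendre 0 (int p) = 0" by (simp add: Legendre_eq_0_iff)
    moreover have "0 \<notin> R" by (simp add: R_def L0)
    moreover have "finite R" by (rule finite_subset[of _ "{0..<int p}"]) (auto simp: R_def)
    moreover have "(\<Sum>a\<in>R. 2 * unity_root p a) = (\<Sum>a\<in>R. (1 + of_int (Legendre a (int p))) * unity_root p a)"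
      by (intro sum.cong refl) (simp add: R_def)
    ultimately show ?thesis by simp
  qed
  also have "\<dots> = (\<Sum>a\<in>{0..<int p}. (1 + of_int (Legendre a (int p))) * unity_root p a)"
  proof (rule sum.mono_neutral_left)
    show "insert 0 R \<subseteq> {0..<int p}" using p by (auto simp: R_def)
    show "\<forall>a\<in>{0..<int p} - insert 0 R. (1 + of_int (Legendre a (int p))) * unity_root p a = 0"
    proof
      fix a assume a: "a \<in> {0..<int p} - insert 0 R"
      hence "\<not> int p dvd a" using zdvd_imp_le[of "int p" a] by auto
      hence "Legendre a (int p) = -1" using a Legendre_values[of a p] Legendre_eq_0_iff[of a p] by (auto simp: R_def)
      thus "(1 + of_int (Legendre a (int p))) * unity_root p a = 0" by simp
    qed
  qed simp
  also have "\<dots> = (\<Sum>a\<in>{0..<int p}. unity_root p (a * 1)) + (\<Sum>a\<in>{0..<int p}. of_int (Legendre a (int p)) * unity_root p a)"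
    by (simp add: ring_distribs sum.distrib)
  also have "(\<Sum>a\<in>{0..<int p}. unity_root p (a * 1)) = 0"
    using p by (subst sum_unity_root) auto
  finally show ?thesis by simp
qed

lemma unity_root_4:
  assumes "odd k"
  shows "unity_root 4 k = (if k mod 4 = 1 then \<i> else - \<i>)"
proof -
  have "unity_root 4 k = unity_root 4 (k mod 4)" by (rule unity_root_cong) (simp add: cong_def)
  moreover have "k mod 4 = 1 \<or> k mod 4 = 3" using assms by presburger
  moreover have "unity_root 4 1 = \<i>" by (simp add: unity_root_def cis.ctr complex_eq_iff)
  moreover have "unity_root 4 3 = unity_root 4 (int 4 * 1) * unity_root 4 (-1)"
    by (subst unity_root_add[symmetric]) simp
  moreover have "unity_root 4 (-1) = - \<i>" by (simp add: unity_root_def complex_eq_iff)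
  moreover have "unity_root 4 4 = 1" using unity_root_mult_N[of 4 1] by simp
  ultimately show ?thesis by auto
qed

text \<open>
  Both sides equal the sum of \<open>exp (2\<pi>i x\<^sup>2 / 4p)\<close> over \<open>x\<close> modulo \<open>2p\<close>: on the left odd \<open>x\<close> are
  written as \<open>2z + p\<close>, where \<open>x\<^sup>2 / 4p = z\<^sup>2 / p + z + p / 4\<close>; on the right \<open>x\<close> is paired with \<open>2p - x\<close>.
\<close>

lemma quadratic_sum_double:
  assumes p: "odd p"
  shows "(\<Sum>x\<in>{0..<int p}. unity_root p (x\<^sup>2)) * (1 + unity_root 4 (int p)) =
           1 + unity_root 4 (int p) + 2 * (\<Sum>x=1..<p. cis (pi * real x ^ 2 / (2 * real p)))"
proof -
  have p0: "p > 0" using p by (auto elim: oddE)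
  define u where "u = (\<lambda>x. unity_root (p * 4) (x\<^sup>2))"
  define G where "G = (\<Sum>x\<in>{0..<int p}. unity_root p (x\<^sup>2))"
  define h where "h = (int p - 1) div 2"
  have h: "int p = 2 * h + 1" using p by (auto simp: h_def elim: oddE)
  have up: "u (int p) = unity_root 4 (int p)"
    using unity_root_mult_cancel[OF p0, of 4 "int p"] by (simp add: u_def power2_eq_square mult.commute)
  have urefl: "u (2 * int p - x) = u x" for x
    unfolding u_def
  proof (rule unity_root_cong)
    have "(2 * int p - x)\<^sup>2 - x\<^sup>2 = int (p * 4) * (int p - x)" by (simp add: power2_eq_square algebra_simps)
    thus "[(2 * int p - x)\<^sup>2 = x\<^sup>2] (mod int (p * 4))" by (simp only: cong_iff_dvd_diff dvd_triv_left)
  qed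
  have "{0..<2 * int p} = (\<lambda>y. 2 * y) ` {0..<int p} \<union> (\<lambda>y. 2 * y + 1) ` {0..<int p}"
  proof (intro equalityI subsetI)
    fix x assume "x \<in> {0..<2 * int p}"
    thus "x \<in> (\<lambda>y. 2 * y) ` {0..<int p} \<union> (\<lambda>y. 2 * y + 1) ` {0..<int p}"
      by (cases "even x") (auto elim!: evenE oddE)
  qed auto
  hence "(\<Sum>x\<in>{0..<2 * int p}. u x) = (\<Sum>x\<in>(\<lambda>y. 2 * y) ` {0..<int p}. u x) + (\<Sum>x\<in>(\<lambda>y. 2 * y + 1) ` {0..<int p}. u x)"
    by (simp only:) (rule sum.union_disjoint, auto, presburger)
  also have "(\<Sum>x\<in>(\<lambda>y. 2 * y) ` {0..<int p}. u x) = (\<Sum>y\<in>{0..<int p}. u (2 * y))"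
    by (subst sum.reindex) (auto simp: inj_on_def)
  also have "\<dots> = G"
    unfolding G_def
  proof (intro sum.cong refl)
    fix y show "u (2 * y) = unity_root p (y\<^sup>2)"
      using unity_root_mult_cancel[of 4 p "y\<^sup>2"] by (simp add: u_def power_mult_distrib mult.commute)
  qed
  also have "(\<Sum>x\<in>(\<lambda>y. 2 * y + 1) ` {0..<int p}. u x) = (\<Sum>y\<in>{0..<int p}. u (2 * y + 1))"
    by (subst sum.reindex) (auto simp: inj_on_def)
  also have "\<dots> = (\<Sum>y\<in>{0..<int p}. unity_root p ((1 * y + (- h))\<^sup>2) * unity_root 4 (int p))"
  proof (intro sum.cong refl)
    fix y
    let ?z = "y - h"
    have "(2 * y + 1)\<^sup>2 = (?z\<^sup>2 + int p * ?z) * int 4 + (int p)\<^sup>2"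
      by (simp add: h power2_eq_square algebra_simps)
    hence "u (2 * y + 1) = unity_root p (?z\<^sup>2 + int p * ?z) * u (int p)"
      unfolding u_def by (simp only: unity_root_add[of "p * 4"] unity_root_mult_cancel[of 4] zero_less_numeral)
    thus "u (2 * y + 1) = unity_root p ((1 * y + (- h))\<^sup>2) * unity_root 4 (int p)"
      by (simp add: unity_root_add[of p] up)
  qed
  also have "\<dots> = G * unity_root 4 (int p)"
    unfolding sum_distrib_right[symmetric] G_def
    by (subst sum_over_residues_mult[OF p0, of "\<lambda>x. unity_root p (x\<^sup>2)"]) (auto intro: unity_root_cong cong_pow)
  finally have 1: "(\<Sum>x\<in>{0..<2 * int p}. u x) = G + G * unity_root 4 (int p)" .
  have "{0..<2 * int p} = insert 0 (insert (int p) ({1..int p - 1} \<union> {int p + 1..2 * int p - 1}))"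
    using p0 by auto
  hence "(\<Sum>x\<in>{0..<2 * int p}. u x) = u 0 + (u (int p) + ((\<Sum>x\<in>{1..int p - 1}. u x) + (\<Sum>x\<in>{int p + 1..2 * int p - 1}. u x)))"
    using p0 by (simp add: sum.union_disjoint)
  also have "(\<Sum>x\<in>{int p + 1..2 * int p - 1}. u x) = (\<Sum>x\<in>{1..int p - 1}. u x)"
    by (rule sum.reindex_bij_witness[of _ "\<lambda>x. 2 * int p - x" "\<lambda>x. 2 * int p - x"]) (auto simp: urefl)
  also have "(\<Sum>x\<in>{1..int p - 1}. u x) = (\<Sum>x=1..<p. cis (pi * real x ^ 2 / (2 * real p)))"
    by (rule sum.reindex_bij_witness[of _ int nat]) (auto simp: u_def unity_root_def)
  finally show ?thesis using 1 by (simp add: G_def[symmetric] up) (simp add: u_def algebra_simps)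
qed

text \<open>For odd p this is the prime with the sign \<open>(-1) ^ ((p - 1) div 2)\<close>, i.e.
  the discriminant of the quadratic subfield of the p-th cyclotomic field.\<close>

definition prime_disc :: "nat \<Rightarrow> int" where
  "prime_disc p = (if p mod 4 = 1 then int p else - int p)"

lemma csqrt_of_int:
  "csqrt (of_int D) = (if D \<ge> 0 then of_real (sqrt \<bar>real_of_int D\<bar>) else \<i> * of_real (sqrt \<bar>real_of_int D\<bar>))"
proof (cases "D \<ge> 0")
  case True
  hence "csqrt (of_real (real_of_int D)) = of_real (sqrt (real_of_int D))" by (intro of_real_sqrt[symmetric]) auto
  thus ?thesis using True by simp
next
  case False
  thus ?thesis by (simp add: csqrt_of_real_nonpos)
qed

text \<open>The square of the Gauss sum leaves two opposite candidates. With
  \<open>e = unity_root 4 p\<close> the wrong one would make the real part of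
  \<open>c * (1 + e)\<close> equal to \<open>- sqrt p\<close>, in both classes modulo 4; the strict
  estimate for the cosine sum excludes precisely this value.\<close>

theorem gauss_char_prime_disc:
  assumes p: "prime p" "2 < p"
  shows "gauss_char p (\<lambda>a. Legendre a (int p)) (csqrt (of_int (prime_disc p)))"
proof -
  define c where "c = (\<Sum>a\<in>{0..<int p}. of_int (Legendre a (int p)) * unity_root p a)"
  have g: "gauss_char p (\<lambda>a. Legendre a (int p)) c" unfolding c_def by (rule gauss_char_Legendre[OF p])
  have op: "odd p" using p prime_odd_nat by blast
  have sq: "c * c * of_int ((-1) ^ ((p - 1) div 2)) = of_nat p"
    using gauss_char_square[OF g] Legendre_1[of "int p"] p by (simp add: Legendre_minus_1)
  define s where "s = sqrt (real p)"
  have s: "of_real s * of_real s = complex_of_nat p" "s > 0"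
    using p by (simp_all add: s_def flip: of_real_mult)
  define e where "e = unity_root 4 (int p)"
  have m4: "int p mod 4 = 1 \<longleftrightarrow> p mod 4 = 1" by presburger
  have e: "e = (if p mod 4 = 1 then \<i> else - \<i>)" unfolding e_def using op m4 by (subst unity_root_4) auto
  have "c * (1 + e) = 1 + e + 2 * (\<Sum>x=1..<p. cis (pi * real x ^ 2 / (2 * real p)))"
    using quadratic_sum_double[OF op] unfolding quadratic_sum_eq_Legendre_sum[OF p] c_def e_def .
  from arg_cong[OF this, of Re]
  have "Re (c * (1 + e)) = 1 + 2 * (\<Sum>x=1..<p. cos (pi * real x ^ 2 / (2 * real p)))"
    by (simp add: e)
  also have "\<dots> > - s" unfolding s_def using p by (intro quadratic_cos_sum_gt) auto
  finally have pos: "Re (c * (1 + e)) > - s" .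
  have "c = csqrt (of_int (prime_disc p))"
  proof (cases "p mod 4 = 1")
    case True
    hence "even ((p - 1) div 2)" by presburger
    hence "c * c = of_real s * of_real s" using sq s by simp
    hence "c = of_real s \<or> c = - of_real s" by (simp only: square_eq_iff)
    hence "c = of_real s" using pos by (auto simp: e True)
    thus ?thesis using True by (simp add: prime_disc_def csqrt_of_int s_def)
  next
    case False
    hence "p mod 4 = 3" using op by presburger
    hence "odd ((p - 1) div 2)" by presburger
    hence "c * c = - (of_real s * of_real s)" using sq s by (simp add: minus_equation_iff)
    also have "\<dots> = (\<i> * of_real s) * (\<i> * of_real s)" by (simp add: complex_eq_iff)
    finally have "c * c = (\<i> * of_real s) * (\<i> * of_real s)" .
    hence "c = \<i> * of_real s \<or> c = - (\<i> * of_real s)" by (simp only: square_eq_iff)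
    hence "c = \<i> * of_real s" using pos False by (auto simp: e)
    thus ?thesis using False p by (simp add: prime_disc_def csqrt_of_int s_def)
  qed
  thus ?thesis using g by simp
qed

section \<open>Kronecker symbols of fundamental discriminants\<close>

text \<open>The primitive quadratic character of discriminant -4. With \<open>chi8\<close>, of
  discriminant 8, and the product of both, of discriminant -8, it makes up all primitive quadratic
  characters of 2-power conductor above 1.\<close>

definition chi4 :: "int \<Rightarrow> int" where
  "chi4 a = (if a mod 4 = 1 then 1 else if a mod 4 = 3 then -1 else 0)"

definition chi8 :: "int \<Rightarrow> int" where
  "chi8 a = (if a mod 8 \<in> {1, 7} then 1 else if a mod 8 \<in> {3, 5} then -1 else 0)"

lemma chi4_mod_cong: "a mod 4 = b mod 4 \<Longrightarrow> chi4 a = chi4 b"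
  by (simp only: chi4_def)

lemma chi8_cong: "[a = b] (mod 8) \<Longrightarrow> chi8 a = chi8 b"
  by (simp only: chi8_def cong_def)

lemma residue_cases_4: "(a::int) mod 4 \<in> {0,1,2,3}"
  by (simp, presburger)

lemma residue_cases_8: "(a::int) mod 8 \<in> {0,1,2,3,4,5,6,7}"
  by (simp, presburger)

lemma chi4_mult: "chi4 (a * b) = chi4 a * chi4 b"
proof -
  have "\<forall>r\<in>{0,1,2,3}. \<forall>s\<in>{0,1,2,3}. chi4 (r * s) = chi4 r * chi4 s"
    by (simp add: chi4_def)
  hence "chi4 ((a mod 4) * (b mod 4)) = chi4 (a mod 4) * chi4 (b mod 4)"
    using residue_cases_4 by blast
  moreover have "chi4 (x mod 4) = chi4 x" for x by (rule chi4_mod_cong) (rule mod_mod_trivial)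
  moreover have "chi4 ((a mod 4) * (b mod 4)) = chi4 (a * b)" by (rule chi4_mod_cong) (rule mod_mult_eq)
  ultimately show ?thesis by simp
qed

lemma chi8_mult: "chi8 (a * b) = chi8 a * chi8 b"
proof -
  have "\<forall>r\<in>{0,1,2,3,4,5,6,7}. \<forall>s\<in>{0,1,2,3,4,5,6,7}. chi8 (r * s) = chi8 r * chi8 s"
    by (simp add: chi8_def)
  hence "chi8 ((a mod 8) * (b mod 8)) = chi8 (a mod 8) * chi8 (b mod 8)"
    using residue_cases_8 by blast
  moreover have "chi8 (x mod 8) = chi8 x" for x
    by (rule chi8_cong) (simp only: cong_def mod_mod_trivial)
  moreover have "chi8 ((a mod 8) * (b mod 8)) = chi8 (a * b)"
    by (rule chi8_cong) (simp only: cong_def mod_mult_eq)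
  ultimately show ?thesis by simp
qed

lemma chi4_cong: "[a = b] (mod 8) \<Longrightarrow> chi4 a = chi4 b"
proof -
  assume "[a = b] (mod 8)"
  hence "[a = b] (mod 4)" by (rule cong_dvd_modulus) simp
  thus ?thesis unfolding cong_def by (rule chi4_mod_cong)
qed

lemma coprime_power2_iff: "k > 0 \<Longrightarrow> coprime (a::int) (2 ^ k) \<longleftrightarrow> odd a"
  by (simp add: coprime_right_2_iff_odd)

lemma chi_odd_cases:
  assumes "odd a"
  shows "chi4 a * chi4 a = 1" "chi8 a * chi8 a = 1"
proof -
  have "a mod 4 = 1 \<or> a mod 4 = 3" "a mod 8 = 1 \<or> a mod 8 = 3 \<or> a mod 8 = 5 \<or> a mod 8 = 7"
    using assms by presburger+
  thus "chi4 a * chi4 a = 1" "chi8 a * chi8 a = 1" by (auto simp: chi4_def chi8_def)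
qed

lemma chi_even:
  assumes "even a"
  shows "chi4 a = 0" "chi8 a = 0"
proof -
  have "a mod 4 = 0 \<or> a mod 4 = 2" "a mod 8 = 0 \<or> a mod 8 = 2 \<or> a mod 8 = 4 \<or> a mod 8 = 6"
    using assms by presburger+
  thus "chi4 a = 0" "chi8 a = 0" by (auto simp: chi4_def chi8_def)
qed

lemma unity_root_8:
  "unity_root 8 3 = - unity_root 8 (-1)" "unity_root 8 5 = - unity_root 8 1"
  "unity_root 8 7 = unity_root 8 (-1)"
proof -
  have 4: "unity_root 8 4 = -1" by (simp add: unity_root_def)
  show "unity_root 8 3 = - unity_root 8 (-1)" "unity_root 8 5 = - unity_root 8 1"
    using unity_root_add[of 8 4 "-1"] unity_root_add[of 8 4 1] 4 by simp_all
  show "unity_root 8 7 = unity_root 8 (-1)" by (rule unity_root_cong) (simp add: cong_def)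
qed

text \<open>The witness for \<open>gauss_charI\<close> is 1 plus half the modulus, here 3 and modulo
  8 below 5: it fixes all even k and the character takes the value -1 there. The Gauss sum itself is
  then evaluated term by term.\<close>

lemma gauss_char_chi4: "gauss_char 4 chi4 (csqrt (of_int (-4)))"
proof -
  have "gauss_char 4 chi4 (\<Sum>a\<in>{0..<int 4}. of_int (chi4 a) * unity_root 4 a)"
  proof (rule gauss_charI)
    fix k assume "\<not> coprime k (int 4)"
    hence "even k" using coprime_power2_iff[of 2 k] by simp
    moreover have "[3 * k = k] (mod 4)" using calculation by (simp add: cong_iff_dvd_diff) presburger
    moreover have "coprime (3::int) (2 ^ 2)" by (subst coprime_power2_iff) auto
    ultimately show "chi4 k = 0 \<and> (\<exists>g. chi4 g = -1 \<and> [g * k = k] (mod int 4) \<and> coprime g (int 4))"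
      using chi_even[of k] by (intro conjI exI[of _ 3]) (auto simp: chi4_def[of 3])
  qed (use coprime_power2_iff[of 2] in
      \<open>auto simp: chi4_mult chi_odd_cases cong_def intro: chi4_mod_cong\<close>)
  moreover have "{0..<int 4} = {0, 1, 2, 3}" by auto
  ultimately show ?thesis
    using unity_root_4[of 1] unity_root_4[of 3] by (simp add: chi4_def csqrt_of_int mult.commute)
qed

lemma gauss_char_chi8: "gauss_char 8 chi8 (csqrt (of_int 8))"
proof -
  have "gauss_char 8 chi8 (\<Sum>a\<in>{0..<int 8}. of_int (chi8 a) * unity_root 8 a)"
  proof (rule gauss_charI)
    fix k assume "\<not> coprime k (int 8)"
    hence "even k" using coprime_power2_iff[of 3 k] by simp
    moreover have "[5 * k = k] (mod 8)" using calculation by (simp add: cong_iff_dvd_diff) presburger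
    moreover have "coprime (5::int) (2 ^ 3)" by (subst coprime_power2_iff) auto
    ultimately show "chi8 k = 0 \<and> (\<exists>g. chi8 g = -1 \<and> [g * k = k] (mod int 8) \<and> coprime g (int 8))"
      using chi_even[of k] by (intro conjI exI[of _ 5]) (auto simp: chi8_def[of 5])
  qed (use coprime_power2_iff[of 3] in \<open>auto simp: chi8_mult chi_odd_cases intro: chi8_cong\<close>)
  moreover have "{0..<int 8} = {0, 1, 2, 3, 4, 5, 6, 7}" by auto
  moreover have "sqrt 8 = 2 * sqrt 2" using real_sqrt_mult[of 4 2] by simp
  moreover have "unity_root 8 1 + unity_root 8 (-1) = of_real (sqrt 2)"
    by (simp add: unity_root_def complex_eq_iff cos_45)
  ultimately show ?thesis
    by (simp add: chi8_def csqrt_of_int unity_root_8) (simp add: algebra_simps)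
qed

lemma gauss_char_chi4_chi8: "gauss_char 8 (\<lambda>a. chi4 a * chi8 a) (csqrt (of_int (-8)))"
proof -
  have "gauss_char 8 (\<lambda>a. chi4 a * chi8 a) (\<Sum>a\<in>{0..<int 8}. of_int (chi4 a * chi8 a) * unity_root 8 a)"
  proof (rule gauss_charI)
    fix k assume "\<not> coprime k (int 8)"
    hence "even k" using coprime_power2_iff[of 3 k] by simp
    moreover have "[5 * k = k] (mod 8)" using calculation by (simp add: cong_iff_dvd_diff) presburger
    moreover have "coprime (5::int) (2 ^ 3)" by (subst coprime_power2_iff) auto
    ultimately show "chi4 k * chi8 k = 0 \<and> (\<exists>g. chi4 g * chi8 g = -1 \<and> [g * k = k] (mod int 8) \<and> coprime g (int 8))"
      using chi_even[of k] by (intro conjI exI[of _ 5]) (auto simp: chi8_def[of 5] chi4_def[of 5])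
  next
    fix k assume "coprime k (int 8)"
    hence "odd k" using coprime_power2_iff[of 3 k] by simp
    thus "chi4 k * chi8 k * (chi4 k * chi8 k) = 1"
      using chi_odd_cases[of k] by (metis mult.assoc mult.commute mult_1)
  next
    fix a b assume "[a = b] (mod int 8)"
    thus "chi4 a * chi8 a = chi4 b * chi8 b" using chi4_cong[of a b] chi8_cong[of a b] by simp
  qed (auto simp: chi8_mult chi4_mult)
  moreover have "{0..<int 8} = {0, 1, 2, 3, 4, 5, 6, 7}" by auto
  moreover have "sqrt 8 = 2 * sqrt 2" using real_sqrt_mult[of 4 2] by simp
  moreover have "unity_root 8 1 - unity_root 8 (-1) = \<i> * of_real (sqrt 2)"
    by (simp add: unity_root_def complex_eq_iff sin_45)
  ultimately show ?thesis
    by (simp add: chi4_def chi8_def csqrt_of_int unity_root_8) (simp add: algebra_simps)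
qed

lemma gauss_char_1: "gauss_char 1 (\<lambda>_. 1) (csqrt (of_int 1))"
proof -
  have "{0..<int 1} = {0}" by auto
  thus ?thesis by (simp add: gauss_char_def)
qed

text \<open>The possible 2-parts of a fundamental discriminant; 1 stands for an odd one.\<close>

definition two_disc :: "int set" where "two_disc = {1, -4, 8, -8}"

definition two_char :: "int \<Rightarrow> int \<Rightarrow> int" where
  "two_char E a = (if E = 1 then 1 else if E = -4 then chi4 a else if E = 8 then chi8 a else chi4 a * chi8 a)"

lemma gauss_char_two_char:
  assumes "E \<in> two_disc"
  shows "gauss_char (nat \<bar>E\<bar>) (two_char E) (csqrt (of_int E))"
  using assms gauss_char_1 gauss_char_chi4 gauss_char_chi8 gauss_char_chi4_chi8
  unfolding two_disc_def two_char_def by auto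

text \<open>The Hilbert symbol at the real place. It plays two roles: the defect of multiplicativity
  of \<open>csqrt\<close>, and the sign in quadratic reciprocity for signed primes.\<close>

definition neg_sign :: "int \<Rightarrow> int \<Rightarrow> int" where
  "neg_sign D E = (if D < 0 \<and> E < 0 then -1 else 1)"

lemma neg_sign_commute: "neg_sign D E = neg_sign E D"
  by (simp add: neg_sign_def)

lemma neg_sign_prod:
  assumes "finite S" "\<And>p. p \<in> S \<Longrightarrow> f p \<noteq> 0"
  shows "(\<Prod>p\<in>S. neg_sign D (f p)) = neg_sign D (\<Prod>p\<in>S. f p)"
  using assms
proof (induction S rule: finite_induct)
  case (insert p S)
  have "f p \<noteq> 0" "(\<Prod>p\<in>S. f p) \<noteq> 0" using insert by auto
  thus ?case using insert by (auto simp: neg_sign_def mult_less_0_iff)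
qed (simp add: neg_sign_def)

lemma csqrt_of_int_mult:
  "csqrt (of_int (D * E)) = of_int (neg_sign D E) * csqrt (of_int D) * csqrt (of_int E)"
proof -
  have "sqrt \<bar>real_of_int (D * E)\<bar> = sqrt \<bar>real_of_int D\<bar> * sqrt \<bar>real_of_int E\<bar>"
    by (simp add: abs_mult real_sqrt_mult)
  thus ?thesis
    unfolding csqrt_of_int neg_sign_def by (auto simp: complex_eq_iff zero_le_mult_iff mult_le_0_iff)
qed

text \<open>The last hypothesis is reciprocity for D and E. It makes the cross factor of
  \<open>gauss_char_mult\<close> coincide with the sign by which \<open>csqrt\<close> fails to be
  multiplicative, so the normalisation is preserved.\<close>

lemma gauss_char_disc_mult:
  assumes "gauss_char (nat \<bar>D\<bar>) f (csqrt (of_int D))" "gauss_char (nat \<bar>E\<bar>) h (csqrt (of_int E))"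
    and "coprime D E" and "f \<bar>E\<bar> * h \<bar>D\<bar> = neg_sign D E"
  shows "gauss_char (nat \<bar>D * E\<bar>) (\<lambda>a. f a * h a) (csqrt (of_int (D * E)))"
proof -
  have "coprime (nat \<bar>D\<bar>) (nat \<bar>E\<bar>)" using assms(3) by (simp add: coprime_nat_abs_left_iff flip: coprime_int_iff)
  from gauss_char_mult[OF assms(1,2) this] assms(4) show ?thesis
    by (simp add: csqrt_of_int_mult abs_mult nat_mult_distrib del: of_int_mult)
qed

lemma prime_disc_props:
  assumes "prime p" "2 < p"
  shows "\<bar>prime_disc p\<bar> = int p" "prime_disc p < 0 \<longleftrightarrow> p mod 4 = 3" "prime_disc p \<noteq> 0" "prime_disc p mod 4 = 1"
proof -
  have "odd p" using assms prime_odd_nat by blast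
  hence *: "p mod 4 = 1 \<or> p mod 4 = 3" by presburger
  show "\<bar>prime_disc p\<bar> = int p" "prime_disc p \<noteq> 0" using assms by (auto simp: prime_disc_def)
  show "prime_disc p < 0 \<longleftrightarrow> p mod 4 = 3" using * assms by (auto simp: prime_disc_def)
  have "int p mod 4 = (if p mod 4 = 1 then 1 else 3)" using * zmod_int[of p 4] by auto
  moreover have "(- int p) mod 4 = 1" if "int p mod 4 = 3" using that by presburger
  ultimately show "prime_disc p mod 4 = 1" by (auto simp: prime_disc_def)
qed

text \<open>The exponents of the classical law are both odd exactly if both primes are 3 modulo 4,
  i.e. if both signed primes are negative.\<close>

lemma Legendre_reciprocity:
  assumes p: "prime p" "2 < p" and q: "prime q" "2 < q" and "p \<noteq> q"
  shows "Legendre (int p) (int q) * Legendre (int q) (int p) = neg_sign (prime_disc p) (prime_disc q)"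
proof -
  have odd: "odd p" "odd q" using p q prime_odd_nat by blast+
  have "odd ((p - 1) div 2) \<longleftrightarrow> p mod 4 = 3" "odd ((q - 1) div 2) \<longleftrightarrow> q mod 4 = 3"
    using odd by presburger+
  hence "(-1 :: int) ^ ((p - 1) div 2 * ((q - 1) div 2)) = neg_sign (prime_disc p) (prime_disc q)"
    using p q by (auto simp: neg_sign_def prime_disc_props minus_one_power_iff)
  thus ?thesis using Quadratic_Reciprocity[OF p q assms(5)] by simp
qed

lemma Legendre_prod:
  assumes "prime q" "2 < q"
  shows "Legendre (\<Prod>p\<in>S. f p) (int q) = (\<Prod>p\<in>S. Legendre (f p) (int q))"
  using assms Legendre_1[of "int q"] by (induction S rule: infinite_finite_induct) (auto simp: Legendre_mult)

lemma abs_prod_prime_disc: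
  assumes "\<And>p. p \<in> S \<Longrightarrow> prime p \<and> 2 < p"
  shows "\<bar>\<Prod>p\<in>S. prime_disc p\<bar> = (\<Prod>p\<in>S. int p)"
  unfolding abs_prod using assms by (intro prod.cong refl) (simp add: prime_disc_props)

text \<open>Adding a prime q costs the cross factor between q and all of S. It is the product of the
  pairwise reciprocity signs, which multiply up to the sign for the whole product.\<close>

lemma gauss_char_prod_primes:
  assumes "finite S" "\<And>p. p \<in> S \<Longrightarrow> prime p \<and> 2 < p"
  defines "D \<equiv> \<lambda>S. \<Prod>p\<in>S. prime_disc p"
  shows "gauss_char (nat \<bar>D S\<bar>) (\<lambda>a. \<Prod>p\<in>S. Legendre a (int p)) (csqrt (of_int (D S)))"
  using assms(1,2)
proof (induction S rule: finite_induct)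
  case empty
  thus ?case using gauss_char_1 by (simp add: D_def)
next
  case (insert q S)
  have q: "prime q" "2 < q" using insert.prems by auto
  have S: "p \<in> S \<Longrightarrow> prime p \<and> 2 < p \<and> p \<noteq> q" for p using insert by auto
  have DS: "\<bar>D S\<bar> = (\<Prod>p\<in>S. int p)" unfolding D_def using S by (intro abs_prod_prime_disc) auto
  have "coprime (int q) (\<Prod>p\<in>S. int p)"
    by (rule prod_coprime_right) (use q S primes_coprime in auto)
  hence cop: "coprime (prime_disc q) (D S)"
    using q DS by (metis coprime_abs_left_iff coprime_abs_right_iff prime_disc_props(1))
  have "Legendre \<bar>D S\<bar> (int q) * (\<Prod>p\<in>S. Legendre \<bar>prime_disc q\<bar> (int p)) =
          (\<Prod>p\<in>S. Legendre (int p) (int q) * Legendre (int q) (int p))"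
    using q by (simp add: DS Legendre_prod prod.distrib prime_disc_props)
  also have "\<dots> = (\<Prod>p\<in>S. neg_sign (prime_disc q) (prime_disc p))"
    using S q by (intro prod.cong refl) (subst Legendre_reciprocity, auto simp: neg_sign_commute)
  also have "\<dots> = neg_sign (prime_disc q) (D S)"
    unfolding D_def using insert.hyps S by (intro neg_sign_prod) (auto simp: prime_disc_props)
  finally have "gauss_char (nat \<bar>prime_disc q * D S\<bar>) (\<lambda>a. Legendre a (int q) * (\<Prod>p\<in>S. Legendre a (int p)))
      (csqrt (of_int (prime_disc q * D S)))"
    using gauss_char_prime_disc[OF q] insert.IH S q cop
    by (intro gauss_char_disc_mult) (auto simp: prime_disc_props)
  thus ?case using insert.hyps by (simp add: D_def)
qed

lemma two_char_mult: "two_char E (a * b) = two_char E a * two_char E b"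
  by (simp add: two_char_def chi4_mult chi8_mult)

lemma two_char_1: "two_char E 1 = 1"
  by (simp add: two_char_def chi4_def chi8_def)

lemma two_char_prod: "two_char E (\<Prod>p\<in>S. f p) = (\<Prod>p\<in>S. two_char E (f p))"
  by (induction S rule: infinite_finite_induct) (auto simp: two_char_mult two_char_1)

text \<open>Both parts rest on the supplementary laws, by which -1 has symbol \<open>chi4 p\<close>
  and 2 has symbol \<open>chi8 p\<close>. The first part exchanges numerator and denominator at the
  prime 2; the second is the cross factor required by \<open>gauss_char_disc_mult\<close>.\<close>

lemma Legendre_two_disc:
  assumes p: "prime p" "2 < p" and E: "E \<in> two_disc"
  shows "Legendre E (int p) = two_char E (int p)"
    and "Legendre \<bar>E\<bar> (int p) * two_char E (int p) = neg_sign E (prime_disc p)"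
proof -
  have op: "odd p" using p prime_odd_nat by blast
  have p4: "p mod 4 = 1 \<or> p mod 4 = 3" using op by presburger
  have "odd ((p - 1) div 2) \<longleftrightarrow> p mod 4 = 3" using op by presburger
  hence L1: "Legendre (-1) (int p) = chi4 (int p)"
    using p p4 zmod_int[of p 4] by (auto simp: Legendre_minus_1 chi4_def minus_one_power_iff)
  have "p mod 8 = 1 \<or> p mod 8 = 3 \<or> p mod 8 = 5 \<or> p mod 8 = 7" using op by presburger
  hence L2: "Legendre 2 (int p) = chi8 (int p)"
    unfolding Legendre_2[OF p] chi8_def using zmod_int[of p 8] by auto
  have sq: "chi8 (int p) * chi8 (int p) = 1" "chi4 (int p) * chi4 (int p) = 1" using op by (auto simp: chi_odd_cases)
  have L4: "Legendre 4 (int p) = 1" using Legendre_mult[OF p, of 2 2] L2 sq by simp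
  have L8: "Legendre 8 (int p) = chi8 (int p)" using Legendre_mult[OF p, of 2 4] L2 L4 by simp
  have Lm4: "Legendre (-4) (int p) = chi4 (int p)" using Legendre_mult[OF p, of "-1" 4] L1 L4 by simp
  have Lm8: "Legendre (-8) (int p) = chi4 (int p) * chi8 (int p)" using Legendre_mult[OF p, of "-1" 8] L1 L8 by simp
  have Lone: "Legendre 1 (int p) = 1" using p by (intro Legendre_1) auto
  show "Legendre E (int p) = two_char E (int p)"
    using E by (auto simp: two_disc_def two_char_def L8 Lm4 Lm8 Lone)
  have "chi4 (int p) = (if prime_disc p < 0 then -1 else 1)"
    using p4 zmod_int[of p 4] p by (auto simp: chi4_def prime_disc_props)
  moreover have "chi8 (int p) * (chi4 (int p) * chi8 (int p)) = chi4 (int p)"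
    using sq by (metis mult.commute mult.left_commute mult.right_neutral)
  ultimately show "Legendre \<bar>E\<bar> (int p) * two_char E (int p) = neg_sign E (prime_disc p)"
    using E sq by (auto simp: two_disc_def two_char_def L8 L4 Lone neg_sign_def)
qed

text \<open>The argument stands in the numerators, so periodicity and multiplicativity are visible;
  in the Kronecker symbol the discriminant stands there instead. Reciprocity identifies the
  two.\<close>

definition disc_char :: "int \<Rightarrow> nat set \<Rightarrow> int \<Rightarrow> int" where
  "disc_char E S a = two_char E a * (\<Prod>p\<in>S. Legendre a (int p))"

lemma gauss_char_disc_char:
  assumes E: "E \<in> two_disc" and S: "finite S" "\<And>p. p \<in> S \<Longrightarrow> prime p \<and> 2 < p"
    and D: "D = E * (\<Prod>p\<in>S. prime_disc p)"
  shows "gauss_char (nat \<bar>D\<bar>) (disc_char E S) (csqrt (of_int D))"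
  unfolding disc_char_def D
proof (rule gauss_char_disc_mult)
  let ?P = "\<Prod>p\<in>S. prime_disc p"
  have P: "\<bar>?P\<bar> = (\<Prod>p\<in>S. int p)" using S by (intro abs_prod_prime_disc) auto
  have "odd (\<Prod>p\<in>S. int p)" using S prime_odd_nat by (subst even_prod_iff) auto
  hence "odd ?P" using P by (metis dvd_abs_iff)
  hence "coprime (2 ^ k) ?P" if "k > 0" for k using coprime_power2_iff[OF that, of ?P] by (simp add: coprime_commute)
  from this[of 2] this[of 3] show "coprime E ?P"
    using E by (auto simp: two_disc_def)
  have "two_char E \<bar>?P\<bar> * (\<Prod>p\<in>S. Legendre \<bar>E\<bar> (int p)) = (\<Prod>p\<in>S. Legendre \<bar>E\<bar> (int p) * two_char E (int p))"
    by (simp add: P two_char_prod prod.distrib mult.commute)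
  also have "\<dots> = (\<Prod>p\<in>S. neg_sign E (prime_disc p))"
    using S E by (intro prod.cong refl Legendre_two_disc) auto
  also have "\<dots> = neg_sign E ?P" using S by (intro neg_sign_prod) (auto simp: prime_disc_props)
  finally show "two_char E \<bar>?P\<bar> * (\<Prod>p\<in>S. Legendre \<bar>E\<bar> (int p)) = neg_sign E ?P" .
qed (use gauss_char_two_char[OF E] gauss_char_prod_primes[OF S] in auto)

text \<open>Reciprocity in sign-free form: for p congruent to 3 modulo 4 the symbol of -1 modulo q
  is exactly the reciprocity sign and cancels it. For p = q both symbols are 0.\<close>

lemma Legendre_prime_disc:
  assumes p: "prime p" "2 < p" and q: "prime q" "2 < q"
  shows "Legendre (prime_disc p) (int q) = Legendre (int q) (int p)"
proof (cases "p = q")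
  case True
  have "Legendre (prime_disc p) (int q) = 0" "Legendre (int q) (int p) = 0"
    using True by (auto simp: Legendre_eq_0_iff prime_disc_def)
  thus ?thesis by simp
next
  case False
  have odd: "odd p" "odd q" using p q prime_odd_nat by blast+
  have q4: "odd ((q - 1) div 2) \<longleftrightarrow> q mod 4 = 3" using odd by presburger
  have ndvd: "\<not> int p dvd int q" using p q False primes_dvd_imp_eq by auto
  hence L: "Legendre (int q) (int p) \<in> {-1, 1}" using Legendre_values[of q p] Legendre_eq_0_iff[of q p] by auto
  have R: "Legendre (int p) (int q) * Legendre (int q) (int p) = neg_sign (prime_disc p) (prime_disc q)"
    by (rule Legendre_reciprocity[OF p q False])
  have "Legendre (prime_disc p) (int q) = neg_sign (prime_disc p) (prime_disc q) * Legendre (int p) (int q)"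
  proof (cases "p mod 4 = 1")
    case True
    thus ?thesis by (simp add: prime_disc_def neg_sign_def)
  next
    case False
    have "Legendre (prime_disc p) (int q) = Legendre (-1) (int q) * Legendre (int p) (int q)"
      using Legendre_mult[OF q, of "-1" "int p"] False by (simp add: prime_disc_def)
    moreover have "prime_disc p < 0" using False p by (simp add: prime_disc_def)
    ultimately show ?thesis using q q4 by (auto simp: neg_sign_def prime_disc_props Legendre_minus_1 minus_one_power_iff)
  qed
  also have "\<dots> = Legendre (int q) (int p)"
    unfolding R[symmetric] using L R by (auto simp: neg_sign_def split: if_splits)
  finally show ?thesis .
qed

lemma disc_char_mult:
  assumes "\<And>p. p \<in> S \<Longrightarrow> prime p \<and> 2 < p"
  shows "disc_char E S (a * b) = disc_char E S a * disc_char E S b"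
proof -
  have "(\<Prod>p\<in>S. Legendre (a * b) (int p)) = (\<Prod>p\<in>S. Legendre a (int p) * Legendre b (int p))"
    using assms by (intro prod.cong refl) (auto simp: Legendre_mult)
  thus ?thesis by (simp add: disc_char_def two_char_mult prod.distrib)
qed

lemma disc_char_1:
  assumes "\<And>p. p \<in> S \<Longrightarrow> prime p \<and> 2 < p"
  shows "disc_char E S 1 = 1"
proof -
  have "(\<Prod>p\<in>S. Legendre 1 (int p)) = (\<Prod>p\<in>S. 1)"
    using assms by (intro prod.cong refl Legendre_1) fastforce
  thus ?thesis by (simp add: disc_char_def two_char_1)
qed

lemma abs_disc_char_le: "\<bar>disc_char E S a\<bar> \<le> 1"
proof -
  have "chi4 a \<in> {-1, 0, 1}" "chi8 a \<in> {-1, 0, 1}" by (simp_all add: chi4_def chi8_def)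
  hence "\<bar>two_char E a\<bar> \<le> 1" unfolding two_char_def by auto
  moreover have "\<bar>\<Prod>p\<in>S. Legendre a (int p)\<bar> \<le> 1"
    unfolding abs_prod by (rule prod_le_1) (auto simp: Legendre_def)
  ultimately have "\<bar>two_char E a\<bar> * \<bar>\<Prod>p\<in>S. Legendre a (int p)\<bar> \<le> 1 * 1" by (intro mult_mono) auto
  thus ?thesis by (simp add: disc_char_def abs_mult)
qed

text \<open>At q = 2 the Kronecker symbol is \<open>chi8 D\<close>. If E is not 1, both sides
  vanish; if E = 1, \<open>chi8\<close> is multiplicative and insensitive to the signs of the
  primes, and \<open>chi8 p\<close> is the Legendre symbol of 2. Odd q follow from reciprocity
  factor by factor.\<close>

lemma kronecker_prime_eq_disc_char:
  assumes E: "E \<in> two_disc" and S: "finite S" "\<And>p. p \<in> S \<Longrightarrow> prime p \<and> 2 < p"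
    and D: "D = E * (\<Prod>p\<in>S. prime_disc p)" and q: "prime q"
  shows "kronecker_prime D (int q) = disc_char E S (int q)"
proof (cases "q = 2")
  case True
  have kp: "kronecker_prime D 2 = chi8 D"
  proof -
    have "D mod 8 = 1 \<or> D mod 8 = 3 \<or> D mod 8 = 5 \<or> D mod 8 = 7" if "odd D" using that by presburger
    thus ?thesis using chi_even[of D] by (cases "even D") (auto simp: kronecker_prime_def chi8_def[of D])
  qed
  show ?thesis
  proof (cases "E = 1")
    case False
    hence "even D" "two_char E 2 = 0" using E by (auto simp: two_disc_def D two_char_def chi_even)
    thus ?thesis using True kp by (simp add: disc_char_def chi_even)
  next
    case E1: True
    have "chi8 (\<Prod>p\<in>S. prime_disc p) = (\<Prod>p\<in>S. chi8 (prime_disc p))"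
      using two_char_prod[of 8 prime_disc S] by (simp add: two_char_def)
    also have "\<dots> = (\<Prod>p\<in>S. Legendre 2 (int p))"
    proof (intro prod.cong refl)
      fix p assume "p \<in> S"
      hence p: "prime p" "2 < p" using S by auto
      hence "odd p" using prime_odd_nat by blast
      hence m: "p mod 8 = 1 \<or> p mod 8 = 3 \<or> p mod 8 = 5 \<or> p mod 8 = 7" by presburger
      have "chi8 (- int p) = chi8 (-1) * chi8 (int p)" using chi8_mult[of "-1" "int p"] by simp
      moreover have "chi8 (-1) = 1" by (simp add: chi8_def)
      ultimately have "chi8 (prime_disc p) = chi8 (int p)" by (simp add: prime_disc_def)
      thus "chi8 (prime_disc p) = Legendre 2 (int p)"
        unfolding Legendre_2[OF p] using m zmod_int[of p 8] by (auto simp: chi8_def)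
    qed
    finally show ?thesis using E1 True kp D by (simp add: disc_char_def two_char_def)
  qed
next
  case False
  hence q2: "2 < q" using q prime_ge_2_nat[of q] by linarith
  have "kronecker_prime D (int q) = Legendre E (int q) * (\<Prod>p\<in>S. Legendre (prime_disc p) (int q))"
    using False q q2 by (simp add: kronecker_prime_def D Legendre_mult Legendre_prod)
  also have "(\<Prod>p\<in>S. Legendre (prime_disc p) (int q)) = (\<Prod>p\<in>S. Legendre (int q) (int p))"
    using S q q2 by (intro prod.cong refl Legendre_prime_disc) auto
  finally show ?thesis by (simp add: disc_char_def Legendre_two_disc[OF q q2 E])
qed

lemma kronecker_symbol_eq_disc_char:
  assumes E: "E \<in> two_disc" and S: "finite S" "\<And>p. p \<in> S \<Longrightarrow> prime p \<and> 2 < p"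
    and D: "D = E * (\<Prod>p\<in>S. prime_disc p)" and n: "n > 0"
  shows "kronecker_symbol D (int n) = disc_char E S (int n)"
proof -
  note mult = disc_char_mult[of S E, OF S(2)] and one = disc_char_1[of S E, OF S(2)]
  have pow: "disc_char E S (a ^ k) = disc_char E S a ^ k" for a k
    by (induction k) (auto simp: mult one)
  have prod: "disc_char E S (\<Prod>q\<in>T. g q) = (\<Prod>q\<in>T. disc_char E S (g q))" for T :: "int set" and g
    by (induction T rule: infinite_finite_induct) (auto simp: mult one)
  have "kronecker_symbol D (int n) = (\<Prod>q\<in>prime_factors (int n). kronecker_prime D q ^ multiplicity q (int n))"
    using n by (simp add: kronecker_symbol_def)
  also have "\<dots> = (\<Prod>q\<in>prime_factors (int n). disc_char E S q ^ multiplicity q (int n))"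
  proof (intro prod.cong refl)
    fix q assume "q \<in> prime_factors (int n)"
    hence "prime q" by auto
    hence "prime (nat q)" using prime_int_nat_transfer by blast
    moreover have "q = int (nat q)" using prime_ge_0_int[OF \<open>prime q\<close>] by simp
    ultimately have "prime (nat q)" "q = int (nat q)" .
    thus "kronecker_prime D q ^ multiplicity q (int n) = disc_char E S q ^ multiplicity q (int n)"
      using kronecker_prime_eq_disc_char[OF E S D] by metis
  qed
  also have "\<dots> = disc_char E S (\<Prod>q\<in>prime_factors (int n). q ^ multiplicity q (int n))"
    by (simp add: prod pow)
  also have "(\<Prod>q\<in>prime_factors (int n). q ^ multiplicity q (int n)) = int n"
    using n by (subst prod_prime_factors) auto
  finally show ?thesis .
qed

section \<open>Discriminants of quadratic fields\<close>

lemma rat_in_subfield: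
  fixes K :: "'a::field_char_0 set"
  assumes K: "is_subfield K"
  shows "of_rat q \<in> K"
proof -
  have nat: "of_nat n \<in> K" for n :: nat
    by (induction n) (use K in \<open>auto simp: is_subfield_def\<close>)
  have int: "of_int k \<in> K" for k :: int
  proof (cases k rule: int_diff_cases)
    case (diff a b)
    have "of_nat a + - (of_nat b :: 'a) \<in> K" using K nat[of a] nat[of b] unfolding is_subfield_def by blast
    thus ?thesis using diff by simp
  qed
  obtain a b where "q = of_int a / of_int b" by (metis quotient_of_div surj_pair)
  hence "of_rat q = (of_int a / of_int b :: 'a)" by (simp add: of_rat_divide)
  also have "\<dots> = of_int a * inverse (of_int b)" by (rule divide_inverse)
  finally have "of_rat q = (of_int a * inverse (of_int b) :: 'a)" .
  thus ?thesis using K int by (simp add: is_subfield_def)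
qed

lemma subfield_rat_subspace:
  assumes "is_subfield K"
  shows "rat_vs.subspace K"
  using assms rat_in_subfield[OF assms] by (auto simp: rat_vs.subspace_def is_subfield_def)

lemma rat_span_insert_1:
  fixes x :: "'a::field_char_0"
  shows "y \<in> rat_vs.span {1, x} \<longleftrightarrow> (\<exists>u v. y = of_rat u + of_rat v * x)"
proof -
  have "y \<in> rat_vs.span {1, x} \<longleftrightarrow> (\<exists>u v. y - of_rat u * 1 = of_rat v * x)"
    unfolding rat_vs.span_breakdown_eq[of y 1 "{x}"] rat_vs.span_singleton by auto
  also have "\<dots> \<longleftrightarrow> (\<exists>u v. y = of_rat u + of_rat v * x)" by (simp add: algebra_simps)
  finally show ?thesis .
qed

locale quadratic_generator =
  fixes K :: "'a::field_char_0 set" and s :: 'a and m :: int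
  assumes quad: "quadratic_field K"
    and K_eq: "K = {of_rat u + of_rat v * s | u v. True}"
    and s_sq: "s * s = of_int m"
    and m_sqfree: "squarefree m"
    and s_irrat: "s \<notin> \<rat>"

text \<open>Extend 1 to a rational basis \<open>{1, x}\<close>, complete the square in the quadratic
  equation of x, and rescale the resulting square root of a rational number to one of a squarefree
  integer.\<close>

lemma quadratic_field_generator:
  assumes quad: "quadratic_field K"
  shows "\<exists>s m. quadratic_generator K s m"
proof -
  have K: "is_subfield K" and dim: "rat_vs.dim K = 2" using quad by (auto simp: quadratic_field_def)
  have sub: "rat_vs.subspace K" by (rule subfield_rat_subspace[OF K])
  have "rat_vs.independent {1}" by simp
  moreover have "{1} \<subseteq> K" using K by (simp add: is_subfield_def)
  ultimately obtain B where B: "{1} \<subseteq> B" "B \<subseteq> K" "rat_vs.independent B" "K \<subseteq> rat_vs.span B"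
    using rat_vs.maximal_independent_subset_extend[of "{1}" K] by metis
  have "card B = 2" using rat_vs.basis_card_eq_dim[OF B(2,4,3)] dim by simp
  then obtain x where x: "B = {1, x}" "x \<noteq> 1" using B(1) by (auto simp: card_2_iff doubleton_eq_iff)
  have KB: "K = rat_vs.span {1, x}"
    using B x rat_vs.span_minimal[OF B(2) sub] by auto
  have Kx: "y \<in> K \<longleftrightarrow> (\<exists>u v. y = of_rat u + of_rat v * x)" for y
    unfolding KB by (rule rat_span_insert_1)
  have xirr: "x \<notin> \<rat>"
  proof
    assume "x \<in> \<rat>"
    then obtain q where "x = of_rat q * 1" by (auto elim: Rats_cases)
    hence "x \<in> rat_vs.span {1}" by (auto simp: rat_vs.span_singleton)
    moreover have "insert x {1} = B" using x by auto
    ultimately show False using B(3) x rat_vs.independent_insert[of x "{1}"] by auto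
  qed
  have "x * x \<in> K" using K B x by (auto simp: is_subfield_def)
  then obtain a b where ab: "x * x = of_rat a + of_rat b * x" using Kx by blast
  define r where "r = a + b * b / 4"
  obtain P Q where PQ: "r = of_int P / of_int Q" "Q > 0"
    by (metis quotient_of_div quotient_of_denom_pos surj_pair)
  define y where "y = x - of_rat (b / 2)"
  have yy: "y * y = of_rat r"
    unfolding y_def r_def by (simp add: algebra_simps ab of_rat_add of_rat_mult of_rat_divide)
  \<comment> \<open>Multiplying \<open>y\<close> by Q clears the denominator, since
    \<open>r * Q^2 = P * Q\<close>; dividing by k, where \<open>k^2\<close> is the largest square
    factor of N, leaves the squarefree part.\<close>
  define N where "N = P * Q"
  define k where "k = square_part N"
  define m where "m = squarefree_part N"
  have N: "N = m * k\<^sup>2" unfolding m_def k_def by (rule squarefree_decompose)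
  have yirr: "y \<notin> \<rat>"
  proof
    assume "y \<in> \<rat>"
    hence "y + of_rat (b / 2) \<in> \<rat>" by (intro Rats_add) auto
    thus False using xirr by (simp add: y_def)
  qed
  have "y \<noteq> 0" using yirr by auto
  hence "r \<noteq> 0" using yy by auto
  hence "N \<noteq> 0" using PQ by (auto simp: N_def)
  hence k0: "k \<noteq> 0" by (simp add: k_def)
  define s where "s = of_rat (of_int Q / of_int k) * y"
  have Q0: "Q \<noteq> 0" using PQ by simp
  have "s * s = of_rat (of_int Q / of_int k) * of_rat (of_int Q / of_int k) * (y * y)"
    by (simp add: s_def mult_ac)
  also have "\<dots> = of_rat (of_int Q / of_int k * (of_int Q / of_int k) * r)"
    unfolding yy by (simp only: of_rat_mult)
  also have "of_int Q / of_int k * (of_int Q / of_int k) * r = of_int N / (of_int k)\<^sup>2"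
    using Q0 by (simp add: PQ N_def power2_eq_square)
  also have "\<dots> = of_int m" using k0 by (simp add: N)
  finally have ss: "s * s = of_int m" by simp
  have ys: "y = of_rat (of_int k / of_int Q) * s"
    using k0 Q0 by (simp add: s_def of_rat_mult[symmetric] mult.assoc[symmetric])
  have "s \<notin> \<rat>"
  proof
    assume "s \<in> \<rat>"
    hence "of_rat (of_int k / of_int Q) * s \<in> \<rat>" by (intro Rats_mult) auto
    thus False using yirr ys by simp
  qed
  moreover have "K = {of_rat u + of_rat v * s | u v. True}"
  proof (intro equalityI subsetI)
    fix z assume "z \<in> K"
    then obtain u v where "z = of_rat u + of_rat v * x" using Kx by blast
    also have "x = of_rat (of_int k / of_int Q) * s + of_rat (b / 2)" using ys by (simp add: y_def diff_eq_eq)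
    also have "of_rat u + of_rat v * \<dots> = of_rat (u + v * (b / 2)) + of_rat (v * (of_int k / of_int Q)) * s"
      unfolding of_rat_add of_rat_mult by (simp add: algebra_simps)
    finally show "z \<in> {of_rat u + of_rat v * s | u v. True}" by blast
  next
    fix z assume "z \<in> {of_rat u + of_rat v * s | u v. True}"
    then obtain u v where "z = of_rat u + of_rat v * s" by blast
    also have "s = of_rat (of_int Q / of_int k) * x + of_rat (of_int Q / of_int k * (- b / 2))"
      unfolding s_def y_def of_rat_mult by (simp add: algebra_simps of_rat_minus)
    also have "of_rat u + of_rat v * \<dots> = of_rat (u + v * (of_int Q / of_int k * (- b / 2))) + of_rat (v * (of_int Q / of_int k)) * x"
      unfolding of_rat_add of_rat_mult by (simp add: algebra_simps)
    finally show "z \<in> K" using Kx by blast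
  qed
  moreover have "squarefree m" using \<open>N \<noteq> 0\<close> by (simp add: m_def)
  ultimately show ?thesis using quad ss unfolding quadratic_generator_def by blast
qed

section \<open>Coordinates, trace and discriminant with respect to 1 and s\<close>

context quadratic_generator
begin

definition elt :: "rat \<Rightarrow> rat \<Rightarrow> 'a" where
  "elt u v = of_rat u + of_rat v * s"

lemma elt_eq_iff [simp]: "elt u v = elt u' v' \<longleftrightarrow> u = u' \<and> v = v'"
proof
  assume eq: "elt u v = elt u' v'"
  hence e: "of_rat (v - v') * s = of_rat (u' - u)"
    unfolding elt_def of_rat_diff by (simp add: algebra_simps)
  have "v = v'"
  proof (rule ccontr)
    assume "v \<noteq> v'"
    hence "s = of_rat (u' - u) / of_rat (v - v')" using e by (simp add: field_simps)
    hence "s \<in> \<rat>" by (simp only:) (intro Rats_divide, auto)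
    thus False using s_irrat by simp
  qed
  thus "u = u' \<and> v = v'" using e by simp
qed simp

lemma elt_in_K: "elt u v \<in> K"
  unfolding K_eq elt_def by blast

lemma K_cases: "x \<in> K \<Longrightarrow> \<exists>u v. x = elt u v"
  unfolding K_eq elt_def by blast

lemma elt_add: "elt u v + elt u' v' = elt (u + u') (v + v')"
  by (simp add: elt_def of_rat_add algebra_simps)

lemma elt_mult: "elt u v * elt u' v' = elt (u * u' + of_int m * v * v') (u * v' + v * u')"
proof -
  have "elt u v * elt u' v' = of_rat u * of_rat u' + of_rat v * of_rat v' * (s * s) + (of_rat u * of_rat v' + of_rat v * of_rat u') * s"
    by (simp add: elt_def algebra_simps)
  thus ?thesis unfolding s_sq by (simp add: elt_def of_rat_add of_rat_mult algebra_simps)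
qed

lemma of_rat_eq_elt: "of_rat q = elt q 0"
  by (simp add: elt_def)

lemma of_int_eq_elt: "of_int k = elt (of_int k) 0"
  by (simp add: elt_def)

lemma zero_eq_elt: "0 = elt 0 0"
  and one_eq_elt: "1 = elt 1 0"
  by (simp_all add: elt_def)

text \<open>The basis in the definition is an unspecified choice, so the trace is extracted from the
  Cayley-Hamilton identity of the matrix in that basis: x satisfies a quadratic equation whose
  linear coefficient is the trace. Comparing the s-coordinates gives \<open>2 * u\<close> when v is
  nonzero; for v = 0 the matrix is scalar.\<close>

lemma field_trace_elt: "field_trace K (elt u v) = 2 * u"
proof -
  have K: "is_subfield K" and dim: "rat_vs.dim K = 2" using quad by (auto simp: quadratic_field_def)
  have sub: "rat_vs.subspace K" by (rule subfield_rat_subspace[OF K])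
  let ?P = "\<lambda>B. \<not> rat_vs.dependent B \<and> rat_vs.span B = K"
  define B where "B = (SOME B. ?P B)"
  obtain B0 where "B0 \<subseteq> K" "rat_vs.independent B0" "K \<subseteq> rat_vs.span B0"
    using rat_vs.basis_exists[of K] by metis
  hence "?P B0" using rat_vs.span_minimal[OF _ sub] by auto
  hence B: "rat_vs.independent B" "rat_vs.span B = K"
    unfolding B_def using someI[of ?P B0] by auto
  have "card B = 2" using rat_vs.dim_span_eq_card_independent[OF B(1)] B(2) dim by simp
  then obtain b1 b2 where b: "B = {b1, b2}" "b1 \<noteq> b2" by (auto simp: card_2_iff)
  have finB: "finite B" using b by simp
  let ?x = "elt u v"
  let ?R = "\<lambda>b c. rat_vs.representation B (?x * b) c"
  have inK: "?x * c \<in> rat_vs.span B" if "c \<in> B" for c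
  proof -
    have "c \<in> K" using rat_vs.span_base[OF that] B by simp
    thus ?thesis using elt_in_K[of u v] K B by (simp add: is_subfield_def)
  qed
  have trace: "field_trace K ?x = ?R b1 b1 + ?R b2 b2"
    unfolding field_trace_def B_def[symmetric] Let_def using b by simp
  have "?R b1 b1 + ?R b2 b2 = 2 * u"
  proof (cases "v = 0")
    case True
    have "?R c c = u" if "c \<in> B" for c
    proof -
      have "c \<in> rat_vs.span B" using that by (rule rat_vs.span_base)
      from rat_vs.representation_scale[OF B(1) this, of u] rat_vs.representation_basis[OF B(1) that]
      show ?thesis using True by (simp add: elt_def)
    qed
    thus ?thesis using b by simp
  next
    case v: False
    have rep: "?x * c = of_rat (?R c b1) * b1 + of_rat (?R c b2) * b2" if "c \<in> B" for c
      using rat_vs.sum_representation_eq[OF B(1) inK[OF that] finB order_refl] b by simp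
    define \<alpha> \<gamma> \<beta> \<delta> where "\<alpha> = ?R b1 b1" and "\<gamma> = ?R b1 b2" and "\<beta> = ?R b2 b1" and "\<delta> = ?R b2 b2"
    have r1: "?x * b1 = of_rat \<alpha> * b1 + of_rat \<gamma> * b2" and r2: "?x * b2 = of_rat \<beta> * b1 + of_rat \<delta> * b2"
      using rep b by (auto simp: \<alpha>_def \<beta>_def \<gamma>_def \<delta>_def)
    \<comment> \<open>Eliminating \<open>b2\<close> with \<open>r1\<close> turns the two columns
      into the characteristic polynomial of the matrix, evaluated at x and applied to
      \<open>b1\<close>.\<close>
    have "(?x * ?x) * b1 = of_rat \<alpha> * (?x * b1) + of_rat \<gamma> * (?x * b2)"
      by (subst mult.assoc, subst r1) (simp add: algebra_simps)
    also have "of_rat \<gamma> * (?x * b2) = of_rat \<beta> * of_rat \<gamma> * b1 + of_rat \<delta> * (of_rat \<gamma> * b2)"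
      by (subst r2) (simp add: algebra_simps)
    also have "of_rat \<gamma> * b2 = ?x * b1 - of_rat \<alpha> * b1" using r1 by simp
    finally have "(?x * ?x) * b1 = (of_rat (\<alpha> + \<delta>) * ?x + of_rat (\<beta> * \<gamma> - \<alpha> * \<delta>)) * b1"
      unfolding of_rat_add of_rat_mult of_rat_diff by (simp add: algebra_simps)
    moreover have "b1 \<noteq> 0" using B(1) b rat_vs.dependent_zero[of B] by auto
    ultimately have "?x * ?x = of_rat (\<alpha> + \<delta>) * ?x + of_rat (\<beta> * \<gamma> - \<alpha> * \<delta>)"
      using mult_right_cancel by blast
    hence "u * v + v * u = (\<alpha> + \<delta>) * v"
      unfolding of_rat_eq_elt elt_mult elt_add elt_eq_iff by simp
    hence "(\<alpha> + \<delta>) * v = (2 * u) * v" by (simp add: algebra_simps)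
    thus ?thesis using v by (simp add: \<alpha>_def \<delta>_def)
  qed
  thus ?thesis using trace by simp
qed

lemma trace_form_det:
  "field_trace K (elt u v * elt u v) * field_trace K (elt u' v' * elt u' v') -
     field_trace K (elt u v * elt u' v') * field_trace K (elt u' v' * elt u v) =
   4 * of_int m * (u * v' - u' * v)\<^sup>2"
  unfolding elt_mult field_trace_elt by (simp add: power2_eq_square algebra_simps)

text \<open>A single integral basis determines the value of \<open>THE\<close>: any other one
  differs by an integer matrix with an integer inverse, so its determinant is 1 or -1 and disappears
  in the square.\<close>

lemma quadratic_disc_eqI:
  assumes w: "integral_basis2 K 1 (elt p q)" and D: "of_int D = 4 * of_int m * q\<^sup>2"
  shows "quadratic_disc K = D"
  unfolding quadratic_disc_def
proof (rule the_equality)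
  show "\<exists>w1 w2. integral_basis2 K w1 w2 \<and>
     of_int D = field_trace K (w1 * w1) * field_trace K (w2 * w2) - field_trace K (w1 * w2) * field_trace K (w2 * w1)"
    using w D trace_form_det[of 1 0 p q] unfolding one_eq_elt
    by (intro exI[of _ "elt 1 0"] exI[of _ "elt p q"]) simp
next
  fix D' assume "\<exists>w1 w2. integral_basis2 K w1 w2 \<and>
     of_int D' = field_trace K (w1 * w1) * field_trace K (w2 * w2) - field_trace K (w1 * w2) * field_trace K (w2 * w1)"
  then obtain w1 w2 where w12: "integral_basis2 K w1 w2" and
    D': "of_int D' = field_trace K (w1 * w1) * field_trace K (w2 * w2) - field_trace K (w1 * w2) * field_trace K (w2 * w1)"
    by blast
  have O: "ring_of_integers K = {of_int a * 1 + of_int b * elt p q | a b. True}"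
    using w by (simp add: integral_basis2_def)
  have O': "ring_of_integers K = {of_int a * w1 + of_int b * w2 | a b. True}"
    using w12 by (simp add: integral_basis2_def)
  have q0: "q \<noteq> 0"
  proof
    assume "q = 0"
    obtain a b where p: "p = of_int a / of_int b" "b > 0" by (metis quotient_of_div quotient_of_denom_pos surj_pair)
    have "of_int (- a) * 1 + of_int b * elt p q = 0"
      using p \<open>q = 0\<close> unfolding of_int_eq_elt one_eq_elt zero_eq_elt elt_mult elt_add elt_eq_iff by simp
    hence "b = 0" using w unfolding integral_basis2_def by blast
    thus False using p by simp
  qed
  have "w1 = of_int 1 * w1 + of_int 0 * w2" "w2 = of_int 0 * w1 + of_int 1 * w2" by simp_all
  hence "w1 \<in> ring_of_integers K" "w2 \<in> ring_of_integers K" unfolding O' by blast+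
  then obtain a b c e where wa: "w1 = of_int a * 1 + of_int b * elt p q" "w2 = of_int c * 1 + of_int e * elt p q"
    unfolding O by blast
  have "1 = of_int 1 * 1 + of_int 0 * elt p q" "elt p q = of_int 0 * 1 + of_int 1 * elt p q" by simp_all
  hence "1 \<in> ring_of_integers K" "elt p q \<in> ring_of_integers K" unfolding O by blast+
  then obtain a' b' c' e' where wa': "1 = of_int a' * w1 + of_int b' * w2" "elt p q = of_int c' * w1 + of_int e' * w2"
    unfolding O' by blast
  define u1 v1 u2 v2 where "u1 = of_int a + of_int b * p" and "v1 = of_int b * q" and "u2 = of_int c + of_int e * p" and "v2 = of_int e * q"
  have w1: "w1 = elt u1 v1" and w2: "w2 = elt u2 v2"
    unfolding wa of_int_eq_elt one_eq_elt elt_mult elt_add by (simp_all add: u1_def v1_def u2_def v2_def)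
  have 1: "1 = of_int a' * u1 + of_int b' * u2" "0 = of_int a' * v1 + of_int b' * v2"
    using wa'(1) unfolding w1 w2 of_int_eq_elt one_eq_elt elt_mult elt_add elt_eq_iff by simp_all
  have 2: "p = of_int c' * u1 + of_int e' * u2" "q = of_int c' * v1 + of_int e' * v2"
    using wa'(2) unfolding w1 w2 of_int_eq_elt elt_mult elt_add elt_eq_iff by simp_all
  have det: "u1 * v2 - u2 * v1 = of_int (a * e - b * c) * q"
    by (simp add: u1_def v1_def u2_def v2_def algebra_simps)
  \<comment> \<open>The number q is the coordinate determinant of the basis 1,
    \<open>elt p q\<close>. Going to \<open>w1\<close>, \<open>w2\<close> and back multiplies it by
    both transition determinants, whose product must therefore be 1.\<close>
  have "q = 1 * q - p * 0" by simp
  also have "\<dots> = (of_int a' * u1 + of_int b' * u2) * (of_int c' * v1 + of_int e' * v2) - (of_int c' * u1 + of_int e' * u2) * (of_int a' * v1 + of_int b' * v2)"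
    using 1 2 by simp
  also have "\<dots> = of_int (a' * e' - b' * c') * (u1 * v2 - u2 * v1)" by (simp add: algebra_simps)
  also have "\<dots> = of_int ((a' * e' - b' * c') * (a * e - b * c)) * q" by (simp add: det)
  finally have "of_int ((a' * e' - b' * c') * (a * e - b * c)) = (1 :: rat)" using q0 by simp
  hence "(a' * e' - b' * c') * (a * e - b * c) = 1" by (simp only: of_int_eq_1_iff)
  hence "\<bar>a * e - b * c\<bar> = 1" by (metis abs_zmult_eq_1 mult.commute abs_one)
  hence "(a * e - b * c)\<^sup>2 = 1" by (metis power2_abs one_power2)
  hence "of_int ((a * e - b * c)\<^sup>2) = (1 :: rat)" by (simp only: of_int_1)
  hence "(u1 * v2 - u2 * v1)\<^sup>2 = q\<^sup>2" unfolding det power_mult_distrib by simp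
  hence "of_int D' = (of_int D :: rat)" using D' trace_form_det[of u1 v1 u2 v2] D unfolding w1 w2 by simp
  thus "D' = D" by simp
qed

lemma elt_char_poly: "elt u v * elt u v - of_rat (2 * u) * elt u v + of_rat (u\<^sup>2 - of_int m * v\<^sup>2) = 0"
proof -
  have "elt u v * elt u v + of_rat (- 2 * u) * elt u v + of_rat (u\<^sup>2 - of_int m * v\<^sup>2) = 0"
    unfolding of_rat_eq_elt zero_eq_elt elt_mult elt_add elt_eq_iff by (simp add: power2_eq_square algebra_simps)
  thus ?thesis by (simp add: of_rat_minus of_rat_mult)
qed

end

section \<open>Integers of a quadratic field\<close>

lemma of_int_poly_add: "map_poly of_int (p + q) = (map_poly of_int p + map_poly of_int q :: 'a::comm_ring_1 poly)"
  by (intro poly_eqI) (simp add: coeff_map_poly)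

lemma of_int_poly_mult: "map_poly of_int (p * q) = (map_poly of_int p * map_poly of_int q :: 'a::comm_ring_1 poly)"
  by (intro poly_eqI) (simp add: coeff_map_poly coeff_mult)

lemma of_int_poly_smult: "map_poly of_int (Polynomial.smult c p) = (Polynomial.smult (of_int c) (map_poly of_int p) :: 'a::comm_ring_1 poly)"
  by (intro poly_eqI) (simp add: coeff_map_poly)

text \<open>A form of Gauss's lemma. The pseudo-remainder has degree at most 1 and an irrational
  zero, hence vanishes; since q is primitive, the multiplier \<open>c\<close> of the pseudo-division
  divides the content of the quotient and cancels.\<close>

lemma primitive_dvd_monic:
  fixes x :: "'a::field_char_0" and p q :: "int poly"
  assumes q: "content q = 1" "degree q = 2" "poly (map_poly of_int q) x = 0"
    and p: "lead_coeff p = 1" "poly (map_poly of_int p) x = 0"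
    and x: "x \<notin> \<rat>"
  shows "q dvd p"
proof -
  have q0: "q \<noteq> 0" using q by auto
  obtain g r where gr: "pseudo_divmod p q = (g, r)" by (cases "pseudo_divmod p q")
  define c where "c = lead_coeff q ^ (Suc (degree p) - degree q)"
  have c0: "c \<noteq> 0" using q0 by (simp add: c_def)
  have eq: "Polynomial.smult c p = q * g + r" and deg: "r = 0 \<or> degree r < degree q"
    using pseudo_divmod[OF q0 gr] by (simp_all add: c_def)
  have "poly (map_poly of_int (Polynomial.smult c p)) x = (0 :: 'a)" using p
    by (simp add: of_int_poly_smult)
  moreover have "poly (map_poly of_int (q * g + r)) x = poly (map_poly of_int r) x"
    using q by (simp add: of_int_poly_add of_int_poly_mult)
  ultimately have rx: "poly (map_poly of_int r) x = 0" unfolding eq by simp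
  have r0: "r = 0"
  proof (rule ccontr)
    assume "r \<noteq> 0"
    hence d: "degree r \<le> 1" using deg q by auto
    hence r: "r = [:Polynomial.coeff r 0, Polynomial.coeff r 1:]" 
      by (intro poly_eqI) (auto simp: coeff_pCons coeff_eq_0 split: nat.splits)
    have e: "of_int (Polynomial.coeff r 0) + x * of_int (Polynomial.coeff r 1) = 0"
      using rx by (subst (asm) r) (simp add: map_poly_pCons)
    show False
    proof (cases "Polynomial.coeff r 1 = 0")
      case True
      hence "Polynomial.coeff r 0 = 0" using e by simp
      thus False using True r \<open>r \<noteq> 0\<close> by simp
    next
      case False
      hence "x = - of_int (Polynomial.coeff r 0) / of_int (Polynomial.coeff r 1)" using e by (simp add: field_simps eq_neg_iff_add_eq_0)
      thus False using x by auto
    qed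
  qed
  hence eq: "Polynomial.smult c p = q * g" using eq by simp
  have "content (Polynomial.smult c p) = content q * content g" unfolding eq by (rule content_mult)
  hence "\<bar>c\<bar> * content p = content g" using q by simp
  hence "c dvd content g" by (metis abs_dvd_iff dvd_triv_left)
  hence "[:c:] dvd g" by (simp add: const_poly_dvd_iff_dvd_content)
  then obtain g' where "g = [:c:] * g'" by (elim dvdE)
  hence "Polynomial.smult c p = Polynomial.smult c (q * g')" using eq by simp
  hence "Polynomial.smult c (p - q * g') = 0" by (simp add: smult_diff_right)
  hence "p = q * g'" using c0 by (simp only: smult_eq_0_iff) simp
  thus ?thesis by simp
qed


text \<open>In lowest terms the square of the denominator would have to divide m.\<close>

lemma squarefree_rat_sqrt_int:
  fixes m :: int and V :: rat
  assumes m: "squarefree m" and V: "of_int m * V\<^sup>2 \<in> \<int>"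
  shows "V \<in> \<int>"
proof -
  obtain a b where ab: "quotient_of V = (a, b)" by (cases "quotient_of V")
  have b: "b > 0" "coprime a b" "V = of_int a / of_int b"
    using quotient_of_denom_pos[OF ab] quotient_of_coprime[OF ab] quotient_of_div[OF ab] by auto
  obtain k where "of_int m * V\<^sup>2 = of_int k" using V by (auto elim: Ints_cases)
  hence "of_int (m * a\<^sup>2) = (of_int (k * b\<^sup>2) :: rat)"
    using b by (simp add: field_simps)
  hence "m * a\<^sup>2 = k * b\<^sup>2" by (simp only: of_int_eq_iff)
  hence "b\<^sup>2 dvd m * a\<^sup>2" by simp
  hence "b\<^sup>2 dvd m" using b by (simp add: coprime_dvd_mult_left_iff coprime_commute)
  hence "is_unit b" using m by (auto simp: squarefree_def)
  hence "b = 1" using b by (simp add: zdvd1_eq)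
  thus ?thesis using b by simp
qed

context quadratic_generator
begin

lemma elt_in_Rats_iff: "elt u v \<in> \<rat> \<longleftrightarrow> v = 0"
proof
  assume "elt u v \<in> \<rat>"
  then obtain q where "elt u v = of_rat q" by (auto elim: Rats_cases)
  thus "v = 0" by (simp add: of_rat_eq_elt)
qed (simp add: elt_def)

text \<open>The two conditions say that trace and norm are integers. For irrational elements the
  primitive integer multiple of the minimal polynomial divides a monic integer polynomial, so its
  leading coefficient is a unit and the minimal polynomial itself is integral.\<close>

lemma algebraic_int_elt_iff:
  "algebraic_int (elt u v) \<longleftrightarrow> 2 * u \<in> \<int> \<and> u\<^sup>2 - of_int m * v\<^sup>2 \<in> \<int>"
proof
  assume "2 * u \<in> \<int> \<and> u\<^sup>2 - of_int m * v\<^sup>2 \<in> \<int>"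
  then obtain t n where tn: "2 * u = of_int t" "u\<^sup>2 - of_int m * v\<^sup>2 = of_int n" by (auto elim!: Ints_cases)
  have "elt u v * elt u v - of_int t * elt u v + of_int n = 0"
    using elt_char_poly[of u v] unfolding tn by simp
  hence "poly (map_poly of_int [:n, - t, 1:]) (elt u v) = 0"
    by (simp add: map_poly_pCons algebra_simps)
  moreover have "lead_coeff [:n, - t, 1:] = 1" by simp
  ultimately show "algebraic_int (elt u v)" unfolding algebraic_int_altdef_ipoly by blast
next
  assume alg: "algebraic_int (elt u v)"
  show "2 * u \<in> \<int> \<and> u\<^sup>2 - of_int m * v\<^sup>2 \<in> \<int>"
  proof (cases "v = 0")
    case True
    hence "elt u v \<in> \<int>" using rational_algebraic_int_is_int[OF alg] elt_in_Rats_iff by blast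
    then obtain k where "elt u v = of_int k" by (auto elim: Ints_cases)
    hence "u = of_int k" by (simp add: of_int_eq_elt)
    thus ?thesis using True by simp
  next
    case False
    hence irr: "elt u v \<notin> \<rat>" by (simp add: elt_in_Rats_iff)
    define T n where "T = 2 * u" and "n = u\<^sup>2 - of_int m * v\<^sup>2"
    obtain a b where ab: "T = of_int a / of_int b" "b > 0" by (metis quotient_of_div quotient_of_denom_pos surj_pair)
    obtain c e where ce: "n = of_int c / of_int e" "e > 0" by (metis quotient_of_div quotient_of_denom_pos surj_pair)
    \<comment> \<open>The polynomial \<open>X^2 - T X + n\<close> multiplied by the common
      denominator \<open>b * e\<close>.\<close>
    define q0 where "q0 = [:c * b, - (a * e), b * e:]"
    define q where "q = primitive_part q0"
    have be: "b * e \<noteq> 0" using ab ce by simp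
    hence q0: "q0 \<noteq> 0" and deg0: "degree q0 = 2" by (simp_all add: q0_def)
    have q0q: "q0 = Polynomial.smult (content q0) q" by (simp add: q_def)
    have cont: "content q0 \<noteq> 0" using q0 by simp
    have q1: "content q = 1" using q0 by (simp add: q_def)
    have dq: "degree q = 2" using deg0 cont by (metis degree_smult_eq q0q)
    have Tn: "of_rat T * of_int (b * e) = (of_int (a * e) :: 'a)" "of_rat n * of_int (b * e) = (of_int (c * b) :: 'a)"
      using ab ce by (simp_all add: of_rat_divide)
    have "elt u v * elt u v * of_int (b * e) - (of_rat T * of_int (b * e)) * elt u v + of_rat n * of_int (b * e) =
        (elt u v * elt u v - of_rat T * elt u v + of_rat n) * of_int (b * e)"
      by (simp add: algebra_simps)
    also have "elt u v * elt u v - of_rat T * elt u v + of_rat n = 0"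
      using elt_char_poly[of u v] by (simp only: T_def n_def)
    finally have "elt u v * elt u v * of_int (b * e) - of_int (a * e) * elt u v + of_int (c * b) = 0"
      by (simp only: Tn mult_zero_left)
    hence "poly (map_poly of_int q0) (elt u v) = 0"
      by (simp add: q0_def map_poly_pCons algebra_simps)
    hence "of_int (content q0) * poly (map_poly of_int q) (elt u v) = 0"
      by (subst (asm) q0q) (simp add: of_int_poly_smult)
    hence qx: "poly (map_poly of_int q) (elt u v) = 0" using cont by simp
    obtain p :: "int poly" where p: "poly (map_poly of_int p) (elt u v) = 0" "lead_coeff p = 1"
      using alg unfolding algebraic_int_altdef_ipoly by blast
    from primitive_dvd_monic[OF q1 dq qx p(2,1) irr] obtain g where "p = q * g" by (elim dvdE)
    hence "lead_coeff q * lead_coeff g = 1" using p by (simp add: lead_coeff_mult)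
    hence "is_unit (lead_coeff q)" by (metis dvd_triv_left)
    hence "\<bar>lead_coeff q\<bar> = 1" by simp
    moreover have "lead_coeff q0 = content q0 * lead_coeff q" by (metis lead_coeff_smult q0q)
    hence "b * e = content q0 * lead_coeff q" using be by (simp add: q0_def)
    ultimately have "\<bar>content q0\<bar> = \<bar>b * e\<bar>" by (simp add: abs_mult)
    hence dvd: "b * e dvd k \<longleftrightarrow> content q0 dvd k" for k by (metis abs_dvd_iff)
    have "content q0 dvd Polynomial.coeff q0 1" "content q0 dvd Polynomial.coeff q0 0" by (rule content_dvd_coeff)+
    hence "b * e dvd a * e" "b * e dvd c * b" unfolding dvd by (simp_all add: q0_def)
    hence "b dvd a" "e dvd c" using ab ce by (simp_all add: mult.commute)
    hence "T \<in> \<int>" "n \<in> \<int>" using ab ce by (auto elim!: dvdE)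
    thus ?thesis by (simp add: T_def n_def)
  qed
qed

lemma ring_of_integers_eq:
  "ring_of_integers K = {elt u v | u v. 2 * u \<in> \<int> \<and> u\<^sup>2 - of_int m * v\<^sup>2 \<in> \<int>}"
proof (intro equalityI subsetI)
  fix x assume "x \<in> ring_of_integers K"
  hence "x \<in> K" "algebraic_int x" by (auto simp: ring_of_integers_def)
  thus "x \<in> {elt u v | u v. 2 * u \<in> \<int> \<and> u\<^sup>2 - of_int m * v\<^sup>2 \<in> \<int>}"
    using K_cases[of x] algebraic_int_elt_iff by blast
qed (auto simp: ring_of_integers_def elt_in_K algebraic_int_elt_iff)

text \<open>Besides \<open>2 * u\<close> also \<open>2 * v\<close> is an integer, because
  \<open>m * (2 * v)^2\<close> is one and m is squarefree.\<close>

lemma integral_coords: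
  fixes u v :: rat
  shows "2 * u \<in> \<int> \<and> u\<^sup>2 - of_int m * v\<^sup>2 \<in> \<int> \<longleftrightarrow>
     (\<exists>t w :: int. u = of_int t / 2 \<and> v = of_int w / 2 \<and> 4 dvd t\<^sup>2 - m * w\<^sup>2)"
proof
  assume "2 * u \<in> \<int> \<and> u\<^sup>2 - of_int m * v\<^sup>2 \<in> \<int>"
  then obtain t n where tn: "2 * u = of_int t" "u\<^sup>2 - of_int m * v\<^sup>2 = of_int n" by (auto elim!: Ints_cases)
  have "of_int m * (2 * v)\<^sup>2 = (2 * u)\<^sup>2 - 4 * (u\<^sup>2 - of_int m * v\<^sup>2)"
    by (simp add: power2_eq_square algebra_simps)
  also have "\<dots> = of_int (t\<^sup>2 - 4 * n)" unfolding tn by simp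
  finally have *: "of_int m * (2 * v)\<^sup>2 = of_int (t\<^sup>2 - 4 * n)" .
  hence "2 * v \<in> \<int>" using squarefree_rat_sqrt_int[OF m_sqfree] by (metis Ints_of_int)
  then obtain w where w: "2 * v = of_int w" by (auto elim: Ints_cases)
  hence "of_int (m * w\<^sup>2) = (of_int (t\<^sup>2 - 4 * n) :: rat)" using * by simp
  hence "m * w\<^sup>2 = t\<^sup>2 - 4 * n" by (simp only: of_int_eq_iff)
  hence "t\<^sup>2 - m * w\<^sup>2 = 4 * n" by simp
  moreover have "u = of_int t / 2" "v = of_int w / 2" using tn w by simp_all
  ultimately show "\<exists>t w :: int. u = of_int t / 2 \<and> v = of_int w / 2 \<and> 4 dvd t\<^sup>2 - m * w\<^sup>2"
    by (metis dvd_triv_left)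
next
  assume "\<exists>t w :: int. u = of_int t / 2 \<and> v = of_int w / 2 \<and> 4 dvd t\<^sup>2 - m * w\<^sup>2"
  then obtain t w k where tw: "u = of_int t / 2" "v = of_int w / 2" "t\<^sup>2 - m * w\<^sup>2 = 4 * k" by (auto elim!: dvdE)
  have "u\<^sup>2 - of_int m * v\<^sup>2 = of_int (t\<^sup>2 - m * w\<^sup>2) / 4"
    unfolding tw(1,2) by (simp add: power2_eq_square field_simps)
  also have "\<dots> = of_int k" unfolding tw by simp
  finally have "u\<^sup>2 - of_int m * v\<^sup>2 \<in> \<int>" by simp
  moreover have "2 * u = of_int t" using tw by simp
  ultimately show "2 * u \<in> \<int> \<and> u\<^sup>2 - of_int m * v\<^sup>2 \<in> \<int>" by simp
qed

lemma m_mod_4: "m mod 4 \<in> {1, 2, 3}"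
proof -
  have "\<not> 4 dvd m"
  proof
    assume "4 dvd m"
    hence "(2::int)\<^sup>2 dvd m" by simp
    hence "is_unit (2 :: int)" using m_sqfree unfolding squarefree_def by blast
    thus False by simp
  qed
  thus ?thesis by (simp, presburger)
qed

lemma m_neq_1: "m \<noteq> 1"
proof
  assume "m = 1"
  hence "s * s = 1" using s_sq by simp
  hence "s = 1 \<or> s = -1" by (simp add: square_eq_1_iff)
  thus False using s_irrat by auto
qed

lemma quadratic_disc_eq: "quadratic_disc K = (if m mod 4 = 1 then m else 4 * m)"
proof (cases "m mod 4 = 1")
  case True
  \<comment> \<open>For m congruent to 1 modulo 4 the divisibility means that t and w have the same
    parity, which gives the integral basis 1, \<open>(1 + s) / 2\<close>.\<close>
  have key: "(\<exists>t w. u = of_int t / 2 \<and> v = of_int w / 2 \<and> 4 dvd t\<^sup>2 - m * w\<^sup>2) \<longleftrightarrow>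
             (\<exists>a b :: int. u = of_int a + of_int b / 2 \<and> v = of_int b / 2)" for u v :: rat
  proof
    assume "\<exists>t w. u = of_int t / 2 \<and> v = of_int w / 2 \<and> 4 dvd t\<^sup>2 - m * w\<^sup>2"
    then obtain t w where tw: "u = of_int t / 2" "v = of_int w / 2" "4 dvd t\<^sup>2 - m * w\<^sup>2" by blast
    have "even (t\<^sup>2 - m * w\<^sup>2)" using tw(3) by (meson dvd_trans even_numeral)
    moreover have "odd m" using True by presburger
    ultimately have "even (t - w)" by simp
    then obtain a where "t = w + 2 * a" by (metis add.commute diff_add_cancel evenE)
    thus "\<exists>a b :: int. u = of_int a + of_int b / 2 \<and> v = of_int b / 2"
      using tw by (intro exI[of _ a] exI[of _ w]) (simp add: field_simps)
  next
    assume "\<exists>a b :: int. u = of_int a + of_int b / 2 \<and> v = of_int b / 2"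
    then obtain a b where ab: "u = of_int a + of_int b / 2" "v = of_int b / 2" by blast
    have "4 dvd m - 1" using True by presburger
    hence "4 dvd 4 * (a\<^sup>2 + a * b) - (m - 1) * b\<^sup>2" by (intro dvd_diff) auto
    also have "4 * (a\<^sup>2 + a * b) - (m - 1) * b\<^sup>2 = (2 * a + b)\<^sup>2 - m * b\<^sup>2"
      by (simp add: power2_eq_square algebra_simps)
    finally show "\<exists>t w. u = of_int t / 2 \<and> v = of_int w / 2 \<and> 4 dvd t\<^sup>2 - m * w\<^sup>2"
      using ab by (intro exI[of _ "2 * a + b"] exI[of _ b]) (simp add: field_simps)
  qed
  have "integral_basis2 K 1 (elt (1 / 2) (1 / 2))"
    unfolding integral_basis2_def
  proof
    have *: "of_int a * 1 + of_int b * elt (1 / 2) (1 / 2) = elt (of_int a + of_int b / 2) (of_int b / 2)" for a b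
      unfolding of_int_eq_elt one_eq_elt elt_mult elt_add by simp
    thus "ring_of_integers K = {of_int a * 1 + of_int b * elt (1 / 2) (1 / 2) | a b. True}"
      unfolding ring_of_integers_eq integral_coords key * by blast
    show "\<forall>a b. of_int a * 1 + of_int b * elt (1 / 2) (1 / 2) = 0 \<longrightarrow> a = 0 \<and> b = 0"
      unfolding of_int_eq_elt one_eq_elt zero_eq_elt elt_mult elt_add elt_eq_iff by auto
  qed
  from quadratic_disc_eqI[OF this, of m] True show ?thesis by (simp add: power2_eq_square)
next
  case False
  hence m: "m mod 4 = 2 \<or> m mod 4 = 3" using m_mod_4 by auto
  \<comment> \<open>Squares are 0 or 1 modulo 4, so for m congruent to 2 or 3 the divisibility
    forces t and w to be even; the integral basis is 1, \<open>s\<close>.\<close>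
  have key: "(\<exists>t w. u = of_int t / 2 \<and> v = of_int w / 2 \<and> 4 dvd t\<^sup>2 - m * w\<^sup>2) \<longleftrightarrow>
             (\<exists>a b :: int. u = of_int a \<and> v = of_int b)" for u v :: rat
  proof
    assume "\<exists>t w. u = of_int t / 2 \<and> v = of_int w / 2 \<and> 4 dvd t\<^sup>2 - m * w\<^sup>2"
    then obtain t w where tw: "u = of_int t / 2" "v = of_int w / 2" "4 dvd t\<^sup>2 - m * w\<^sup>2" by blast
    have sq: "x\<^sup>2 mod 4 = (if even x then 0 else 1)" for x :: int
    proof (cases "even x")
      case True
      then obtain y where "x = 2 * y" by (elim evenE)
      thus ?thesis by (simp add: power2_eq_square)
    next
      case False
      then obtain y where "x = 2 * y + 1" by (elim oddE)
      hence "x\<^sup>2 = 1 + (y\<^sup>2 + y) * 4" by (simp add: power2_eq_square algebra_simps)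
      hence "x\<^sup>2 mod 4 = 1 mod 4" by (simp only: mod_mult_self1)
      thus ?thesis using False by simp
    qed
    have "t\<^sup>2 mod 4 = (m * w\<^sup>2) mod 4" using tw(3) by (simp add: mod_eq_dvd_iff)
    also have "\<dots> = ((m mod 4) * (w\<^sup>2 mod 4)) mod 4" by (simp only: mod_mult_eq)
    finally have "even t \<and> even w" using m unfolding sq by (auto split: if_splits)
    then obtain a b where "t = 2 * a" "w = 2 * b" by (auto elim!: evenE)
    thus "\<exists>a b :: int. u = of_int a \<and> v = of_int b" using tw by simp
  next
    assume "\<exists>a b :: int. u = of_int a \<and> v = of_int b"
    then obtain a b where ab: "u = of_int a" "v = of_int b" by blast
    have "(2 * a)\<^sup>2 - m * (2 * b)\<^sup>2 = 4 * (a\<^sup>2 - m * b\<^sup>2)" by (simp add: power2_eq_square algebra_simps)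
    thus "\<exists>t w. u = of_int t / 2 \<and> v = of_int w / 2 \<and> 4 dvd t\<^sup>2 - m * w\<^sup>2"
      using ab by (intro exI[of _ "2 * a"] exI[of _ "2 * b"]) simp
  qed
  have "integral_basis2 K 1 (elt 0 1)"
    unfolding integral_basis2_def
  proof
    have *: "of_int a * 1 + of_int b * elt 0 1 = elt (of_int a) (of_int b)" for a b
      unfolding of_int_eq_elt one_eq_elt elt_mult elt_add by simp
    thus "ring_of_integers K = {of_int a * 1 + of_int b * elt 0 1 | a b. True}"
      unfolding ring_of_integers_eq integral_coords key * by blast
    show "\<forall>a b. of_int a * 1 + of_int b * elt 0 1 = 0 \<longrightarrow> a = 0 \<and> b = 0"
      unfolding of_int_eq_elt one_eq_elt zero_eq_elt elt_mult elt_add elt_eq_iff by auto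
  qed
  from quadratic_disc_eqI[OF this, of "4 * m"] False show ?thesis by simp
qed

end

lemma quadratic_disc_squarefree:
  assumes "quadratic_field K"
  shows "\<exists>m. squarefree m \<and> m \<noteq> 1 \<and> quadratic_disc K = (if m mod 4 = 1 then m else 4 * m)"
proof -
  obtain s m where "quadratic_generator K s m" using quadratic_field_generator[OF assms] by blast
  then interpret quadratic_generator K s m .
  show ?thesis using m_sqfree m_neq_1 quadratic_disc_eq by blast
qed

section \<open>The formulas for the quotients\<close>

lemma squarefree_prod_prime_factors:
  fixes n :: nat
  assumes "squarefree n" "n > 0"
  shows "(\<Prod>p\<in>prime_factors n. p) = n"
proof -
  have "(\<Prod>p\<in>prime_factors n. p) = (\<Prod>p\<in>prime_factors n. p ^ multiplicity p n)"
  proof (intro prod.cong refl)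
    fix p assume "p \<in> prime_factors n"
    hence "multiplicity p n = 1"
      using assms \<open>p \<in> prime_factors n\<close> by (simp add: squarefree_factorial_semiring')
    thus "p = p ^ multiplicity p n" by simp
  qed
  also have "\<dots> = n" using assms by (subst prod_prime_factors) auto
  finally show ?thesis .
qed

lemma prod_prime_disc_mod_4:
  assumes "finite S" "\<And>p. p \<in> S \<Longrightarrow> prime p \<and> 2 < p"
  shows "(\<Prod>p\<in>S. prime_disc p) mod 4 = 1"
  using assms
proof (induction S rule: finite_induct)
  case (insert p S)
  have "(prime_disc p * (\<Prod>p\<in>S. prime_disc p)) mod 4 = ((prime_disc p mod 4) * ((\<Prod>p\<in>S. prime_disc p) mod 4)) mod 4"
    by (simp only: mod_mult_eq)
  also have "\<dots> = 1" using insert by (simp add: prime_disc_props)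
  finally show ?case using insert by simp
qed simp

lemma fundamental_disc_decompose:
  fixes m :: int
  assumes m: "squarefree m" "m > 0"
  shows "\<exists>E S. E \<in> two_disc \<and> finite S \<and> (\<forall>p\<in>S. prime p \<and> 2 < p) \<and>
           (if m mod 4 = 1 then m else 4 * m) = E * (\<Prod>p\<in>S. prime_disc p)"
proof -
  define n where "n = nat m"
  have mn: "m = int n" and n0: "n > 0" using m by (simp_all add: n_def)
  have sf: "squarefree n"
    unfolding squarefree_def
  proof safe
    fix x assume "x\<^sup>2 dvd n"
    hence "(int x)\<^sup>2 dvd m" unfolding mn by (simp flip: of_nat_power)
    hence "is_unit (int x)" using m(1) unfolding squarefree_def by blast
    thus "is_unit x" by simp
  qed
  define S where "S = {p \<in> prime_factors n. 2 < p}"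
  have S: "finite S" "\<forall>p\<in>S. prime p \<and> 2 < p" by (auto simp: S_def)
  define P where "P = (\<Prod>p\<in>S. prime_disc p)"
  have absP: "\<bar>P\<bar> = (\<Prod>p\<in>S. int p)" unfolding P_def using S by (intro abs_prod_prime_disc) auto
  have P4: "P mod 4 = 1" unfolding P_def using S by (intro prod_prime_disc_mod_4) auto
  have gt2: "2 < p" if "prime p" "p \<noteq> 2" for p :: nat using that prime_ge_2_nat[of p] by linarith
  have mP: "m = (if even m then 2 else 1) * \<bar>P\<bar>"
  proof -
    have two_notin: "2 \<notin> S" by (simp add: S_def)
    have "prime_factors n = (if even n then insert 2 S else S)"
      using n0 gt2 by (auto simp: S_def in_prime_factors_iff)
    hence "(\<Prod>p\<in>prime_factors n. p) = (if even n then 2 else 1) * \<Prod>S"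
      using S(1) by (cases "even n") (simp_all add: two_notin)
    hence "int n = int ((if even n then 2 else 1) * \<Prod>S)"
      using squarefree_prod_prime_factors[OF sf n0] by simp
    also have "\<dots> = (if even n then 2 else 1) * (\<Prod>p\<in>S. int p)" by simp
    finally have "m = (if even n then 2 else 1) * (\<Prod>p\<in>S. int p)" unfolding mn .
    moreover have "even m \<longleftrightarrow> even n" by (simp add: mn)
    ultimately show ?thesis unfolding absP by (simp only:)
  qed
  \<comment> \<open>Since P is 1 modulo 4, an odd m equals P or -P according to its class modulo 4;
    -4 repairs the sign in the second case. For even m the sign of P selects 8 or -8, so that the
    product is positive.\<close>
  define E :: int where "E = (if m mod 4 = 1 then 1 else if odd m then -4 else if P > 0 then 8 else -8)"
  have "(if m mod 4 = 1 then m else 4 * m) = E * P"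
  proof (cases "even m")
    case True
    hence "m = 2 * \<bar>P\<bar>" "m mod 4 \<noteq> 1" using mP by (simp, presburger)
    thus ?thesis using True by (auto simp: E_def)
  next
    case False
    hence m: "m = \<bar>P\<bar>" using mP by simp
    show ?thesis
    proof (cases "P > 0")
      case True
      thus ?thesis using m P4 by (simp add: E_def)
    next
      case neg: False
      hence "m = - P" using m by simp
      hence "m mod 4 = 3" using P4 by presburger
      thus ?thesis using \<open>m = - P\<close> False by (simp add: E_def)
    qed
  qed
  moreover have "E \<in> two_disc" by (simp add: E_def two_disc_def)
  ultimately show ?thesis using S unfolding P_def by blast
qed

text \<open>A multiplicative function that does not vanish at 0 is constantly 1, and its Gauss sum
  for N > 1 would be 0.\<close>

lemma gauss_char_0:
  assumes g: "gauss_char N f c" and "N > 1" "c \<noteq> 0"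
  shows "f 0 = 0"
proof (rule ccontr)
  assume f0: "f 0 \<noteq> 0"
  have "f a = 1" for a
  proof -
    have "f (0 * a) = f 0 * f a" using g unfolding gauss_char_def by blast
    thus ?thesis using f0 by simp
  qed
  hence "(\<Sum>a\<in>{0..<int N}. unity_root N (a * 1)) = c"
    using g unfolding gauss_char_def by (metis (mono_tags, lifting) mult.left_neutral mult.right_neutral of_int_1 sum.cong)
  moreover have "(\<Sum>a\<in>{0..<int N}. unity_root N (a * 1)) = 0"
    using assms by (subst sum_unity_root) auto
  ultimately show False using assms by simp
qed

lemma attached_character_gauss_char:
  assumes K: "quadratic_field K" and d: "int d = quadratic_disc K" "d > 0"
  shows "\<exists>f. gauss_char d f (of_real (sqrt (real d))) \<and> f 1 = 1 \<and> d > 1 \<and>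
           (\<forall>k. \<bar>f k\<bar> \<le> 1) \<and> (\<forall>k. attached_character K k = of_int (f (int k)))"
proof -
  obtain m where m: "squarefree m" "m \<noteq> 1" "int d = (if m mod 4 = 1 then m else 4 * m)"
    using quadratic_disc_squarefree[OF K] d by metis
  have m0: "m > 0" using m(3) d by (auto split: if_splits)
  have d1: "d > 1" using m m0 by (auto split: if_splits)
  obtain E S where ES: "E \<in> two_disc" "finite S" "\<And>p. p \<in> S \<Longrightarrow> prime p \<and> 2 < p"
     "int d = E * (\<Prod>p\<in>S. prime_disc p)"
    using fundamental_disc_decompose[OF m(1) m0] m(3) by metis
  let ?f = "disc_char E S"
  have "gauss_char (nat \<bar>int d\<bar>) ?f (csqrt (of_int (int d)))"
    by (rule gauss_char_disc_char[OF ES])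
  hence g: "gauss_char d ?f (of_real (sqrt (real d)))" unfolding csqrt_of_int by simp
  \<comment> \<open>At k = 0 the Kronecker symbol is not given by its product formula; both sides
    vanish there because d > 1.\<close>
  have "attached_character K k = of_int (?f (int k))" for k
  proof (cases "k = 0")
    case True
    have "?f 0 = 0" using gauss_char_0[OF g d1] d by simp
    moreover have "kronecker_symbol (int d) 0 = 0" using d1 by (simp add: kronecker_symbol_def)
    ultimately show ?thesis using True d by (simp add: attached_character_def)
  next
    case False
    thus ?thesis using kronecker_symbol_eq_disc_char[OF ES] d by (simp add: attached_character_def)
  qed
  thus ?thesis using g d1 disc_char_1[OF ES(3)] abs_disc_char_le by blast
qed

lemma attached_character_bernoulli:
  assumes K: "quadratic_field K" and d: "int d = quadratic_disc K" "d > 0" and n: "n \<ge> 2" "even n"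
  shows "gen_bernoulli_number d (attached_character K) n / fact n =
           - 2 * (of_real (sqrt (real d)) / of_nat d) * (\<i> / (2 * of_real pi)) ^ n * of_nat d ^ n *
           dirichlet_L (attached_character K) (of_nat n)"
proof -
  obtain f where g: "gauss_char d f (of_real (sqrt (real d)))" and f1: "f 1 = 1" and d1: "d > 1"
    and bd: "\<And>k. \<bar>f k\<bar> \<le> 1" and chi: "\<And>k. attached_character K k = of_int (f (int k))"
    using attached_character_gauss_char[OF K d] by blast
  have cong: "f a = f b" if "[a = b] (mod int d)" for a b using g that unfolding gauss_char_def by blast
  have rr: "complex_of_real (sqrt (real d)) * of_real (sqrt (real d)) = of_nat d"
    by (simp flip: of_real_mult)
  \<comment> \<open>Positivity of the discriminant enters here: the Gauss sum is the real number
    \<open>sqrt d\<close>, and its square times \<open>f (-1)\<close> is d, so the character is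
    even.\<close>
  have "of_int (f (-1)) = (1 :: complex)"
    using gauss_char_square[OF g] f1 d unfolding rr by simp
  hence fm1: "f (-1) = 1" by simp
  show ?thesis
  proof (rule gen_bernoulli_number_eq_L[OF n d1])
    show "attached_character K (k + d) = attached_character K k" for k
      using cong[of "int (k + d)" "int k"] by (simp add: chi cong_def)
    show "norm (attached_character K k) \<le> 1" for k
      using bd[of "int k"] unfolding chi norm_of_int by (simp flip: of_int_abs)
    show "attached_character K 0 = 0"
      using gauss_char_0[OF g d1] d by (simp add: chi)
    show "attached_character K (d - k) = attached_character K k" if "k \<le> d" for k
    proof -
      have "f (int (d - k)) = f (-1 * int k)" using that by (intro cong) (simp add: of_nat_diff cong_iff_dvd_diff)
      also have "\<dots> = f (-1) * f (int k)" using g unfolding gauss_char_def by blast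
      finally show ?thesis using fm1 by (simp add: chi)
    qed
    show "(\<Sum>a<d. attached_character K a * cis (2 * pi * real a * real k / real d)) =
            of_real (sqrt (real d)) * attached_character K k" for k
    proof -
      have "(\<Sum>a<d. attached_character K a * cis (2 * pi * real a * real k / real d)) =
              (\<Sum>a\<in>{0..<int d}. of_int (f a) * unity_root d (a * int k))"
        by (rule sum.reindex_bij_witness[of _ nat int]) (auto simp: chi unity_root_def mult.assoc)
      thus ?thesis using g by (simp add: gauss_char_def chi)
    qed
  qed (rule rr)
qed

theorem proposition9:
  fixes K :: "'a::field_char_0 set" and d n :: nat and chi :: "nat \<Rightarrow> complex"
  assumes "quadratic_field K"
    and "chi = attached_character K"
    and "int d = quadratic_disc K" and "d > 0"
    and "even n" and "n \<ge> 2"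
  shows "q1 d chi (of_nat n) =
           - (2 * of_nat d ^ n / (of_nat ((2 * n) choose n) * of_real (sqrt (real d)))) *
           (bernoulli_number (2 * n) / (gen_bernoulli_number d chi n * bernoulli_number n)) *
           (\<Prod>p | prime p \<and> p dvd d. 1 + of_nat p powi (- int n))
         \<and> q2 d chi (of_nat n) =
           of_real (sqrt (real d)) / of_nat d ^ n *
           (gen_bernoulli_number d chi n / bernoulli_number n) *
           (\<Prod>p | prime p \<and> p dvd d. inverse (1 - of_nat p powi (- int n)))"
proof -
  define r where "r = complex_of_real (sqrt (real d))"
  define c where "c = (\<i> / (2 * of_real pi)) ^ n"
  define Z where "Z = riemann_zeta (of_nat n)"
  define Z2 where "Z2 = riemann_zeta (2 * of_nat n)"
  define L where "L = dirichlet_L chi (of_nat n)"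
  define b where "b = complex_of_nat ((2 * n) choose n)"
  have r2: "r * r = of_nat d" by (simp add: r_def flip: of_real_mult)
  have nz: "r \<noteq> 0" "c \<noteq> 0" "b \<noteq> 0" "complex_of_nat d \<noteq> 0"
    using assms(4) by (auto simp: r_def c_def b_def)
  have Bn: "bernoulli_number n = (- 2 * fact n * c) * Z"
    using bernoulli_number_eq_zeta[OF assms(6,5)] unfolding c_def[symmetric] Z_def[symmetric]
    by (simp only: nonzero_divide_eq_eq[OF fact_nonzero] mult_ac)
  have cc: "c * c = (\<i> / (2 * of_real pi)) ^ (2 * n)" by (simp only: c_def mult_2 power_add)
  have "bernoulli_number (2 * n) / fact (2 * n) = - 2 * (c * c) * Z2"
    using bernoulli_number_eq_zeta[of "2 * n"] assms(6) unfolding cc by (simp add: Z2_def)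
  hence B2n: "bernoulli_number (2 * n) = (- 2 * fact (2 * n) * (c * c)) * Z2"
    by (simp only: nonzero_divide_eq_eq[OF fact_nonzero] mult_ac)
  have Bchi: "gen_bernoulli_number d chi n = (- 2 * fact n * c) * (r / of_nat d * of_nat d ^ n * L)"
    using attached_character_bernoulli[OF assms(1,3,4,6,5)]
    unfolding assms(2)[symmetric] c_def[symmetric] r_def[symmetric] L_def[symmetric]
    by (simp only: nonzero_divide_eq_eq[OF fact_nonzero] mult_ac)
  have powr: "of_nat p powr (- of_nat n) = (of_nat p powi (- int n) :: complex)" if "prime p" for p :: nat
    using of_nat_powr_minus_of_nat[of p n] prime_gt_0_nat[OF that] by (simp add: power_int_minus)
  have prods: "(\<Prod>p | prime p \<and> p dvd d. 1 + of_nat p powr (- of_nat n)) =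
                 (\<Prod>p | prime p \<and> p dvd d. 1 + of_nat p powi (- int n) :: complex)"
    "(\<Prod>p | prime p \<and> p dvd d. inverse (1 - of_nat p powr (- of_nat n))) =
       (\<Prod>p | prime p \<and> p dvd d. inverse (1 - of_nat p powi (- int n)) :: complex)"
    by (intro prod.cong refl; simp add: powr)+
  have bin: "fact (2 * n) = fact n * fact n * b"
    using binomial_fact_lemma[of n "2 * n"] unfolding b_def
    by (metis (no_types, lifting) add_diff_cancel_left' le_add1 mult_2 of_nat_fact of_nat_mult)
  have den: "gen_bernoulli_number d chi n * bernoulli_number n =
      (4 * fact n * fact n * (c * c) * (r / of_nat d * of_nat d ^ n)) * (Z * L)"
    unfolding Bn Bchi by (simp add: mult_ac)
  have "bernoulli_number (2 * n) / (gen_bernoulli_number d chi n * bernoulli_number n) =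
      ((- 2 * fact (2 * n) * (c * c)) * Z2) / ((4 * fact n * fact n * (c * c) * (r / of_nat d * of_nat d ^ n)) * (Z * L))"
    unfolding den B2n ..
  \<comment> \<open>The zeta and L values are split off as one block, so that afterwards only
    explicitly nonzero constants are cancelled. The powers of \<open>c\<close> match because
    \<open>bernoulli_number (2 * n)\<close> carries the exponent 2n.\<close>
  also have "\<dots> = ((- 2 * fact (2 * n) * (c * c)) / (4 * fact n * fact n * (c * c) * (r / of_nat d * of_nat d ^ n))) * (Z2 / (Z * L))"
    by (rule times_divide_times_eq[symmetric])
  also have "(- 2 * fact (2 * n) * (c * c)) / (4 * fact n * fact n * (c * c) * (r / of_nat d * of_nat d ^ n)) =
       - (b * r / (2 * of_nat d ^ n))"
    unfolding bin using nz r2[symmetric] by (simp add: field_simps)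
  finally have quot1: "bernoulli_number (2 * n) / (gen_bernoulli_number d chi n * bernoulli_number n) =
      - (b * r / (2 * of_nat d ^ n)) * (Z2 / (Z * L))" .
  have "- (2 * of_nat d ^ n / (b * r)) * (- (b * r / (2 * of_nat d ^ n)) * (Z2 / (Z * L))) = Z2 / (Z * L)"
    using nz by simp
  hence 1: "- (2 * of_nat d ^ n / (b * r)) * (bernoulli_number (2 * n) / (gen_bernoulli_number d chi n * bernoulli_number n)) = Z2 / (Z * L)"
    by (simp only: quot1)
  have "gen_bernoulli_number d chi n / bernoulli_number n = (r / of_nat d * of_nat d ^ n * L) / Z"
    unfolding Bn Bchi using nz by simp
  also have "r / of_nat d ^ n * \<dots> = (r * r) / of_nat d * (L / Z)" using nz by simp
  also have "\<dots> = L / Z" using nz by (simp add: r2)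
  finally have 2: "r / of_nat d ^ n * (gen_bernoulli_number d chi n / bernoulli_number n) = L / Z" .
  show ?thesis
    unfolding q1_def q2_def prods r_def[symmetric] b_def[symmetric] Z_def[symmetric] Z2_def[symmetric] L_def[symmetric] 1 2
    by simp
qed

end
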